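(* Let $\Gamma$ be a groupoid, $R$ a $\Gamma$-graded ring and $M$ a $\Gamma$-graded right $R$-module. The following statements hold: (1) If $R$ is gr-semilocal and $\mathrm{rad}^{\mathrm{gr}}(R)$ is right objectwise nilpotent, then: (a) $M$ is gr-noetherian $\Leftrightarrow$ $M$ is gr-artinian and finitely generated. (b) $M$ is $\Gamma_0$-noetherian $\Leftrightarrow$ $M$ is $\Gamma_0$-artinian and $\Gamma_0$-finitely generated. (c) $M$ is strongly $\Gamma_0$-noetherian $\Leftrightarrow$ $M$ is strongly $\Gamma_0$-artinian and $\Gamma_0$-finitely generated. (2) If $R$ is gr-semilocal and $\mathrm{rad}^{\mathrm{gr}}(R)$ is left objectwise nilpotent, then: (a) $M$ is gr-artinian $\Leftrightarrow$ $M$ is gr-noetherian and finitely gr-cogenerated. (b) $M$ is $\Gamma_0$-artinian $\Leftrightarrow$ $M$ is $\Gamma_0$-noetherian and $\Gamma_0$-finitely gr-cogenerated. (c) $M$ is strongly $\Gamma_0$-artinian $\Leftrightarrow$ $M$ is strongly $\Gamma_0$-noetherian and $\Gamma_0$-finitely gr-cogenerated.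
   Context: A groupoid $\Gamma$ is the set of morphisms of a small category in which all morphisms are invertible; $\Gamma_0\subseteq\Gamma$ is the set of identity morphisms; $d(\gamma)=\gamma^{-1}\gamma$, $r(\gamma)=\gamma\gamma^{-1}$; the product $\gamma\delta$ is defined iff $d(\gamma)=r(\delta)$. Rings are associative, not necessarily unital. A $\Gamma$-graded ring is a ring $R=\bigoplus_{\gamma\in\Gamma}R_\gamma$ (additive subgroups) with $R_\gamma R_\delta\subseteq R_{\gamma\delta}$ if $d(\gamma)=r(\delta)$ and $R_\gamma R_\delta=0$ otherwise; it is always assumed object unital: for each $e\in\Gamma_0$ the ring $R_e$ has an identity $1_e$ (possibly $0$) with $1_{r(\gamma)}a=a=a1_{d(\gamma)}$ for all $a\in R_\gamma$, $\gamma\in\Gamma$. A $\Gamma$-graded right $R$-module is a right $R$-module $M=\bigoplus_{\gamma}M_\gamma$ with $M_\sigma R_\tau\subseteq M_{\sigma\tau}$ if $d(\sigma)=r(\tau)$, $M_\sigma R_\tau=0$ otherwise, and $m1_{d(\sigma)}=m$ for $m\in M_\sigma$. A submodule (or one- or two-sided ideal) $N$ is graded if $N=\bigoplus_\gamma (N\cap M_\gamma)$. For $e\in\Gamma_0$, $M(e):=\bigoplus_{r(\gamma)=e}M_\gamma$, a graded submodule; $M=\bigoplus_{e\in\Gamma_0}M(e)$. A graded module is gr-artinian (gr-noetherian) if it has no infinite strictly decreasing (increasing) chain of graded submodules. It is finitely gr-cogenerated if every family $\{M_i\}_{i\in I}$ of graded submodules with $\bigcap_{i\in I}M_i=0$ has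 a finite subfamily with zero intersection. $M$ is $\Gamma_0$-artinian / $\Gamma_0$-noetherian / $\Gamma_0$-finitely generated / $\Gamma_0$-finitely gr-cogenerated if $M(e)$ is gr-artinian / gr-noetherian / finitely generated / finitely gr-cogenerated for every $e\in\Gamma_0$. $M$ is strongly $\Gamma_0$-artinian (resp. strongly $\Gamma_0$-noetherian) if there is no infinite strictly decreasing (resp. increasing) chain $\{M_i\}_{i\ge1}$ of graded submodules of $M$ such that for all $e\in\Gamma_0$ and $i\ge 1$: $M_i(e)=M_{i+1}(e)$ implies $M_i(e)=M_{i+l}(e)$ for all $l\ge1$. $\mathrm{rad}^{\mathrm{gr}}(R)$, the graded Jacobson radical, is the intersection of all gr-maximal graded right ideals (those maximal among proper graded right ideals); it is a graded two-sided ideal. A nonzero graded module is gr-simple if its only graded submodules are $0$ and itself; a graded module is gr-semisimple if it is a sum of gr-simple graded submodules; a graded ring is gr-semisimple if it is so as a right module over itself; $R$ is gr-semilocal if the graded ring $R/\mathrm{rad}^{\mathrm{gr}}(R)$ is gr-semisimple. A graded ideal $U$ is right (resp. left) objectwise nilpotent if for each $e\in\Gamma_0$ there is a positive integer $n_e$ with $1_eU^{n_e}=0$ (resp. $U^{n_e}1_e=0$). *)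

theory Defs
  imports "HOL-Algebra.QuotRing" "HOL-Algebra.Ideal_Product"
begin

section \<open>Groupoids\<close>

text \<open>A small category is presented by its set of morphisms; an object is identified with its
  identity morphism, so that domain and range of a morphism are again morphisms; by \<open>invertible\<close>
  below they are $\gamma^{-1}\gamma$ and $\gamma\gamma^{-1}$.
  The value of \<open>gcomp\<close> is relevant only on composable pairs.\<close>

record 'g groupoid =
  arrows :: "'g set"
  gdom :: "'g \<Rightarrow> 'g"
  gran :: "'g \<Rightarrow> 'g"
  gcomp :: "'g \<Rightarrow> 'g \<Rightarrow> 'g"

definition units :: "'g groupoid \<Rightarrow> 'g set"
  where "units \<Gamma> = gdom \<Gamma> ` arrows \<Gamma>"

locale groupoid =
  fixes \<Gamma> :: "'g groupoid"
  assumes dom_arrow: "\<gamma> \<in> arrows \<Gamma> \<Longrightarrow> gdom \<Gamma> \<gamma> \<in> arrows \<Gamma>"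
    and ran_arrow: "\<gamma> \<in> arrows \<Gamma> \<Longrightarrow> gran \<Gamma> \<gamma> \<in> arrows \<Gamma>"
    and dom_dom: "\<gamma> \<in> arrows \<Gamma> \<Longrightarrow> gdom \<Gamma> (gdom \<Gamma> \<gamma>) = gdom \<Gamma> \<gamma>"
    and ran_dom: "\<gamma> \<in> arrows \<Gamma> \<Longrightarrow> gran \<Gamma> (gdom \<Gamma> \<gamma>) = gdom \<Gamma> \<gamma>"
    and dom_ran: "\<gamma> \<in> arrows \<Gamma> \<Longrightarrow> gdom \<Gamma> (gran \<Gamma> \<gamma>) = gran \<Gamma> \<gamma>"
    and ran_ran: "\<gamma> \<in> arrows \<Gamma> \<Longrightarrow> gran \<Gamma> (gran \<Gamma> \<gamma>) = gran \<Gamma> \<gamma>"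
    and comp_arrow: "\<lbrakk>\<gamma> \<in> arrows \<Gamma>; \<delta> \<in> arrows \<Gamma>; gdom \<Gamma> \<gamma> = gran \<Gamma> \<delta>\<rbrakk>
      \<Longrightarrow> gcomp \<Gamma> \<gamma> \<delta> \<in> arrows \<Gamma>"
    and dom_comp: "\<lbrakk>\<gamma> \<in> arrows \<Gamma>; \<delta> \<in> arrows \<Gamma>; gdom \<Gamma> \<gamma> = gran \<Gamma> \<delta>\<rbrakk>
      \<Longrightarrow> gdom \<Gamma> (gcomp \<Gamma> \<gamma> \<delta>) = gdom \<Gamma> \<delta>"
    and ran_comp: "\<lbrakk>\<gamma> \<in> arrows \<Gamma>; \<delta> \<in> arrows \<Gamma>; gdom \<Gamma> \<gamma> = gran \<Gamma> \<delta>\<rbrakk>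
      \<Longrightarrow> gran \<Gamma> (gcomp \<Gamma> \<gamma> \<delta>) = gran \<Gamma> \<gamma>"
    and comp_assoc: "\<lbrakk>\<gamma> \<in> arrows \<Gamma>; \<delta> \<in> arrows \<Gamma>; \<epsilon> \<in> arrows \<Gamma>;
        gdom \<Gamma> \<gamma> = gran \<Gamma> \<delta>; gdom \<Gamma> \<delta> = gran \<Gamma> \<epsilon>\<rbrakk>
      \<Longrightarrow> gcomp \<Gamma> (gcomp \<Gamma> \<gamma> \<delta>) \<epsilon> = gcomp \<Gamma> \<gamma> (gcomp \<Gamma> \<delta> \<epsilon>)"
    and comp_dom: "\<gamma> \<in> arrows \<Gamma> \<Longrightarrow> gcomp \<Gamma> \<gamma> (gdom \<Gamma> \<gamma>) = \<gamma>"
    and ran_comp_self: "\<gamma> \<in> arrows \<Gamma> \<Longrightarrow> gcomp \<Gamma> (gran \<Gamma> \<gamma>) \<gamma> = \<gamma>"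
    and invertible: "\<gamma> \<in> arrows \<Gamma> \<Longrightarrow> \<exists>\<delta>\<in>arrows \<Gamma>.
        gdom \<Gamma> \<delta> = gran \<Gamma> \<gamma> \<and> gran \<Gamma> \<delta> = gdom \<Gamma> \<gamma> \<and>
        gcomp \<Gamma> \<delta> \<gamma> = gdom \<Gamma> \<gamma> \<and> gcomp \<Gamma> \<gamma> \<delta> = gran \<Gamma> \<gamma>"

section \<open>Sums of additive subgroups\<close>

definition sum_of :: "('a, 'x) ring_scheme \<Rightarrow> 'i set \<Rightarrow> ('i \<Rightarrow> 'a set) \<Rightarrow> 'a set"
  where "sum_of G I A =
    {finsum G f F | f F. finite F \<and> F \<subseteq> I \<and> (\<forall>i\<in>F. f i \<in> A i)}"

definition direct_sum_on :: "('a, 'x) ring_scheme \<Rightarrow> 'i set \<Rightarrow> ('i \<Rightarrow> 'a set) \<Rightarrow> 'a set \<Rightarrow> bool"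
  where "direct_sum_on G I A N \<longleftrightarrow>
    (\<forall>i\<in>I. subgroup (A i) (add_monoid G)) \<and>
    N = sum_of G I A \<and>
    (\<forall>f F. finite F \<and> F \<subseteq> I \<and> (\<forall>i\<in>F. f i \<in> A i) \<and> finsum G f F = \<zero>\<^bsub>G\<^esub>
      \<longrightarrow> (\<forall>i\<in>F. f i = \<zero>\<^bsub>G\<^esub>))"

section \<open>Graded rings and modules\<close>

text \<open>Rings need not be unital: the field \<^const>\<open>one\<close> of a ring record is ignored throughout, and
  so are the fields \<^const>\<open>one\<close> and \<^const>\<open>mult\<close> of a module record (which extends the
  ring record only for its additive structure, as HOL-Algebra does for left modules).\<close>

record ('g, 'a) gr_ring = "'a ring" +
  grade :: "'g \<Rightarrow> 'a set"

record ('g, 'r, 'm) gr_module = "('g, 'm) gr_ring" +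
  ract :: "'m \<Rightarrow> 'r \<Rightarrow> 'm" (infixl \<open>\<triangleleft>\<index>\<close> 70)

locale nonunital_ring = abelian_group R for R (structure) +
  assumes m_closed: "\<lbrakk>x \<in> carrier R; y \<in> carrier R\<rbrakk> \<Longrightarrow> x \<otimes> y \<in> carrier R"
    and m_assoc: "\<lbrakk>x \<in> carrier R; y \<in> carrier R; z \<in> carrier R\<rbrakk>
      \<Longrightarrow> (x \<otimes> y) \<otimes> z = x \<otimes> (y \<otimes> z)"
    and l_distr: "\<lbrakk>x \<in> carrier R; y \<in> carrier R; z \<in> carrier R\<rbrakk>
      \<Longrightarrow> (x \<oplus> y) \<otimes> z = x \<otimes> z \<oplus> y \<otimes> z"
    and r_distr: "\<lbrakk>x \<in> carrier R; y \<in> carrier R; z \<in> carrier R\<rbrakk>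
      \<Longrightarrow> z \<otimes> (x \<oplus> y) = z \<otimes> x \<oplus> z \<otimes> y"

definition is_obj_one :: "('g, 'r) gr_ring \<Rightarrow> 'g \<Rightarrow> 'r \<Rightarrow> bool"
  where "is_obj_one R e u \<longleftrightarrow>
    u \<in> grade R e \<and> (\<forall>a\<in>grade R e. u \<otimes>\<^bsub>R\<^esub> a = a \<and> a \<otimes>\<^bsub>R\<^esub> u = a)"

definition obj_one :: "('g, 'r) gr_ring \<Rightarrow> 'g \<Rightarrow> 'r"
  where "obj_one R e = (THE u. is_obj_one R e u)"

lemma is_obj_one_unique: "is_obj_one R e u \<Longrightarrow> is_obj_one R e v \<Longrightarrow> u = v"
  unfolding is_obj_one_def by metis

lemma obj_one_eq: "is_obj_one R e u \<Longrightarrow> obj_one R e = u"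
  unfolding obj_one_def by (blast intro: is_obj_one_unique)

locale graded_ring = groupoid \<Gamma> + nonunital_ring R
  for \<Gamma> :: "'g groupoid" and R :: "('g, 'r) gr_ring" (structure) +
  assumes grading: "direct_sum_on R (arrows \<Gamma>) (grade R) (carrier R)"
    and grade_mult: "\<lbrakk>\<gamma> \<in> arrows \<Gamma>; \<delta> \<in> arrows \<Gamma>; gdom \<Gamma> \<gamma> = gran \<Gamma> \<delta>;
        a \<in> grade R \<gamma>; b \<in> grade R \<delta>\<rbrakk> \<Longrightarrow> a \<otimes> b \<in> grade R (gcomp \<Gamma> \<gamma> \<delta>)"
    and grade_mult_zero: "\<lbrakk>\<gamma> \<in> arrows \<Gamma>; \<delta> \<in> arrows \<Gamma>; gdom \<Gamma> \<gamma> \<noteq> gran \<Gamma> \<delta>;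
        a \<in> grade R \<gamma>; b \<in> grade R \<delta>\<rbrakk> \<Longrightarrow> a \<otimes> b = \<zero>"
    and obj_one_exists: "e \<in> units \<Gamma> \<Longrightarrow> \<exists>u. is_obj_one R e u"
    and obj_one_left: "\<lbrakk>\<gamma> \<in> arrows \<Gamma>; a \<in> grade R \<gamma>\<rbrakk>
      \<Longrightarrow> obj_one R (gran \<Gamma> \<gamma>) \<otimes> a = a"
    and obj_one_right: "\<lbrakk>\<gamma> \<in> arrows \<Gamma>; a \<in> grade R \<gamma>\<rbrakk>
      \<Longrightarrow> a \<otimes> obj_one R (gdom \<Gamma> \<gamma>) = a"

locale right_module = R: nonunital_ring R + M: abelian_group M
  for R :: "('g, 'r) gr_ring" (structure) and M :: "('g, 'r, 'm) gr_module" (structure) +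
  assumes ract_closed: "\<lbrakk>x \<in> carrier M; a \<in> carrier R\<rbrakk> \<Longrightarrow> x \<triangleleft>\<^bsub>M\<^esub> a \<in> carrier M"
    and ract_l_distr: "\<lbrakk>x \<in> carrier M; y \<in> carrier M; a \<in> carrier R\<rbrakk>
      \<Longrightarrow> (x \<oplus>\<^bsub>M\<^esub> y) \<triangleleft>\<^bsub>M\<^esub> a = x \<triangleleft>\<^bsub>M\<^esub> a \<oplus>\<^bsub>M\<^esub> y \<triangleleft>\<^bsub>M\<^esub> a"
    and ract_r_distr: "\<lbrakk>x \<in> carrier M; a \<in> carrier R; b \<in> carrier R\<rbrakk>
      \<Longrightarrow> x \<triangleleft>\<^bsub>M\<^esub> (a \<oplus>\<^bsub>R\<^esub> b) = x \<triangleleft>\<^bsub>M\<^esub> a \<oplus>\<^bsub>M\<^esub> x \<triangleleft>\<^bsub>M\<^esub> b"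
    and ract_assoc: "\<lbrakk>x \<in> carrier M; a \<in> carrier R; b \<in> carrier R\<rbrakk>
      \<Longrightarrow> x \<triangleleft>\<^bsub>M\<^esub> (a \<otimes>\<^bsub>R\<^esub> b) = (x \<triangleleft>\<^bsub>M\<^esub> a) \<triangleleft>\<^bsub>M\<^esub> b"

locale graded_module = graded_ring \<Gamma> R + right_module R M
  for \<Gamma> :: "'g groupoid" and R :: "('g, 'r) gr_ring" (structure)
    and M :: "('g, 'r, 'm) gr_module" (structure) +
  assumes module_grading: "direct_sum_on M (arrows \<Gamma>) (grade M) (carrier M)"
    and grade_ract: "\<lbrakk>\<sigma> \<in> arrows \<Gamma>; \<tau> \<in> arrows \<Gamma>; gdom \<Gamma> \<sigma> = gran \<Gamma> \<tau>;
        x \<in> grade M \<sigma>; a \<in> grade R \<tau>\<rbrakk> \<Longrightarrow> x \<triangleleft>\<^bsub>M\<^esub> a \<in> grade M (gcomp \<Gamma> \<sigma> \<tau>)"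
    and grade_ract_zero: "\<lbrakk>\<sigma> \<in> arrows \<Gamma>; \<tau> \<in> arrows \<Gamma>; gdom \<Gamma> \<sigma> \<noteq> gran \<Gamma> \<tau>;
        x \<in> grade M \<sigma>; a \<in> grade R \<tau>\<rbrakk> \<Longrightarrow> x \<triangleleft>\<^bsub>M\<^esub> a = \<zero>\<^bsub>M\<^esub>"
    and ract_obj_one: "\<lbrakk>\<sigma> \<in> arrows \<Gamma>; x \<in> grade M \<sigma>\<rbrakk>
      \<Longrightarrow> x \<triangleleft>\<^bsub>M\<^esub> obj_one R (gdom \<Gamma> \<sigma>) = x"

section \<open>Submodules\<close>

definition right_submodule :: "('g, 'r) gr_ring \<Rightarrow> ('g, 'r, 'm) gr_module \<Rightarrow> 'm set \<Rightarrow> bool"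
  where "right_submodule R M N \<longleftrightarrow>
    subgroup N (add_monoid M) \<and> (\<forall>x\<in>N. \<forall>a\<in>carrier R. x \<triangleleft>\<^bsub>M\<^esub> a \<in> N)"

definition gr_submodule ::
  "'g groupoid \<Rightarrow> ('g, 'r) gr_ring \<Rightarrow> ('g, 'r, 'm) gr_module \<Rightarrow> 'm set \<Rightarrow> bool"
  where "gr_submodule \<Gamma> R M N \<longleftrightarrow>
    right_submodule R M N \<and> direct_sum_on M (arrows \<Gamma>) (\<lambda>\<gamma>. N \<inter> grade M \<gamma>) N"

text \<open>A graded submodule regarded as a graded module in its own right.\<close>

definition sub_module :: "('g, 'r, 'm) gr_module \<Rightarrow> 'm set \<Rightarrow> ('g, 'r, 'm) gr_module"
  where "sub_module M N = M\<lparr>carrier := N, grade := \<lambda>\<gamma>. N \<inter> grade M \<gamma>\<rparr>"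

text \<open>\<open>part \<Gamma> M e\<close> is the set underlying $M(e)$, and \<open>part_module \<Gamma> M e\<close> is the
  graded module $M(e)$.\<close>

definition part :: "'g groupoid \<Rightarrow> ('g, 'r, 'm) gr_module \<Rightarrow> 'g \<Rightarrow> 'm set"
  where "part \<Gamma> M e = sum_of M {\<gamma> \<in> arrows \<Gamma>. gran \<Gamma> \<gamma> = e} (grade M)"

definition part_module :: "'g groupoid \<Rightarrow> ('g, 'r, 'm) gr_module \<Rightarrow> 'g \<Rightarrow> ('g, 'r, 'm) gr_module"
  where "part_module \<Gamma> M e = sub_module M (part \<Gamma> M e)"

definition gen_submodule :: "('g, 'r) gr_ring \<Rightarrow> ('g, 'r, 'm) gr_module \<Rightarrow> 'm set \<Rightarrow> 'm set"
  where "gen_submodule R M X = \<Inter> {N. right_submodule R M N \<and> X \<subseteq> N}"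

definition fin_generated :: "('g, 'r) gr_ring \<Rightarrow> ('g, 'r, 'm) gr_module \<Rightarrow> bool"
  where "fin_generated R M \<longleftrightarrow>
    (\<exists>X. finite X \<and> X \<subseteq> carrier M \<and> gen_submodule R M X = carrier M)"

section \<open>Chain conditions\<close>

definition gr_artinian :: "'g groupoid \<Rightarrow> ('g, 'r) gr_ring \<Rightarrow> ('g, 'r, 'm) gr_module \<Rightarrow> bool"
  where "gr_artinian \<Gamma> R M \<longleftrightarrow>
    \<not> (\<exists>N :: nat \<Rightarrow> 'm set. (\<forall>i. gr_submodule \<Gamma> R M (N i)) \<and> (\<forall>i. N (Suc i) \<subset> N i))"

definition gr_noetherian :: "'g groupoid \<Rightarrow> ('g, 'r) gr_ring \<Rightarrow> ('g, 'r, 'm) gr_module \<Rightarrow> bool"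
  where "gr_noetherian \<Gamma> R M \<longleftrightarrow>
    \<not> (\<exists>N :: nat \<Rightarrow> 'm set. (\<forall>i. gr_submodule \<Gamma> R M (N i)) \<and> (\<forall>i. N i \<subset> N (Suc i)))"

text \<open>The intersection of an empty family of submodules of \<open>M\<close> is \<open>M\<close>.\<close>

definition fin_gr_cogenerated ::
  "'g groupoid \<Rightarrow> ('g, 'r) gr_ring \<Rightarrow> ('g, 'r, 'm) gr_module \<Rightarrow> bool"
  where "fin_gr_cogenerated \<Gamma> R M \<longleftrightarrow>
    (\<forall>\<F>. \<F> \<subseteq> Collect (gr_submodule \<Gamma> R M) \<and> carrier M \<inter> \<Inter>\<F> = {\<zero>\<^bsub>M\<^esub>} \<longrightarrow>
      (\<exists>\<G>. \<G> \<subseteq> \<F> \<and> finite \<G> \<and> carrier M \<inter> \<Inter>\<G> = {\<zero>\<^bsub>M\<^esub>}))"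

definition obj_artinian :: "'g groupoid \<Rightarrow> ('g, 'r) gr_ring \<Rightarrow> ('g, 'r, 'm) gr_module \<Rightarrow> bool"
  where "obj_artinian \<Gamma> R M \<longleftrightarrow> (\<forall>e\<in>units \<Gamma>. gr_artinian \<Gamma> R (part_module \<Gamma> M e))"

definition obj_noetherian :: "'g groupoid \<Rightarrow> ('g, 'r) gr_ring \<Rightarrow> ('g, 'r, 'm) gr_module \<Rightarrow> bool"
  where "obj_noetherian \<Gamma> R M \<longleftrightarrow> (\<forall>e\<in>units \<Gamma>. gr_noetherian \<Gamma> R (part_module \<Gamma> M e))"

definition obj_fin_generated :: "'g groupoid \<Rightarrow> ('g, 'r) gr_ring \<Rightarrow> ('g, 'r, 'm) gr_module \<Rightarrow> bool"
  where "obj_fin_generated \<Gamma> R M \<longleftrightarrow> (\<forall>e\<in>units \<Gamma>. fin_generated R (part_module \<Gamma> M e))"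

definition obj_fin_gr_cogenerated ::
  "'g groupoid \<Rightarrow> ('g, 'r) gr_ring \<Rightarrow> ('g, 'r, 'm) gr_module \<Rightarrow> bool"
  where "obj_fin_gr_cogenerated \<Gamma> R M \<longleftrightarrow>
    (\<forall>e\<in>units \<Gamma>. fin_gr_cogenerated \<Gamma> R (part_module \<Gamma> M e))"

text \<open>For a chain of graded submodules \<open>N i\<close>: as soon as the parts at \<open>e\<close> of two consecutive
  members agree, the parts at \<open>e\<close> are constant from there on.\<close>

definition obj_stable_chain ::
  "'g groupoid \<Rightarrow> ('g, 'r, 'm) gr_module \<Rightarrow> (nat \<Rightarrow> 'm set) \<Rightarrow> bool"
  where "obj_stable_chain \<Gamma> M N \<longleftrightarrow>
    (\<forall>e\<in>units \<Gamma>. \<forall>i.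
      part \<Gamma> (sub_module M (N i)) e = part \<Gamma> (sub_module M (N (Suc i))) e \<longrightarrow>
      (\<forall>l\<ge>1. part \<Gamma> (sub_module M (N i)) e = part \<Gamma> (sub_module M (N (i + l))) e))"

definition strongly_obj_artinian ::
  "'g groupoid \<Rightarrow> ('g, 'r) gr_ring \<Rightarrow> ('g, 'r, 'm) gr_module \<Rightarrow> bool"
  where "strongly_obj_artinian \<Gamma> R M \<longleftrightarrow>
    \<not> (\<exists>N :: nat \<Rightarrow> 'm set. (\<forall>i. gr_submodule \<Gamma> R M (N i)) \<and>
        (\<forall>i. N (Suc i) \<subset> N i) \<and> obj_stable_chain \<Gamma> M N)"

definition strongly_obj_noetherian ::
  "'g groupoid \<Rightarrow> ('g, 'r) gr_ring \<Rightarrow> ('g, 'r, 'm) gr_module \<Rightarrow> bool"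
  where "strongly_obj_noetherian \<Gamma> R M \<longleftrightarrow>
    \<not> (\<exists>N :: nat \<Rightarrow> 'm set. (\<forall>i. gr_submodule \<Gamma> R M (N i)) \<and>
        (\<forall>i. N i \<subset> N (Suc i)) \<and> obj_stable_chain \<Gamma> M N)"

section \<open>Semisimplicity and the graded Jacobson radical\<close>

text \<open>The ring as a right module over itself; its graded submodules are the graded right ideals.\<close>

definition regular_module :: "('g, 'r) gr_ring \<Rightarrow> ('g, 'r, 'r) gr_module"
  where "regular_module R =
    \<lparr>carrier = carrier R, mult = mult R, one = one R, zero = zero R, add = add R,
     grade = grade R, ract = mult R\<rparr>"

definition gr_simple :: "'g groupoid \<Rightarrow> ('g, 'r) gr_ring \<Rightarrow> ('g, 'r, 'm) gr_module \<Rightarrow> bool"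
  where "gr_simple \<Gamma> R M \<longleftrightarrow> carrier M \<noteq> {\<zero>\<^bsub>M\<^esub>} \<and>
    (\<forall>N. gr_submodule \<Gamma> R M N \<longrightarrow> N = {\<zero>\<^bsub>M\<^esub>} \<or> N = carrier M)"

definition gr_semisimple :: "'g groupoid \<Rightarrow> ('g, 'r) gr_ring \<Rightarrow> ('g, 'r, 'm) gr_module \<Rightarrow> bool"
  where "gr_semisimple \<Gamma> R M \<longleftrightarrow>
    (\<exists>\<S>. (\<forall>S\<in>\<S>. gr_submodule \<Gamma> R M S \<and> gr_simple \<Gamma> R (sub_module M S)) \<and>
      sum_of M \<S> (\<lambda>S. S) = carrier M)"

definition gr_semisimple_ring :: "'g groupoid \<Rightarrow> ('g, 'r) gr_ring \<Rightarrow> bool"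
  where "gr_semisimple_ring \<Gamma> R \<longleftrightarrow> gr_semisimple \<Gamma> R (regular_module R)"

definition gr_right_ideal :: "'g groupoid \<Rightarrow> ('g, 'r) gr_ring \<Rightarrow> 'r set \<Rightarrow> bool"
  where "gr_right_ideal \<Gamma> R J \<longleftrightarrow> gr_submodule \<Gamma> R (regular_module R) J"

definition gr_maximal_right_ideal :: "'g groupoid \<Rightarrow> ('g, 'r) gr_ring \<Rightarrow> 'r set \<Rightarrow> bool"
  where "gr_maximal_right_ideal \<Gamma> R J \<longleftrightarrow>
    gr_right_ideal \<Gamma> R J \<and> J \<noteq> carrier R \<and>
    (\<forall>K. gr_right_ideal \<Gamma> R K \<and> K \<noteq> carrier R \<and> J \<subseteq> K \<longrightarrow> K = J)"

definition gr_radical :: "'g groupoid \<Rightarrow> ('g, 'r) gr_ring \<Rightarrow> 'r set"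
  where "gr_radical \<Gamma> R = carrier R \<inter> \<Inter> {J. gr_maximal_right_ideal \<Gamma> R J}"

text \<open>\<open>R/I\<close>, graded by the images of the homogeneous components.\<close>

definition gr_quotient_ring :: "('g, 'r) gr_ring \<Rightarrow> 'r set \<Rightarrow> ('g, 'r set) gr_ring"
  where "gr_quotient_ring R I =
    ring.extend (R Quot I) (gr_ring.fields (\<lambda>\<gamma>. (\<lambda>a. I +>\<^bsub>R\<^esub> a) ` grade R \<gamma>))"

definition gr_semilocal :: "'g groupoid \<Rightarrow> ('g, 'r) gr_ring \<Rightarrow> bool"
  where "gr_semilocal \<Gamma> R \<longleftrightarrow>
    gr_semisimple_ring \<Gamma> (gr_quotient_ring R (gr_radical \<Gamma> R))"

section \<open>Objectwise nilpotency\<close>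

text \<open>The power $U^n$, meaningful for $n \geq 1$ only, since there is no natural $U^0$ in a
  non-unital ring.\<close>

definition ideal_pow :: "('g, 'r) gr_ring \<Rightarrow> 'r set \<Rightarrow> nat \<Rightarrow> 'r set"
  where "ideal_pow R U n = ((\<lambda>V. ideal_prod R V U) ^^ (n - 1)) U"

definition right_obj_nilpotent :: "'g groupoid \<Rightarrow> ('g, 'r) gr_ring \<Rightarrow> 'r set \<Rightarrow> bool"
  where "right_obj_nilpotent \<Gamma> R U \<longleftrightarrow>
    (\<forall>e\<in>units \<Gamma>. \<exists>n\<ge>1. \<forall>x\<in>ideal_pow R U n. obj_one R e \<otimes>\<^bsub>R\<^esub> x = \<zero>\<^bsub>R\<^esub>)"

definition left_obj_nilpotent :: "'g groupoid \<Rightarrow> ('g, 'r) gr_ring \<Rightarrow> 'r set \<Rightarrow> bool"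
  where "left_obj_nilpotent \<Gamma> R U \<longleftrightarrow>
    (\<forall>e\<in>units \<Gamma>. \<exists>n\<ge>1. \<forall>x\<in>ideal_pow R U n. x \<otimes>\<^bsub>R\<^esub> obj_one R e = \<zero>\<^bsub>R\<^esub>)"

end

theory Submission
  imports Defs
begin

text \<open>Write $J$ for the graded radical. Since $R/J$ is gr-semisimple, every interval $[B, A]$ of
  graded submodules with $AJ \subseteq B$ is relatively complemented, so that passing to
  complements turns ascending chains into descending ones and conversely. Hence, if $MJ^n = 0$ for
  some $n$, then $M$ is gr-artinian if and only if it is gr-noetherian. If $1_e J^{n_e} = 0$, then
  each homogeneous element is annihilated by a power of $J$, and one power suffices for
  finitely many generators. If $J^{n_e} 1_e = 0$, then $\bigcap_n MJ^n = 0$, and finite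
  cogeneration makes the chain $MJ^n$ reach $0$. The objectwise statements follow by
  applying this to each $M(e)$. For the strong versions, once all $M(e)$ are both gr-artinian and
  gr-noetherian, each part of an objectwise stable chain is eventually constant, so the chain can be
  run backwards part by part.\<close>

section \<open>Homogeneous components\<close>

text \<open>Since R has no global identity, the way back from x R to x is the equation x = x
  1_{d(\<sigma>)} for homogeneous x of degree \<sigma>. This fixes the method: arguments test
  homogeneous elements, for which t -> x t shifts degrees by \<sigma> and therefore carries graded
  right ideals to graded submodules and pulls graded submodules back to graded right ideals. The
  same shift shows that J is also a left ideal, without which R/J is not a ring. Semisimplicity is
  given for R/J as a right module over itself. It is pulled back to right ideals T of R that are
  minimal above J; a maximal submodule with prescribed intersection is a complement in M because any
  failure would be witnessed by some x T that could still be added. Quotient modules of M never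
  occur: a factor A/B is represented by the interval [B, A], and the modular law takes over the role
  of the isomorphism theorems. Arbitrary complements of nested submodules need not be nested, so
  they are chosen recursively, each relative to the previous one. In the strong versions no single n
  with M J^n = 0 need serve all objects at once, so the chain itself is reversed there instead of
  its complements being taken.\<close>

locale internal_direct_sum = abelian_group G for G (structure) +
  fixes I :: "'i set" and A :: "'i \<Rightarrow> 'a set"
  assumes direct: "direct_sum_on G I A (carrier G)"
begin

text \<open>\<open>f\<close> is total and zero outside \<open>F\<close>, so \<open>x\<close>
  determines \<open>f\<close>. It does not determine \<open>F\<close>, which may be enlarged by
  indices of value zero; this lets two decompositions be compared on a common index set.\<close>

definition decomp :: "'a \<Rightarrow> ('i \<Rightarrow> 'a) \<Rightarrow> 'i set \<Rightarrow> bool"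
  where "decomp x f F \<longleftrightarrow> finite F \<and> F \<subseteq> I \<and> (\<forall>i\<in>F. f i \<in> A i) \<and> (\<forall>i. i \<notin> F \<longrightarrow> f i = \<zero>)
    \<and> x = finsum G f F"

definition component :: "'a \<Rightarrow> 'i \<Rightarrow> 'a"
  where "component x = (THE f. \<exists>F. decomp x f F)"

lemma summand_subgroup: "i \<in> I \<Longrightarrow> subgroup (A i) (add_monoid G)"
  using direct unfolding direct_sum_on_def by blast

lemma summand_carrier: "i \<in> I \<Longrightarrow> a \<in> A i \<Longrightarrow> a \<in> carrier G"
  using subgroup.subset[OF summand_subgroup] by auto

lemma summand_zero: "i \<in> I \<Longrightarrow> \<zero> \<in> A i"
  using subgroup.one_closed[OF summand_subgroup] by auto

lemma summand_add: "i \<in> I \<Longrightarrow> a \<in> A i \<Longrightarrow> b \<in> A i \<Longrightarrow> a \<oplus> b \<in> A i"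
  using subgroup.m_closed[OF summand_subgroup] by auto

lemma summand_minus: "i \<in> I \<Longrightarrow> a \<in> A i \<Longrightarrow> \<ominus> a \<in> A i"
  using subgroup.m_inv_closed[OF summand_subgroup] by (auto simp: a_inv_def)

lemma decomp_mem: "decomp x f F \<Longrightarrow> i \<in> I \<Longrightarrow> f i \<in> A i"
  using summand_zero unfolding decomp_def by (cases "i \<in> F") auto

lemma decomp_carrier: "decomp x f F \<Longrightarrow> f i \<in> carrier G"
  using summand_carrier unfolding decomp_def by (cases "i \<in> F") auto

lemma finsum_extend:
  assumes "finite H" "F \<subseteq> H" "f \<in> H \<rightarrow> carrier G" "\<And>i. i \<in> H \<Longrightarrow> i \<notin> F \<Longrightarrow> f i = \<zero>"
  shows "finsum G f H = finsum G f F"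
proof (rule add.finprod_mono_neutral_cong_right[OF assms(1-2)])
  show "\<And>i. i \<in> H - F \<Longrightarrow> f i = \<zero>" using assms(4) by blast
qed (use assms(3) in auto)

lemma decomp_extend:
  assumes "decomp x f F" "finite H" "F \<subseteq> H" "H \<subseteq> I"
  shows "decomp x f H"
proof -
  have "finsum G f H = finsum G f F"
    by (rule finsum_extend) (use assms decomp_carrier in \<open>auto simp: decomp_def\<close>)
  then show ?thesis using assms decomp_mem[OF assms(1)] unfolding decomp_def by auto
qed

lemma decomp_exists:
  assumes "x \<in> carrier G"
  shows "\<exists>f F. decomp x f F"
proof -
  have "x \<in> sum_of G I A" using direct assms unfolding direct_sum_on_def by auto
  then obtain f F where f: "x = finsum G f F" "finite F" "F \<subseteq> I" "\<forall>i\<in>F. f i \<in> A i"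
    unfolding sum_of_def by blast
  let ?g = "\<lambda>i. if i \<in> F then f i else \<zero>"
  have "finsum G f F = finsum G ?g F"
    by (rule finsum_cong') (use f summand_carrier in auto)
  then have "decomp x ?g F" unfolding decomp_def using f by auto
  then show ?thesis by blast
qed

lemma decomp_add:
  assumes "decomp x f F" "decomp y g H"
  shows "decomp (x \<oplus> y) (\<lambda>i. f i \<oplus> g i) (F \<union> H)"
proof -
  have "finite F" "finite H" "F \<subseteq> I" "H \<subseteq> I" using assms unfolding decomp_def by auto
  then have d: "decomp x f (F \<union> H)" "decomp y g (F \<union> H)"
    by (simp_all add: decomp_extend[OF assms(1)] decomp_extend[OF assms(2)])
  have "finsum G (\<lambda>i. f i \<oplus> g i) (F \<union> H) = finsum G f (F \<union> H) \<oplus> finsum G g (F \<union> H)"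
    by (rule finsum_addf) (use decomp_carrier[OF assms(1)] decomp_carrier[OF assms(2)] in auto)
  moreover have "f i \<oplus> g i \<in> A i" if "i \<in> I" for i
    using decomp_mem d summand_add that by blast
  ultimately show ?thesis
    using d unfolding decomp_def by auto
qed

lemma decomp_zero: "decomp \<zero> f F \<Longrightarrow> f = (\<lambda>_. \<zero>)"
proof
  fix i assume d: "decomp \<zero> f F"
  then have "\<forall>i\<in>F. f i = \<zero>" using direct unfolding direct_sum_on_def decomp_def by auto
  with d show "f i = \<zero>" unfolding decomp_def by blast
qed

lemma decomp_minus:
  assumes "decomp x f F"
  shows "decomp (\<ominus> x) (\<lambda>i. \<ominus> f i) F"
proof -
  have c: "f i \<in> carrier G" for i using decomp_carrier[OF assms] .
  have "finsum G (\<lambda>i. \<ominus> f i) F \<oplus> finsum G f F = \<zero>"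
    using finsum_addf[of "\<lambda>i. \<ominus> f i" F f] c by (simp add: l_neg)
  then have "finsum G (\<lambda>i. \<ominus> f i) F = \<ominus> x"
    using c assms minus_equality unfolding decomp_def by auto
  then show ?thesis using assms summand_minus unfolding decomp_def by auto
qed

lemma decomp_unique:
  assumes "decomp x f F" "decomp x g H"
  shows "f = g"
proof -
  have x: "x \<in> carrier G" using assms(1) decomp_carrier[OF assms(1)] unfolding decomp_def by auto
  have "decomp (x \<oplus> \<ominus> x) (\<lambda>i. f i \<oplus> \<ominus> g i) (F \<union> H)"
    using assms decomp_add decomp_minus by blast
  then have "(\<lambda>i. f i \<oplus> \<ominus> g i) = (\<lambda>_. \<zero>)" using decomp_zero x by (simp add: r_neg)
  then have "f i \<oplus> \<ominus> g i = \<zero>" for i by meson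
  then show ?thesis
    using decomp_carrier[OF assms(1)] decomp_carrier[OF assms(2)]
    by (metis (no_types) a_inv_closed minus_equality minus_minus ext)
qed

lemma component_eq: "decomp x f F \<Longrightarrow> component x = f"
  unfolding component_def by (rule the_equality) (auto intro: decomp_unique)

lemma decomp_component: "x \<in> carrier G \<Longrightarrow> \<exists>F. decomp x (component x) F"
  using decomp_exists component_eq by metis

lemma component_mem: "x \<in> carrier G \<Longrightarrow> i \<in> I \<Longrightarrow> component x i \<in> A i"
  using decomp_component decomp_mem by blast

lemma component_carrier: "x \<in> carrier G \<Longrightarrow> component x i \<in> carrier G"
  using decomp_component decomp_carrier by blast

lemma component_add:
  "x \<in> carrier G \<Longrightarrow> y \<in> carrier G \<Longrightarrow> component (x \<oplus> y) i = component x i \<oplus> component y i"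
  by (metis (no_types, lifting) decomp_component decomp_add[THEN component_eq])

lemma component_minus: "x \<in> carrier G \<Longrightarrow> component (\<ominus> x) i = \<ominus> component x i"
  by (metis (no_types, lifting) decomp_component decomp_minus[THEN component_eq])

lemma component_homogeneous:
  assumes "i \<in> I" "a \<in> A i"
  shows "component a j = (if j = i then a else \<zero>)"
proof -
  have "decomp a (\<lambda>j. if j = i then a else \<zero>) {i}"
    using assms summand_carrier finsum_insert[of "{}" i "\<lambda>j. if j = i then a else \<zero>"]
    by (simp add: decomp_def)
  from component_eq[OF this] show ?thesis by simp
qed

lemma component_zero: "component \<zero> i = \<zero>"
proof -
  obtain F where "decomp \<zero> (component \<zero>) F" using decomp_component by blast
  then show ?thesis using decomp_zero by metis
qed

text \<open>\<open>N\<close> need only be closed under addition and contain zero. It is mostly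
  applied to a set defined by the property to be proved, which reduces an additive property of
  \<open>x\<close> to its homogeneous components.\<close>

lemma mem_if_components:
  assumes "x \<in> carrier G" "\<zero> \<in> N" "\<And>a b. a \<in> N \<Longrightarrow> b \<in> N \<Longrightarrow> a \<oplus> b \<in> N"
    and "\<And>i. i \<in> I \<Longrightarrow> component x i \<in> N"
  shows "x \<in> N"
proof -
  obtain F where F: "decomp x (component x) F" using decomp_component assms(1) by blast
  have "finsum G (component x) H \<in> N" if "finite H" "H \<subseteq> I" for H
    using that
  proof (induction H)
    case (insert i H)
    then have "finsum G (component x) (insert i H) = component x i \<oplus> finsum G (component x) H"
      using component_carrier[OF assms(1)] by (intro finsum_insert) auto
    then show ?case using insert assms(3,4) by simp
  qed (use assms in simp)
  then show ?thesis using F unfolding decomp_def by metis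
qed

lemma finsum_mem:
  assumes "\<zero> \<in> N" "\<And>a b. a \<in> N \<Longrightarrow> b \<in> N \<Longrightarrow> a \<oplus> b \<in> N" "N \<subseteq> carrier G" "finite F"
    and "\<And>i. i \<in> F \<Longrightarrow> f i \<in> N"
  shows "finsum G f F \<in> N"
  using assms(4,5)
proof (induction F)
  case (insert i F)
  then have "finsum G f (insert i F) = f i \<oplus> finsum G f F"
    using assms(3) by (intro finsum_insert) auto
  then show ?case using insert assms by simp
qed (use assms in simp)

lemma homogeneous_induct [consumes 1, case_names zero homogeneous add]:
  assumes "x \<in> carrier G" "P \<zero>" "\<And>i a. i \<in> I \<Longrightarrow> a \<in> A i \<Longrightarrow> P a"
    and "\<And>x y. x \<in> carrier G \<Longrightarrow> y \<in> carrier G \<Longrightarrow> P x \<Longrightarrow> P y \<Longrightarrow> P (x \<oplus> y)"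
  shows "P x"
proof -
  have "x \<in> {x \<in> carrier G. P x}"
    by (rule mem_if_components)
      (use assms component_mem[OF assms(1)] component_carrier[OF assms(1)] in auto)
  then show ?thesis by simp
qed

text \<open>Independence of the summands \<open>N \<inter> A i\<close> is inherited from the ambient
  grading, so only the spanning condition says anything about \<open>N\<close>. This replaces
  gradedness by a closure property that can be checked element by element.\<close>

lemma direct_sum_on_subgroup_iff:
  assumes "subgroup N (add_monoid G)"
  shows "direct_sum_on G I (\<lambda>i. N \<inter> A i) N \<longleftrightarrow> (\<forall>x\<in>N. \<forall>i\<in>I. component x i \<in> N)"
proof -
  have N: "N \<subseteq> carrier G" "\<zero> \<in> N" "\<And>a b. a \<in> N \<Longrightarrow> b \<in> N \<Longrightarrow> a \<oplus> b \<in> N"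
    using subgroup.subset[OF assms] subgroup.one_closed[OF assms] subgroup.m_closed[OF assms]
    by auto
  show ?thesis
  proof
    assume d: "direct_sum_on G I (\<lambda>i. N \<inter> A i) N"
    show "\<forall>x\<in>N. \<forall>i\<in>I. component x i \<in> N"
    proof (intro ballI)
      fix x i assume "x \<in> N" "i \<in> I"
      then have "x \<in> sum_of G I (\<lambda>i. N \<inter> A i)" using d unfolding direct_sum_on_def by auto
      then obtain f F where f: "x = finsum G f F" "finite F" "F \<subseteq> I" "\<forall>i\<in>F. f i \<in> N \<inter> A i"
        unfolding sum_of_def by blast
      let ?g = "\<lambda>i. if i \<in> F then f i else \<zero>"
      have "finsum G f F = finsum G ?g F"
        by (rule finsum_cong') (use f N(1) in auto)
      then have "decomp x ?g F" unfolding decomp_def using f by auto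
      then show "component x i \<in> N" using component_eq f N by auto
    qed
  next
    assume c: "\<forall>x\<in>N. \<forall>i\<in>I. component x i \<in> N"
    have "N = sum_of G I (\<lambda>i. N \<inter> A i)"
    proof (intro equalityI subsetI)
      fix x assume x: "x \<in> N"
      then obtain F where F: "decomp x (component x) F" using decomp_component N(1) by blast
      moreover have "\<forall>i\<in>F. component x i \<in> N \<inter> A i"
        using F c x N(1) component_mem unfolding decomp_def by auto
      ultimately show "x \<in> sum_of G I (\<lambda>i. N \<inter> A i)"
        unfolding sum_of_def decomp_def by blast
    next
      fix x assume "x \<in> sum_of G I (\<lambda>i. N \<inter> A i)"
      then obtain f F where f: "x = finsum G f F" "finite F" "F \<subseteq> I" "\<forall>i\<in>F. f i \<in> N \<inter> A i"
        unfolding sum_of_def by blast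
      then show "x \<in> N" using finsum_mem[OF N(2,3,1) f(2), of f] by simp
    qed
    moreover have "\<forall>i\<in>I. subgroup (N \<inter> A i) (add_monoid G)"
      using add.subgroups_Inter_pair[OF assms summand_subgroup] by blast
    moreover have "\<forall>f F. finite F \<and> F \<subseteq> I \<and> (\<forall>i\<in>F. f i \<in> N \<inter> A i) \<and> finsum G f F = \<zero>
      \<longrightarrow> (\<forall>i\<in>F. f i = \<zero>)"
      using direct unfolding direct_sum_on_def by blast
    ultimately show "direct_sum_on G I (\<lambda>i. N \<inter> A i) N" unfolding direct_sum_on_def by blast
  qed
qed

end

section \<open>Graded submodules\<close>

lemma (in graded_ring) ring_direct_sum: "internal_direct_sum R (arrows \<Gamma>) (grade R)"
  by (simp add: internal_direct_sum.intro internal_direct_sum_axioms.intro grading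
      abelian_group_axioms)

sublocale graded_ring \<subseteq> RC: internal_direct_sum R "arrows \<Gamma>" "grade R"
  by (rule ring_direct_sum)

sublocale graded_module \<subseteq> MC: internal_direct_sum M "arrows \<Gamma>" "grade M"
  by (simp add: internal_direct_sum.intro internal_direct_sum_axioms.intro module_grading
      M.abelian_group_axioms)

section \<open>Left translation in a groupoid\<close>

context groupoid
begin

lemma units_arrow: "e \<in> units \<Gamma> \<Longrightarrow> e \<in> arrows \<Gamma>"
  unfolding units_def using dom_arrow by auto

lemma dom_unit: "\<gamma> \<in> arrows \<Gamma> \<Longrightarrow> gdom \<Gamma> \<gamma> \<in> units \<Gamma>"
  unfolding units_def by auto

lemma ran_unit: "\<gamma> \<in> arrows \<Gamma> \<Longrightarrow> gran \<Gamma> \<gamma> \<in> units \<Gamma>"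
  by (metis dom_ran dom_unit ran_arrow)

text \<open>Multiply by an inverse of \<sigma>. Together with \<open>comp_left_solve\<close>, where
  the solution is \<delta> = \<sigma>^{-1} \<gamma>, this makes \<delta> -> \<sigma> \<delta> a
  bijection from the arrows of range d(\<sigma>) to those of range r(\<sigma>).\<close>

lemma comp_left_cancel:
  assumes "\<sigma> \<in> arrows \<Gamma>" "\<delta> \<in> arrows \<Gamma>" "\<epsilon> \<in> arrows \<Gamma>"
    and "gdom \<Gamma> \<sigma> = gran \<Gamma> \<delta>" "gdom \<Gamma> \<sigma> = gran \<Gamma> \<epsilon>" "gcomp \<Gamma> \<sigma> \<delta> = gcomp \<Gamma> \<sigma> \<epsilon>"
  shows "\<delta> = \<epsilon>"
proof -
  obtain \<tau> where t: "\<tau> \<in> arrows \<Gamma>" "gdom \<Gamma> \<tau> = gran \<Gamma> \<sigma>" "gcomp \<Gamma> \<tau> \<sigma> = gdom \<Gamma> \<sigma>"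
    using invertible[OF assms(1)] by blast
  have "gcomp \<Gamma> \<tau> (gcomp \<Gamma> \<sigma> \<epsilon>') = \<epsilon>'" if "\<epsilon>' \<in> arrows \<Gamma>" "gdom \<Gamma> \<sigma> = gran \<Gamma> \<epsilon>'" for \<epsilon>'
    using comp_assoc[OF t(1) assms(1) that(1) t(2) that(2)] t(3) ran_comp_self[OF that(1)] that(2)
    by simp
  then show ?thesis using assms by metis
qed

lemma comp_left_solve:
  assumes "\<sigma> \<in> arrows \<Gamma>" "\<gamma> \<in> arrows \<Gamma>" "gran \<Gamma> \<gamma> = gran \<Gamma> \<sigma>"
  shows "\<exists>\<delta>\<in>arrows \<Gamma>. gdom \<Gamma> \<sigma> = gran \<Gamma> \<delta> \<and> gcomp \<Gamma> \<sigma> \<delta> = \<gamma>"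
proof -
  obtain \<tau> where t: "\<tau> \<in> arrows \<Gamma>" "gdom \<Gamma> \<tau> = gran \<Gamma> \<sigma>" "gran \<Gamma> \<tau> = gdom \<Gamma> \<sigma>"
    "gcomp \<Gamma> \<sigma> \<tau> = gran \<Gamma> \<sigma>"
    using invertible[OF assms(1)] by blast
  have 1: "gdom \<Gamma> \<tau> = gran \<Gamma> \<gamma>" "gdom \<Gamma> \<sigma> = gran \<Gamma> \<tau>" using t assms by auto
  have "gcomp \<Gamma> \<sigma> (gcomp \<Gamma> \<tau> \<gamma>) = gcomp \<Gamma> (gcomp \<Gamma> \<sigma> \<tau>) \<gamma>"
    using comp_assoc[OF assms(1) t(1) assms(2) 1(2) 1(1)] by simp
  also have "\<dots> = \<gamma>" using t(4) assms(3) ran_comp_self[OF assms(2)] by simp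
  finally show ?thesis
    using comp_arrow[OF t(1) assms(2) 1(1)] ran_comp[OF t(1) assms(2) 1(1)] 1(2) by metis
qed

end

section \<open>Zero and negatives under the action\<close>

context right_module
begin

lemma ract_zero [simp]:
  assumes "x \<in> carrier M"
  shows "x \<triangleleft>\<^bsub>M\<^esub> \<zero>\<^bsub>R\<^esub> = \<zero>\<^bsub>M\<^esub>"
proof -
  have c: "x \<triangleleft>\<^bsub>M\<^esub> \<zero>\<^bsub>R\<^esub> \<in> carrier M" using assms ract_closed by simp
  have "x \<triangleleft>\<^bsub>M\<^esub> \<zero>\<^bsub>R\<^esub> \<oplus>\<^bsub>M\<^esub> x \<triangleleft>\<^bsub>M\<^esub> \<zero>\<^bsub>R\<^esub> = x \<triangleleft>\<^bsub>M\<^esub> \<zero>\<^bsub>R\<^esub>"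
    using ract_r_distr[OF assms R.zero_closed R.zero_closed] by simp
  then show ?thesis using c by (metis M.add.l_cancel_one)
qed

lemma zero_ract [simp]:
  assumes "a \<in> carrier R"
  shows "\<zero>\<^bsub>M\<^esub> \<triangleleft>\<^bsub>M\<^esub> a = \<zero>\<^bsub>M\<^esub>"
proof -
  have c: "\<zero>\<^bsub>M\<^esub> \<triangleleft>\<^bsub>M\<^esub> a \<in> carrier M" using assms ract_closed by simp
  have "\<zero>\<^bsub>M\<^esub> \<triangleleft>\<^bsub>M\<^esub> a \<oplus>\<^bsub>M\<^esub> \<zero>\<^bsub>M\<^esub> \<triangleleft>\<^bsub>M\<^esub> a = \<zero>\<^bsub>M\<^esub> \<triangleleft>\<^bsub>M\<^esub> a"
    using ract_l_distr[OF M.zero_closed M.zero_closed assms] by simp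
  then show ?thesis using c by (metis M.add.l_cancel_one)
qed

lemma minus_ract:
  assumes "x \<in> carrier M" "a \<in> carrier R"
  shows "(\<ominus>\<^bsub>M\<^esub> x) \<triangleleft>\<^bsub>M\<^esub> a = \<ominus>\<^bsub>M\<^esub> (x \<triangleleft>\<^bsub>M\<^esub> a)"
proof -
  have "(\<ominus>\<^bsub>M\<^esub> x) \<triangleleft>\<^bsub>M\<^esub> a \<oplus>\<^bsub>M\<^esub> x \<triangleleft>\<^bsub>M\<^esub> a = \<zero>\<^bsub>M\<^esub>"
    using ract_l_distr[of "\<ominus>\<^bsub>M\<^esub> x" x a] assms by (simp add: M.l_neg)
  then show ?thesis using assms ract_closed by (metis M.a_inv_closed M.minus_equality)
qed

lemma ract_minus:
  assumes "x \<in> carrier M" "a \<in> carrier R"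
  shows "x \<triangleleft>\<^bsub>M\<^esub> (\<ominus>\<^bsub>R\<^esub> a) = \<ominus>\<^bsub>M\<^esub> (x \<triangleleft>\<^bsub>M\<^esub> a)"
proof -
  have "x \<triangleleft>\<^bsub>M\<^esub> (\<ominus>\<^bsub>R\<^esub> a) \<oplus>\<^bsub>M\<^esub> x \<triangleleft>\<^bsub>M\<^esub> a = \<zero>\<^bsub>M\<^esub>"
    using ract_r_distr[of x "\<ominus>\<^bsub>R\<^esub> a" a] assms by (simp add: R.l_neg)
  then show ?thesis using assms ract_closed by (metis R.a_inv_closed M.minus_equality)
qed

end

lemma (in abelian_group) subgroup_add_monoid_iff:
  "subgroup N (add_monoid G) \<longleftrightarrow> N \<subseteq> carrier G \<and> \<zero> \<in> N \<and> (\<forall>x\<in>N. \<forall>y\<in>N. x \<oplus> y \<in> N) \<and>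
    (\<forall>x\<in>N. \<ominus> x \<in> N)"
  unfolding subgroup_def a_inv_def by auto

context graded_module
begin

lemma gr_submodule_iff:
  "gr_submodule \<Gamma> R M N \<longleftrightarrow> N \<subseteq> carrier M \<and> \<zero>\<^bsub>M\<^esub> \<in> N \<and> (\<forall>x\<in>N. \<forall>y\<in>N. x \<oplus>\<^bsub>M\<^esub> y \<in> N) \<and>
    (\<forall>x\<in>N. \<ominus>\<^bsub>M\<^esub> x \<in> N) \<and> (\<forall>x\<in>N. \<forall>a\<in>carrier R. x \<triangleleft>\<^bsub>M\<^esub> a \<in> N) \<and>
    (\<forall>x\<in>N. \<forall>\<gamma>\<in>arrows \<Gamma>. MC.component x \<gamma> \<in> N)"
proof (cases "subgroup N (add_monoid M)")
  case True
  then show ?thesis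
    using MC.direct_sum_on_subgroup_iff[OF True] M.subgroup_add_monoid_iff[of N]
    by (simp add: gr_submodule_def right_submodule_def)
next
  case False
  then show ?thesis
    unfolding gr_submodule_def right_submodule_def M.subgroup_add_monoid_iff by argo
qed

lemma gr_submoduleI:
  assumes "N \<subseteq> carrier M" "\<zero>\<^bsub>M\<^esub> \<in> N" "\<And>x y. x \<in> N \<Longrightarrow> y \<in> N \<Longrightarrow> x \<oplus>\<^bsub>M\<^esub> y \<in> N"
    and "\<And>x. x \<in> N \<Longrightarrow> \<ominus>\<^bsub>M\<^esub> x \<in> N" "\<And>x a. x \<in> N \<Longrightarrow> a \<in> carrier R \<Longrightarrow> x \<triangleleft>\<^bsub>M\<^esub> a \<in> N"
    and "\<And>x \<gamma>. x \<in> N \<Longrightarrow> \<gamma> \<in> arrows \<Gamma> \<Longrightarrow> MC.component x \<gamma> \<in> N"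
  shows "gr_submodule \<Gamma> R M N"
  using assms by (simp add: gr_submodule_iff)

lemma
  assumes "gr_submodule \<Gamma> R M N"
  shows gr_submodule_carrier: "x \<in> N \<Longrightarrow> x \<in> carrier M"
    and gr_submodule_subset: "N \<subseteq> carrier M"
    and gr_submodule_zero: "\<zero>\<^bsub>M\<^esub> \<in> N"
    and gr_submodule_add: "x \<in> N \<Longrightarrow> y \<in> N \<Longrightarrow> x \<oplus>\<^bsub>M\<^esub> y \<in> N"
    and gr_submodule_minus: "x \<in> N \<Longrightarrow> \<ominus>\<^bsub>M\<^esub> x \<in> N"
    and gr_submodule_ract: "x \<in> N \<Longrightarrow> a \<in> carrier R \<Longrightarrow> x \<triangleleft>\<^bsub>M\<^esub> a \<in> N"
    and gr_submodule_component: "x \<in> N \<Longrightarrow> \<gamma> \<in> arrows \<Gamma> \<Longrightarrow> MC.component x \<gamma> \<in> N"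
  using assms by (auto simp: gr_submodule_iff)

lemma gr_submodule_add_cancel:
  assumes "gr_submodule \<Gamma> R M N" "x \<in> N" "x \<oplus>\<^bsub>M\<^esub> y \<in> N" "y \<in> carrier M"
  shows "y \<in> N"
proof -
  have x: "x \<in> carrier M" using assms gr_submodule_carrier by blast
  have "\<ominus>\<^bsub>M\<^esub> x \<oplus>\<^bsub>M\<^esub> (x \<oplus>\<^bsub>M\<^esub> y) \<in> N" using assms gr_submodule_add gr_submodule_minus by blast
  then show ?thesis using x assms(4) by (simp add: M.r_neg1)
qed

lemma gr_submodule_le_if_homogeneous:
  assumes "gr_submodule \<Gamma> R M N" "gr_submodule \<Gamma> R M K"
    and "\<And>\<gamma>. \<gamma> \<in> arrows \<Gamma> \<Longrightarrow> N \<inter> grade M \<gamma> \<subseteq> K"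
  shows "N \<subseteq> K"
proof
  fix x assume x: "x \<in> N"
  have xc: "x \<in> carrier M" using gr_submodule_carrier[OF assms(1) x] .
  show "x \<in> K"
  proof (rule MC.mem_if_components[OF xc])
    fix \<gamma> assume "\<gamma> \<in> arrows \<Gamma>"
    then show "MC.component x \<gamma> \<in> K"
      using assms(3) gr_submodule_component[OF assms(1) x] MC.component_mem[OF xc] by blast
  qed (use assms(2) gr_submodule_zero gr_submodule_add in auto)
qed

section \<open>The modular lattice of graded submodules\<close>

lemma gr_submodule_null: "gr_submodule \<Gamma> R M {\<zero>\<^bsub>M\<^esub>}"
  by (rule gr_submoduleI) (auto simp: MC.component_zero)

lemma gr_submodule_top: "gr_submodule \<Gamma> R M (carrier M)"
  by (rule gr_submoduleI) (auto simp: ract_closed MC.component_carrier)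

lemma gr_submodule_Int:
  assumes "gr_submodule \<Gamma> R M N" "gr_submodule \<Gamma> R M K"
  shows "gr_submodule \<Gamma> R M (N \<inter> K)"
  using assms by (auto simp: gr_submodule_iff)

lemma gr_submodule_Inter:
  assumes "\<And>N. N \<in> F \<Longrightarrow> gr_submodule \<Gamma> R M N"
  shows "gr_submodule \<Gamma> R M (carrier M \<inter> \<Inter>F)"
proof (rule gr_submoduleI)
  fix x \<gamma> assume "x \<in> carrier M \<inter> \<Inter>F" "\<gamma> \<in> arrows \<Gamma>"
  then show "MC.component x \<gamma> \<in> carrier M \<inter> \<Inter>F"
    using gr_submodule_component[OF assms] MC.component_carrier by simp
qed (use assms gr_submodule_zero gr_submodule_add gr_submodule_minus gr_submodule_ract ract_closed
    in auto)

lemma gr_submodule_Union_chain: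
  assumes "C \<noteq> {}" "\<And>N. N \<in> C \<Longrightarrow> gr_submodule \<Gamma> R M N"
    and "\<And>N K. N \<in> C \<Longrightarrow> K \<in> C \<Longrightarrow> N \<subseteq> K \<or> K \<subseteq> N"
  shows "gr_submodule \<Gamma> R M (\<Union>C)"
proof (rule gr_submoduleI)
  fix x y assume "x \<in> \<Union>C" "y \<in> \<Union>C"
  then obtain N K where "N \<in> C" "K \<in> C" "x \<in> N" "y \<in> K" by blast
  then obtain L where "L \<in> C" "x \<in> L" "y \<in> L" using assms(3) by blast
  then show "x \<oplus>\<^bsub>M\<^esub> y \<in> \<Union>C" using gr_submodule_add[OF assms(2)] by blast
next
  show "\<Union>C \<subseteq> carrier M" using gr_submodule_subset[OF assms(2)] by auto
  show "\<zero>\<^bsub>M\<^esub> \<in> \<Union>C" using assms(1) gr_submodule_zero[OF assms(2)] by auto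
  show "\<ominus>\<^bsub>M\<^esub> x \<in> \<Union>C" if "x \<in> \<Union>C" for x
    using that gr_submodule_minus[OF assms(2)] by auto
  show "x \<triangleleft>\<^bsub>M\<^esub> a \<in> \<Union>C" if "x \<in> \<Union>C" "a \<in> carrier R" for x a
    using that gr_submodule_ract[OF assms(2)] by blast
  show "MC.component x \<gamma> \<in> \<Union>C" if "x \<in> \<Union>C" "\<gamma> \<in> arrows \<Gamma>" for x \<gamma>
    using that gr_submodule_component[OF assms(2)] by blast
qed

lemma mem_set_add_iff: "z \<in> N <+>\<^bsub>M\<^esub> K \<longleftrightarrow> (\<exists>x\<in>N. \<exists>y\<in>K. z = x \<oplus>\<^bsub>M\<^esub> y)"
  unfolding set_add_def' by auto

lemma gr_submodule_set_add:
  assumes N: "gr_submodule \<Gamma> R M N" and K: "gr_submodule \<Gamma> R M K"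
  shows "gr_submodule \<Gamma> R M (N <+>\<^bsub>M\<^esub> K)"
proof (rule gr_submoduleI)
  note c = gr_submodule_carrier[OF N] gr_submodule_carrier[OF K]
  show "N <+>\<^bsub>M\<^esub> K \<subseteq> carrier M" using c by (auto simp: mem_set_add_iff)
  show "\<zero>\<^bsub>M\<^esub> \<in> N <+>\<^bsub>M\<^esub> K" unfolding mem_set_add_iff
    using gr_submodule_zero[OF N] gr_submodule_zero[OF K] by force
  fix z assume "z \<in> N <+>\<^bsub>M\<^esub> K"
  then obtain x y where z: "x \<in> N" "y \<in> K" "z = x \<oplus>\<^bsub>M\<^esub> y" unfolding mem_set_add_iff by blast
  have xy: "x \<in> carrier M" "y \<in> carrier M" using z c by auto
  show "\<ominus>\<^bsub>M\<^esub> z \<in> N <+>\<^bsub>M\<^esub> K" unfolding mem_set_add_iff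
    using z xy gr_submodule_minus[OF N] gr_submodule_minus[OF K] M.minus_add by blast
  show "z \<triangleleft>\<^bsub>M\<^esub> a \<in> N <+>\<^bsub>M\<^esub> K" if "a \<in> carrier R" for a unfolding mem_set_add_iff
    using z xy gr_submodule_ract[OF N] gr_submodule_ract[OF K] ract_l_distr that by blast
  show "MC.component z \<gamma> \<in> N <+>\<^bsub>M\<^esub> K" if "\<gamma> \<in> arrows \<Gamma>" for \<gamma> unfolding mem_set_add_iff
    using z xy gr_submodule_component[OF N] gr_submodule_component[OF K] MC.component_add that
    by blast
  fix z' assume "z' \<in> N <+>\<^bsub>M\<^esub> K"
  then obtain x' y' where z': "x' \<in> N" "y' \<in> K" "z' = x' \<oplus>\<^bsub>M\<^esub> y'" unfolding mem_set_add_iff by blast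
  then have "z \<oplus>\<^bsub>M\<^esub> z' = (x \<oplus>\<^bsub>M\<^esub> x') \<oplus>\<^bsub>M\<^esub> (y \<oplus>\<^bsub>M\<^esub> y')"
    using z xy c by (simp add: M.a_ac)
  then show "z \<oplus>\<^bsub>M\<^esub> z' \<in> N <+>\<^bsub>M\<^esub> K" unfolding mem_set_add_iff
    using z z' gr_submodule_add[OF N] gr_submodule_add[OF K] by blast
qed

lemma set_add_upper:
  assumes "gr_submodule \<Gamma> R M N" "gr_submodule \<Gamma> R M K"
  shows "N \<subseteq> N <+>\<^bsub>M\<^esub> K" "K \<subseteq> N <+>\<^bsub>M\<^esub> K"
proof -
  have "x \<in> N <+>\<^bsub>M\<^esub> K" if "x \<in> N" for x unfolding mem_set_add_iff
    using that gr_submodule_zero[OF assms(2)] gr_submodule_carrier[OF assms(1)] M.r_zero by metis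
  then show "N \<subseteq> N <+>\<^bsub>M\<^esub> K" by blast
  have "x \<in> N <+>\<^bsub>M\<^esub> K" if "x \<in> K" for x unfolding mem_set_add_iff
    using that gr_submodule_zero[OF assms(1)] gr_submodule_carrier[OF assms(2)] M.l_zero by metis
  then show "K \<subseteq> N <+>\<^bsub>M\<^esub> K" by blast
qed

lemma set_add_least:
  assumes "gr_submodule \<Gamma> R M L" "N \<subseteq> L" "K \<subseteq> L"
  shows "N <+>\<^bsub>M\<^esub> K \<subseteq> L"
  using assms(2,3) by (auto simp: mem_set_add_iff intro!: gr_submodule_add[OF assms(1)])

lemma set_add_mono: "N \<subseteq> N' \<Longrightarrow> K \<subseteq> K' \<Longrightarrow> N <+>\<^bsub>M\<^esub> K \<subseteq> N' <+>\<^bsub>M\<^esub> K'"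
  unfolding set_add_def' by blast

lemma modular_law:
  assumes "gr_submodule \<Gamma> R M N" "gr_submodule \<Gamma> R M K" "gr_submodule \<Gamma> R M L" "N \<subseteq> L"
  shows "(N <+>\<^bsub>M\<^esub> K) \<inter> L \<subseteq> N <+>\<^bsub>M\<^esub> (K \<inter> L)"
proof
  fix z assume "z \<in> (N <+>\<^bsub>M\<^esub> K) \<inter> L"
  then obtain x y where z: "x \<in> N" "y \<in> K" "z = x \<oplus>\<^bsub>M\<^esub> y" "z \<in> L"
    unfolding mem_set_add_iff Int_iff by blast
  then have "y \<in> L"
    using gr_submodule_add_cancel[OF assms(3), of x y] assms gr_submodule_carrier by blast
  then show "z \<in> N <+>\<^bsub>M\<^esub> (K \<inter> L)" unfolding mem_set_add_iff using z by blast
qed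

text \<open>L = (N + K) \<inter> L = N + (K \<inter> L) = N + (K \<inter> N) = N. This form of
  modularity supplies all strictness: for extensions of chain conditions, and for chains of
  complements.\<close>

lemma eq_if_Int_set_add_eq:
  assumes "gr_submodule \<Gamma> R M N" "gr_submodule \<Gamma> R M K" "gr_submodule \<Gamma> R M L" "N \<subseteq> L"
    and "N \<inter> K = L \<inter> K" "N <+>\<^bsub>M\<^esub> K = L <+>\<^bsub>M\<^esub> K"
  shows "N = L"
proof -
  have "L \<subseteq> (N <+>\<^bsub>M\<^esub> K) \<inter> L" using assms set_add_upper by blast
  also have "\<dots> \<subseteq> N <+>\<^bsub>M\<^esub> (K \<inter> L)" by (rule modular_law[OF assms(1-4)])
  also have "\<dots> \<subseteq> N" using assms by (intro set_add_least) blast+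
  finally show ?thesis using assms(4) by blast
qed

text \<open>Left translation by \<sigma> is injective on composable arrows, so exactly one
  homogeneous component of \<open>t\<close> contributes to the degree \<sigma>\<delta> of x
  t.\<close>

lemma component_ract:
  assumes "\<sigma> \<in> arrows \<Gamma>" "x \<in> grade M \<sigma>" "t \<in> carrier R" "\<delta> \<in> arrows \<Gamma>"
    and "gdom \<Gamma> \<sigma> = gran \<Gamma> \<delta>"
  shows "MC.component (x \<triangleleft>\<^bsub>M\<^esub> t) (gcomp \<Gamma> \<sigma> \<delta>) = x \<triangleleft>\<^bsub>M\<^esub> RC.component t \<delta>"
proof -
  have x: "x \<in> carrier M" using assms MC.summand_carrier by blast
  show ?thesis using assms(3)
  proof (induction t rule: RC.homogeneous_induct)
    case zero
    then show ?case using x by (simp add: MC.component_zero RC.component_zero)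
  next
    case (homogeneous \<epsilon> a)
    have a: "a \<in> carrier R" using homogeneous RC.summand_carrier by blast
    show ?case
    proof (cases "gdom \<Gamma> \<sigma> = gran \<Gamma> \<epsilon>")
      case True
      have "MC.component (x \<triangleleft>\<^bsub>M\<^esub> a) (gcomp \<Gamma> \<sigma> \<delta>) =
        (if gcomp \<Gamma> \<sigma> \<delta> = gcomp \<Gamma> \<sigma> \<epsilon> then x \<triangleleft>\<^bsub>M\<^esub> a else \<zero>\<^bsub>M\<^esub>)"
        using grade_ract[OF assms(1) homogeneous(1) True assms(2) homogeneous(2)]
          comp_arrow[OF assms(1) homogeneous(1) True] by (rule MC.component_homogeneous[rotated])
      moreover have "gcomp \<Gamma> \<sigma> \<delta> = gcomp \<Gamma> \<sigma> \<epsilon> \<longleftrightarrow> \<delta> = \<epsilon>"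
        using comp_left_cancel[OF assms(1,4) homogeneous(1) assms(5) True] by blast
      ultimately show ?thesis using x by (simp add: RC.component_homogeneous[OF homogeneous])
    next
      case False
      then have "x \<triangleleft>\<^bsub>M\<^esub> a = \<zero>\<^bsub>M\<^esub>" "\<delta> \<noteq> \<epsilon>"
        using grade_ract_zero[OF assms(1) homogeneous(1) False assms(2) homogeneous(2)] assms(5)
        by auto
      then show ?thesis using x
        by (simp add: RC.component_homogeneous[OF homogeneous] MC.component_zero)
    qed
  next
    case (add s t)
    then show ?case using x
      by (simp add: ract_r_distr ract_closed MC.component_add RC.component_add RC.component_carrier)
  qed
qed

text \<open>Every product \<sigma>\<epsilon> has the range of \<sigma>. This is why the elements
  supported over one object form a submodule.\<close>

lemma component_ract_zero:
  assumes "\<sigma> \<in> arrows \<Gamma>" "x \<in> grade M \<sigma>" "t \<in> carrier R" "\<gamma> \<in> arrows \<Gamma>"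
    and "gran \<Gamma> \<gamma> \<noteq> gran \<Gamma> \<sigma>"
  shows "MC.component (x \<triangleleft>\<^bsub>M\<^esub> t) \<gamma> = \<zero>\<^bsub>M\<^esub>"
proof -
  have x: "x \<in> carrier M" using assms MC.summand_carrier by blast
  show ?thesis using assms(3)
  proof (induction t rule: RC.homogeneous_induct)
    case zero
    then show ?case using x by (simp add: MC.component_zero)
  next
    case (homogeneous \<epsilon> a)
    show ?case
    proof (cases "gdom \<Gamma> \<sigma> = gran \<Gamma> \<epsilon>")
      case True
      have "gcomp \<Gamma> \<sigma> \<epsilon> \<noteq> \<gamma>" using ran_comp[OF assms(1) homogeneous(1) True] assms(5) by auto
      then show ?thesis
        using MC.component_homogeneous[OF comp_arrow[OF assms(1) homogeneous(1) True]
          grade_ract[OF assms(1) homogeneous(1) True assms(2) homogeneous(2)]] by simp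
    next
      case False
      then show ?thesis
        using grade_ract_zero[OF assms(1) homogeneous(1) False assms(2) homogeneous(2)]
        by (simp add: MC.component_zero)
    qed
  next
    case (add s t)
    then show ?case using x
      by (simp add: ract_r_distr ract_closed MC.component_add)
  qed
qed

end

section \<open>The regular module\<close>

context graded_ring
begin

lemma regular_simps [simp]:
  "carrier (regular_module R) = carrier R" "zero (regular_module R) = zero R"
  "add (regular_module R) = add R" "grade (regular_module R) = grade R"
  "ract (regular_module R) = mult R"
  by (simp_all add: regular_module_def)

lemma regular_a_inv [simp]: "a_inv (regular_module R) = a_inv R"
  by (simp add: a_inv_def m_inv_def fun_eq_iff)

lemma regular_finsum [simp]: "finsum (regular_module R) = finsum R"
  by (simp add: finsum_def finprod_def fun_eq_iff)

lemma regular_subgroup: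
  "subgroup N (add_monoid (regular_module R)) \<longleftrightarrow> subgroup N (add_monoid R)"
  by (simp add: subgroup_def m_inv_def)

lemma regular_direct_sum_on:
  "direct_sum_on (regular_module R) I A N \<longleftrightarrow> direct_sum_on R I A N"
  unfolding direct_sum_on_def sum_of_def regular_subgroup by simp

lemma regular_abelian_group: "abelian_group (regular_module R)"
  by (rule abelian_groupI)
    (auto simp: a_ac l_neg intro: a_inv_closed bexI[of _ "\<ominus> _"])

text \<open>Through the sublocale built on this fact, every result on graded submodules becomes one
  on graded right ideals, under the prefix \<open>reg\<close>.\<close>

lemma regular_graded_module: "graded_module \<Gamma> R (regular_module R)"
  by (intro graded_module.intro right_module.intro graded_ring_axioms nonunital_ring_axioms
      regular_abelian_group right_module_axioms.intro graded_module_axioms.intro)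
    (auto simp: regular_direct_sum_on grading grade_mult grade_mult_zero obj_one_right
      m_closed l_distr r_distr m_assoc)

end

sublocale graded_ring \<subseteq> reg: graded_module \<Gamma> R "regular_module R"
  by (rule regular_graded_module)

context graded_ring
begin

lemma regular_component:
  "internal_direct_sum.component (regular_module R) (arrows \<Gamma>) (grade R) = RC.component"
proof
  fix x
  have "internal_direct_sum.decomp (regular_module R) (arrows \<Gamma>) (grade R) x f F =
      RC.decomp x f F" for f F
    using reg.MC.decomp_def[of x f F] by (simp add: RC.decomp_def)
  then show "internal_direct_sum.component (regular_module R) (arrows \<Gamma>) (grade R) x =
      RC.component x"
    using reg.MC.component_def[of x] by (simp add: RC.component_def)
qed

lemma gr_right_ideal_iff:
  "gr_right_ideal \<Gamma> R N \<longleftrightarrow> N \<subseteq> carrier R \<and> \<zero> \<in> N \<and> (\<forall>x\<in>N. \<forall>y\<in>N. x \<oplus> y \<in> N) \<and>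
    (\<forall>x\<in>N. \<ominus> x \<in> N) \<and> (\<forall>x\<in>N. \<forall>a\<in>carrier R. x \<otimes> a \<in> N) \<and>
    (\<forall>x\<in>N. \<forall>\<gamma>\<in>arrows \<Gamma>. RC.component x \<gamma> \<in> N)"
  unfolding gr_right_ideal_def reg.gr_submodule_iff by (simp add: regular_component)

end

context graded_module
begin

text \<open>For homogeneous \<open>x\<close> the map t -> x t is graded up to the shift by \<sigma>:
  the component of x t in degree \<gamma> is x times the component of t in degree \<sigma>^{-1}
  \<gamma>, or zero if the ranges differ. Homogeneity of \<open>x\<close> is what keeps the image
  graded.\<close>

lemma gr_submodule_image_ract:
  assumes "\<sigma> \<in> arrows \<Gamma>" "x \<in> grade M \<sigma>" "gr_right_ideal \<Gamma> R T"
  shows "gr_submodule \<Gamma> R M ((\<lambda>t. x \<triangleleft>\<^bsub>M\<^esub> t) ` T)"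
proof -
  have x: "x \<in> carrier M" using assms MC.summand_carrier by blast
  have T: "\<And>t. t \<in> T \<Longrightarrow> t \<in> carrier R" "\<zero> \<in> T" "\<And>s t. s \<in> T \<Longrightarrow> t \<in> T \<Longrightarrow> s \<oplus> t \<in> T"
    "\<And>t. t \<in> T \<Longrightarrow> \<ominus> t \<in> T" "\<And>t a. t \<in> T \<Longrightarrow> a \<in> carrier R \<Longrightarrow> t \<otimes> a \<in> T"
    "\<And>t \<gamma>. t \<in> T \<Longrightarrow> \<gamma> \<in> arrows \<Gamma> \<Longrightarrow> RC.component t \<gamma> \<in> T"
    using assms(3) by (auto simp: gr_right_ideal_iff)
  have zero: "\<zero>\<^bsub>M\<^esub> \<in> (\<lambda>t. x \<triangleleft>\<^bsub>M\<^esub> t) ` T"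
    by (rule image_eqI[OF _ T(2)]) (simp add: x)
  show ?thesis
  proof (rule gr_submoduleI)
    show "(\<lambda>t. x \<triangleleft>\<^bsub>M\<^esub> t) ` T \<subseteq> carrier M" using x T(1) ract_closed by auto
    fix y assume "y \<in> (\<lambda>t. x \<triangleleft>\<^bsub>M\<^esub> t) ` T"
    then obtain t where t: "t \<in> T" "y = x \<triangleleft>\<^bsub>M\<^esub> t" by blast
    have tc: "t \<in> carrier R" using T(1) t(1) .
    show "\<ominus>\<^bsub>M\<^esub> y \<in> (\<lambda>t. x \<triangleleft>\<^bsub>M\<^esub> t) ` T"
      by (rule image_eqI[OF _ T(4)[OF t(1)]]) (simp add: ract_minus x tc t)
    show "y \<triangleleft>\<^bsub>M\<^esub> a \<in> (\<lambda>t. x \<triangleleft>\<^bsub>M\<^esub> t) ` T" if "a \<in> carrier R" for a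
      by (rule image_eqI[OF _ T(5)[OF t(1) that]]) (simp add: ract_assoc x tc t that)
    show "y \<oplus>\<^bsub>M\<^esub> z \<in> (\<lambda>t. x \<triangleleft>\<^bsub>M\<^esub> t) ` T" if z: "z \<in> (\<lambda>t. x \<triangleleft>\<^bsub>M\<^esub> t) ` T" for z
    proof -
      obtain s where s: "s \<in> T" "z = x \<triangleleft>\<^bsub>M\<^esub> s" using z by blast
      show ?thesis
        by (rule image_eqI[OF _ T(3)[OF t(1) s(1)]]) (simp add: ract_r_distr x tc T(1) t s)
    qed
    show "MC.component y \<gamma> \<in> (\<lambda>t. x \<triangleleft>\<^bsub>M\<^esub> t) ` T" if g: "\<gamma> \<in> arrows \<Gamma>" for \<gamma>
    proof (cases "gran \<Gamma> \<gamma> = gran \<Gamma> \<sigma>")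
      case True
      then obtain \<delta> where d: "\<delta> \<in> arrows \<Gamma>" "gdom \<Gamma> \<sigma> = gran \<Gamma> \<delta>" "gcomp \<Gamma> \<sigma> \<delta> = \<gamma>"
        using comp_left_solve[OF assms(1) g] by blast
      then have "MC.component y \<gamma> = x \<triangleleft>\<^bsub>M\<^esub> RC.component t \<delta>"
        using component_ract[OF assms(1,2) tc d(1,2)] t by simp
      then show ?thesis using T(6)[OF t(1) d(1)] by blast
    next
      case False
      then show ?thesis
        using component_ract_zero[OF assms(1,2) tc g] t(2) zero by simp
    qed
  qed (rule zero)
qed

text \<open>The preimage of \<open>K\<close> under the same degree shift. Components of
  \<open>t\<close> not composable with \<sigma> are killed by \<open>x\<close>, so they belong to
  the preimage for that reason.\<close>

lemma gr_right_ideal_transporter: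
  assumes "\<sigma> \<in> arrows \<Gamma>" "x \<in> grade M \<sigma>" "gr_submodule \<Gamma> R M K"
  shows "gr_right_ideal \<Gamma> R {t \<in> carrier R. x \<triangleleft>\<^bsub>M\<^esub> t \<in> K}"
proof -
  have x: "x \<in> carrier M" using assms MC.summand_carrier by blast
  note K = assms(3)[unfolded gr_submodule_iff]
  have "x \<triangleleft>\<^bsub>M\<^esub> RC.component t \<delta> \<in> K"
    if t: "t \<in> carrier R" "x \<triangleleft>\<^bsub>M\<^esub> t \<in> K" and d: "\<delta> \<in> arrows \<Gamma>" for t \<delta>
  proof (cases "gdom \<Gamma> \<sigma> = gran \<Gamma> \<delta>")
    case True
    then show ?thesis
      using component_ract[OF assms(1,2) t(1) d True] K t comp_arrow[OF assms(1) d True] by metis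
  next
    case False
    then show ?thesis
      using grade_ract_zero[OF assms(1) d False assms(2) RC.component_mem[OF t(1) d]] K by simp
  qed
  then show ?thesis unfolding gr_right_ideal_iff
    using K x by (auto simp: ract_r_distr ract_minus ract_assoc m_closed RC.component_carrier)
qed

text \<open>Stands in for x = x 1: it puts a homogeneous \<open>x\<close> into x R, with the local
  identity at its domain as the witness.\<close>

lemma homogeneous_mem_orbit:
  assumes "\<sigma> \<in> arrows \<Gamma>" "x \<in> grade M \<sigma>"
  shows "obj_one R (gdom \<Gamma> \<sigma>) \<in> carrier R" "x \<triangleleft>\<^bsub>M\<^esub> obj_one R (gdom \<Gamma> \<sigma>) = x"
proof -
  have u: "gdom \<Gamma> \<sigma> \<in> units \<Gamma>" using dom_unit assms by blast
  obtain v where v: "is_obj_one R (gdom \<Gamma> \<sigma>) v" using obj_one_exists[OF u] by blast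
  then have "obj_one R (gdom \<Gamma> \<sigma>) \<in> grade R (gdom \<Gamma> \<sigma>)"
    using obj_one_eq[OF v] unfolding is_obj_one_def by simp
  then show "obj_one R (gdom \<Gamma> \<sigma>) \<in> carrier R"
    using RC.summand_carrier units_arrow[OF u] by blast
  show "x \<triangleleft>\<^bsub>M\<^esub> obj_one R (gdom \<Gamma> \<sigma>) = x" using ract_obj_one assms by blast
qed

end

section \<open>Graded submodules as graded modules\<close>

lemma sub_module_simps [simp]:
  "carrier (sub_module M N) = N" "zero (sub_module M N) = zero M"
  "add (sub_module M N) = add M" "grade (sub_module M N) \<gamma> = N \<inter> grade M \<gamma>"
  "ract (sub_module M N) = ract M"
  by (simp_all add: sub_module_def)

context graded_module
begin

context
  fixes N
  assumes N: "gr_submodule \<Gamma> R M N"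
begin

lemma sub_module_abelian_group: "abelian_group (sub_module M N)"
proof (rule abelian_groupI)
  note c = gr_submodule_carrier[OF N]
  fix x y z
  assume "x \<in> carrier (sub_module M N)"
  then have x: "x \<in> N" by simp
  then show "\<zero>\<^bsub>sub_module M N\<^esub> \<oplus>\<^bsub>sub_module M N\<^esub> x = x" using c by simp
  show "\<exists>y\<in>carrier (sub_module M N). y \<oplus>\<^bsub>sub_module M N\<^esub> x = \<zero>\<^bsub>sub_module M N\<^esub>"
    using x c gr_submodule_minus[OF N] M.l_neg by auto
  assume "y \<in> carrier (sub_module M N)"
  then have y: "y \<in> N" by simp
  show "x \<oplus>\<^bsub>sub_module M N\<^esub> y \<in> carrier (sub_module M N)" using x y gr_submodule_add[OF N] by simp
  show "x \<oplus>\<^bsub>sub_module M N\<^esub> y = y \<oplus>\<^bsub>sub_module M N\<^esub> x" using x y c by (simp add: M.a_comm)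
  assume "z \<in> carrier (sub_module M N)"
  then show "x \<oplus>\<^bsub>sub_module M N\<^esub> y \<oplus>\<^bsub>sub_module M N\<^esub> z =
      x \<oplus>\<^bsub>sub_module M N\<^esub> (y \<oplus>\<^bsub>sub_module M N\<^esub> z)"
    using x y c by (simp add: M.a_assoc)
qed (use gr_submodule_zero[OF N] in simp)

interpretation S: abelian_group "sub_module M N"
  by (rule sub_module_abelian_group)

lemma sub_module_a_inv: "x \<in> N \<Longrightarrow> \<ominus>\<^bsub>sub_module M N\<^esub> x = \<ominus>\<^bsub>M\<^esub> x"
  using S.minus_equality[of "\<ominus>\<^bsub>M\<^esub> x" x] gr_submodule_minus[OF N] gr_submodule_carrier[OF N] M.l_neg
  by simp

lemma sub_module_finsum:
  assumes "\<And>i. i \<in> F \<Longrightarrow> f i \<in> N"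
  shows "finsum (sub_module M N) f F = finsum M f F"
proof (cases "finite F")
  case True
  then show ?thesis using assms
  proof (induction F)
    case (insert i F)
    have "finsum (sub_module M N) f (insert i F) =
        f i \<oplus>\<^bsub>sub_module M N\<^esub> finsum (sub_module M N) f F"
      using insert by (intro S.finsum_insert) auto
    moreover have "finsum M f (insert i F) = f i \<oplus>\<^bsub>M\<^esub> finsum M f F"
      using insert gr_submodule_carrier[OF N] by (intro M.finsum_insert) auto
    ultimately show ?case using insert by simp
  qed (use S.finsum_empty in simp)
next
  case False
  then show ?thesis using S.finsum_infinite by simp
qed

lemma sub_module_subgroup:
  "subgroup K (add_monoid (sub_module M N)) \<longleftrightarrow> subgroup K (add_monoid M) \<and> K \<subseteq> N"
proof -
  have "(\<forall>x\<in>K. \<ominus>\<^bsub>sub_module M N\<^esub> x \<in> K) \<longleftrightarrow> (\<forall>x\<in>K. \<ominus>\<^bsub>M\<^esub> x \<in> K)" if "K \<subseteq> N"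
    using sub_module_a_inv that by (metis subsetD)
  then show ?thesis
    unfolding S.subgroup_add_monoid_iff M.subgroup_add_monoid_iff
    using gr_submodule_subset[OF N] by auto
qed

lemma sub_module_direct_sum_on:
  assumes "\<And>i. i \<in> I \<Longrightarrow> A i \<subseteq> N"
  shows "direct_sum_on (sub_module M N) I A K \<longleftrightarrow> direct_sum_on M I A K"
proof -
  have fs: "finsum (sub_module M N) f F = finsum M f F"
    if "F \<subseteq> I" "\<forall>i\<in>F. f i \<in> A i" for f F
    using that assms by (intro sub_module_finsum) blast
  have "sum_of (sub_module M N) I A = sum_of M I A"
    unfolding sum_of_def using fs by (metis (no_types, lifting))
  moreover have "(\<forall>i\<in>I. subgroup (A i) (add_monoid (sub_module M N))) \<longleftrightarrow>
      (\<forall>i\<in>I. subgroup (A i) (add_monoid M))"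
    using sub_module_subgroup assms by blast
  moreover have "(finite F \<and> F \<subseteq> I \<and> (\<forall>i\<in>F. f i \<in> A i) \<and>
        finsum (sub_module M N) f F = \<zero>\<^bsub>M\<^esub> \<longrightarrow> (\<forall>i\<in>F. f i = \<zero>\<^bsub>M\<^esub>)) \<longleftrightarrow>
      (finite F \<and> F \<subseteq> I \<and> (\<forall>i\<in>F. f i \<in> A i) \<and>
        finsum M f F = \<zero>\<^bsub>M\<^esub> \<longrightarrow> (\<forall>i\<in>F. f i = \<zero>\<^bsub>M\<^esub>))" for f F
    using fs by metis
  ultimately show ?thesis unfolding direct_sum_on_def sub_module_simps by simp
qed

lemma sub_module_right_submodule:
  "right_submodule R (sub_module M N) K \<longleftrightarrow> right_submodule R M K \<and> K \<subseteq> N"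
  unfolding right_submodule_def sub_module_subgroup by auto

text \<open>Conditions on the graded module \<open>N\<close> thereby become conditions on the
  submodules of \<open>M\<close> below \<open>N\<close>; in this way the objectwise notions are
  handled inside the lattice of \<open>M\<close>.\<close>

lemma sub_module_gr_submodule:
  "gr_submodule \<Gamma> R (sub_module M N) K \<longleftrightarrow> gr_submodule \<Gamma> R M K \<and> K \<subseteq> N"
proof (cases "K \<subseteq> N")
  case True
  then have "(\<lambda>\<gamma>. K \<inter> grade (sub_module M N) \<gamma>) = (\<lambda>\<gamma>. K \<inter> grade M \<gamma>)" by auto
  moreover have "direct_sum_on (sub_module M N) (arrows \<Gamma>) (\<lambda>\<gamma>. K \<inter> grade M \<gamma>) K \<longleftrightarrow>
      direct_sum_on M (arrows \<Gamma>) (\<lambda>\<gamma>. K \<inter> grade M \<gamma>) K"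
    by (rule sub_module_direct_sum_on) (use True in auto)
  ultimately show ?thesis
    using True unfolding gr_submodule_def sub_module_right_submodule by simp
next
  case False
  then show ?thesis unfolding gr_submodule_def sub_module_right_submodule by simp
qed

lemma sub_module_graded_module: "graded_module \<Gamma> R (sub_module M N)"
proof (intro graded_module.intro right_module.intro graded_ring_axioms nonunital_ring_axioms
      sub_module_abelian_group right_module_axioms.intro graded_module_axioms.intro)
  note c = gr_submodule_carrier[OF N]
  have "direct_sum_on M (arrows \<Gamma>) (\<lambda>\<gamma>. N \<inter> grade M \<gamma>) N"
    using N unfolding gr_submodule_def by blast
  moreover have "grade (sub_module M N) = (\<lambda>\<gamma>. N \<inter> grade M \<gamma>)" by auto
  ultimately show "direct_sum_on (sub_module M N) (arrows \<Gamma>) (grade (sub_module M N))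
      (carrier (sub_module M N))"
    using sub_module_direct_sum_on[of "arrows \<Gamma>" "\<lambda>\<gamma>. N \<inter> grade M \<gamma>" N] by auto
  show "x \<triangleleft>\<^bsub>sub_module M N\<^esub> a \<in> grade (sub_module M N) (gcomp \<Gamma> \<sigma> \<tau>)"
    if "\<sigma> \<in> arrows \<Gamma>" "\<tau> \<in> arrows \<Gamma>" "gdom \<Gamma> \<sigma> = gran \<Gamma> \<tau>"
      "x \<in> grade (sub_module M N) \<sigma>" "a \<in> grade R \<tau>" for \<sigma> \<tau> x a
    using that grade_ract[OF that(1-3)] gr_submodule_ract[OF N] RC.summand_carrier[OF that(2,5)]
    by simp
qed (auto simp: gr_submodule_ract[OF N] gr_submodule_carrier[OF N] ract_l_distr ract_r_distr
    ract_assoc grade_ract_zero ract_obj_one)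

lemma sub_module_component:
  assumes "x \<in> N"
  shows "internal_direct_sum.component (sub_module M N) (arrows \<Gamma>)
      (grade (sub_module M N)) x = MC.component x"
proof -
  interpret S: graded_module \<Gamma> R "sub_module M N" by (rule sub_module_graded_module)
  obtain F where F: "S.MC.decomp x (S.MC.component x) F"
    using S.MC.decomp_component assms by auto
  have "MC.decomp x (S.MC.component x) F"
    using F sub_module_finsum[of F "S.MC.component x"]
    by (auto simp: S.MC.decomp_def MC.decomp_def)
  from MC.component_eq[OF this] show ?thesis by simp
qed

end

section \<open>Submodules described by their parts over the objects\<close>

lemma sum_of_grade_iff:
  assumes "I \<subseteq> arrows \<Gamma>"
  shows "x \<in> sum_of M I (grade M) \<longleftrightarrow>
    x \<in> carrier M \<and> (\<forall>\<gamma>\<in>arrows \<Gamma>. \<gamma> \<notin> I \<longrightarrow> MC.component x \<gamma> = \<zero>\<^bsub>M\<^esub>)"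
proof (intro iffI conjI ballI impI)
  assume "x \<in> sum_of M I (grade M)"
  then obtain f F where f: "x = finsum M f F" "finite F" "F \<subseteq> I" "\<forall>i\<in>F. f i \<in> grade M i"
    unfolding sum_of_def by blast
  let ?K = "{x \<in> carrier M. \<forall>\<gamma>\<in>arrows \<Gamma>. \<gamma> \<notin> I \<longrightarrow> MC.component x \<gamma> = \<zero>\<^bsub>M\<^esub>}"
  have "finsum M f F \<in> ?K"
  proof (rule MC.finsum_mem)
    fix i assume i: "i \<in> F"
    then have "i \<in> arrows \<Gamma>" "f i \<in> grade M i" using f assms by auto
    then show "f i \<in> ?K"
      using MC.summand_carrier MC.component_homogeneous i f by auto
  qed (auto simp: f MC.component_zero MC.component_add)
  then show "x \<in> carrier M" "\<And>\<gamma>. \<gamma> \<in> arrows \<Gamma> \<Longrightarrow> \<gamma> \<notin> I \<Longrightarrow> MC.component x \<gamma> = \<zero>\<^bsub>M\<^esub>"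
    using f by auto
next
  assume x: "x \<in> carrier M \<and> (\<forall>\<gamma>\<in>arrows \<Gamma>. \<gamma> \<notin> I \<longrightarrow> MC.component x \<gamma> = \<zero>\<^bsub>M\<^esub>)"
  then obtain F where F: "MC.decomp x (MC.component x) F" using MC.decomp_component by blast
  have "finsum M (MC.component x) F = finsum M (MC.component x) (F \<inter> I)"
    by (rule MC.finsum_extend) (use F x MC.component_carrier in \<open>auto simp: MC.decomp_def\<close>)
  moreover have "\<forall>i\<in>F \<inter> I. MC.component x i \<in> grade M i"
    using x MC.component_mem assms by auto
  ultimately show "x \<in> sum_of M I (grade M)"
    using F unfolding sum_of_def MC.decomp_def
    by (intro CollectI exI[of _ "MC.component x"] exI[of _ "F \<inter> I"]) auto
qed

lemma part_iff:
  "x \<in> part \<Gamma> M e \<longleftrightarrow>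
    x \<in> carrier M \<and> (\<forall>\<gamma>\<in>arrows \<Gamma>. gran \<Gamma> \<gamma> \<noteq> e \<longrightarrow> MC.component x \<gamma> = \<zero>\<^bsub>M\<^esub>)"
  unfolding part_def by (subst sum_of_grade_iff) auto

text \<open>The action never changes the range of a degree, so one may prescribe a graded submodule
  separately over each range.\<close>

definition glue :: "('g \<Rightarrow> 'm set) \<Rightarrow> 'm set"
  where "glue N = {x \<in> carrier M. \<forall>\<gamma>\<in>arrows \<Gamma>. MC.component x \<gamma> \<in> N (gran \<Gamma> \<gamma>)}"

lemma gr_submodule_glue:
  assumes "\<And>e. e \<in> units \<Gamma> \<Longrightarrow> gr_submodule \<Gamma> R M (N e)"
  shows "gr_submodule \<Gamma> R M (glue N)"
  unfolding glue_def
proof (rule gr_submoduleI)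
  let ?P = "{x \<in> carrier M. \<forall>\<gamma>\<in>arrows \<Gamma>. MC.component x \<gamma> \<in> N (gran \<Gamma> \<gamma>)}"
  note N = assms[OF ran_unit]
  show zero: "\<zero>\<^bsub>M\<^esub> \<in> ?P" using gr_submodule_zero[OF N] by (simp add: MC.component_zero)
  show add: "x \<oplus>\<^bsub>M\<^esub> y \<in> ?P" if "x \<in> ?P" "y \<in> ?P" for x y
    using that gr_submodule_add[OF N] by (simp add: MC.component_add)
  show "\<ominus>\<^bsub>M\<^esub> x \<in> ?P" if "x \<in> ?P" for x
    using that gr_submodule_minus[OF N] by (simp add: MC.component_minus)
  show "MC.component x \<gamma> \<in> ?P" if "x \<in> ?P" "\<gamma> \<in> arrows \<Gamma>" for x \<gamma>
    using that gr_submodule_zero[OF N]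
    by (simp add: MC.component_carrier MC.component_homogeneous[OF that(2) MC.component_mem])
  show "x \<triangleleft>\<^bsub>M\<^esub> a \<in> ?P" if x: "x \<in> ?P" and a: "a \<in> carrier R" for x a
  proof -
    \<comment> \<open>The set of elements sent into \<open>?P\<close> by \<open>a\<close> is
      additively closed, so \<open>x\<close> may be replaced by its component of degree \<sigma>.
      The product of that component with \<open>a\<close> lies in the submodule prescribed at
      r(\<sigma>) and has zero components over every other range.\<close>
    have "x \<in> {x \<in> carrier M. x \<triangleleft>\<^bsub>M\<^esub> a \<in> ?P}"
    proof (rule MC.mem_if_components)
      fix \<sigma> assume s: "\<sigma> \<in> arrows \<Gamma>"
      let ?y = "MC.component x \<sigma>"
      have y: "?y \<in> grade M \<sigma>" "?y \<in> N (gran \<Gamma> \<sigma>)" "?y \<in> carrier M"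
        using x s MC.component_mem MC.component_carrier by auto
      have "MC.component (?y \<triangleleft>\<^bsub>M\<^esub> a) \<gamma> \<in> N (gran \<Gamma> \<gamma>)" if g: "\<gamma> \<in> arrows \<Gamma>" for \<gamma>
      proof (cases "gran \<Gamma> \<gamma> = gran \<Gamma> \<sigma>")
        case True
        have "?y \<triangleleft>\<^bsub>M\<^esub> a \<in> N (gran \<Gamma> \<sigma>)" using gr_submodule_ract[OF N[OF s] y(2) a] .
        then show ?thesis using gr_submodule_component[OF N[OF s] _ g] True by metis
      next
        case False
        then show ?thesis using component_ract_zero[OF s y(1) a g] gr_submodule_zero[OF N[OF g]]
          by simp
      qed
      then show "?y \<in> {x \<in> carrier M. x \<triangleleft>\<^bsub>M\<^esub> a \<in> ?P}" using y a ract_closed by simp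
    next
      show "\<zero>\<^bsub>M\<^esub> \<in> {x \<in> carrier M. x \<triangleleft>\<^bsub>M\<^esub> a \<in> ?P}" using zero a by simp
      show "y \<oplus>\<^bsub>M\<^esub> z \<in> {x \<in> carrier M. x \<triangleleft>\<^bsub>M\<^esub> a \<in> ?P}"
        if "y \<in> {x \<in> carrier M. x \<triangleleft>\<^bsub>M\<^esub> a \<in> ?P}" "z \<in> {x \<in> carrier M. x \<triangleleft>\<^bsub>M\<^esub> a \<in> ?P}" for y z
        using that add[of "y \<triangleleft>\<^bsub>M\<^esub> a" "z \<triangleleft>\<^bsub>M\<^esub> a"] a by (simp add: ract_l_distr)
    qed (use x in simp)
    then show ?thesis by simp
  qed
qed auto

lemma gr_submodule_part:
  assumes "e \<in> units \<Gamma>"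
  shows "gr_submodule \<Gamma> R M (part \<Gamma> M e)"
proof -
  have "part \<Gamma> M e = glue (\<lambda>f. if f = e then carrier M else {\<zero>\<^bsub>M\<^esub>})"
    using MC.component_carrier by (auto simp: part_iff glue_def)
  then show ?thesis
    using gr_submodule_glue[of "\<lambda>f. if f = e then carrier M else {\<zero>\<^bsub>M\<^esub>}"] gr_submodule_top
      gr_submodule_null by simp
qed

lemma part_sub_module:
  assumes "gr_submodule \<Gamma> R M N"
  shows "part \<Gamma> (sub_module M N) e = N \<inter> part \<Gamma> M e"
proof -
  interpret S: graded_module \<Gamma> R "sub_module M N" by (rule sub_module_graded_module[OF assms])
  show ?thesis
    using sub_module_component[OF assms] gr_submodule_subset[OF assms]
    by (auto simp: part_iff S.part_iff)
qed

end

section \<open>The graded Jacobson radical\<close>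

context graded_ring
begin

lemma
  assumes "gr_right_ideal \<Gamma> R T"
  shows gr_right_ideal_carrier: "t \<in> T \<Longrightarrow> t \<in> carrier R"
    and gr_right_ideal_zero: "\<zero> \<in> T"
    and gr_right_ideal_add: "s \<in> T \<Longrightarrow> t \<in> T \<Longrightarrow> s \<oplus> t \<in> T"
    and gr_right_ideal_minus: "t \<in> T \<Longrightarrow> \<ominus> t \<in> T"
    and gr_right_ideal_mult: "t \<in> T \<Longrightarrow> a \<in> carrier R \<Longrightarrow> t \<otimes> a \<in> T"
    and gr_right_ideal_component: "t \<in> T \<Longrightarrow> \<gamma> \<in> arrows \<Gamma> \<Longrightarrow> RC.component t \<gamma> \<in> T"
  using assms by (auto simp: gr_right_ideal_iff)

lemma gr_right_ideal_radical: "gr_right_ideal \<Gamma> R (gr_radical \<Gamma> R)"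
  using reg.gr_submodule_Inter[of "{J. gr_maximal_right_ideal \<Gamma> R J}"]
  by (simp add: gr_radical_def gr_maximal_right_ideal_def gr_right_ideal_def)

text \<open>Left multiplication by \<open>a\<close> identifies $R/(N : a)$ with a shift of $(aR + N)/N = R/N$; maximality
  of $(N : a)$ is what makes the radical a left ideal.\<close>

lemma gr_maximal_right_ideal_transporter:
  assumes "gr_maximal_right_ideal \<Gamma> R N" "\<gamma> \<in> arrows \<Gamma>" "a \<in> grade R \<gamma>" "a \<notin> N"
  shows "gr_maximal_right_ideal \<Gamma> R {t \<in> carrier R. a \<otimes> t \<in> N}" (is "gr_maximal_right_ideal _ _ ?T")
proof -
  have N: "gr_right_ideal \<Gamma> R N" and max: "\<And>K. gr_right_ideal \<Gamma> R K \<Longrightarrow> K \<noteq> carrier R \<Longrightarrow> N \<subseteq> K \<Longrightarrow> K = N"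
    using assms(1) unfolding gr_maximal_right_ideal_def by auto
  have N': "gr_submodule \<Gamma> R (regular_module R) N" using N unfolding gr_right_ideal_def .
  have a: "a \<in> carrier R" "a \<in> grade (regular_module R) \<gamma>"
    using assms RC.summand_carrier by auto
  have T: "gr_right_ideal \<Gamma> R ?T"
    using reg.gr_right_ideal_transporter[OF assms(2) a(2) N'] by simp
  \<comment> \<open>The local identity at d(\<gamma>) witnesses properness: \<open>a\<close> times
    it is \<open>a\<close>, which is not in \<open>N\<close>.\<close>
  have one: "obj_one R (gdom \<Gamma> \<gamma>) \<in> carrier R" "obj_one R (gdom \<Gamma> \<gamma>) \<notin> ?T"
    using reg.homogeneous_mem_orbit[OF assms(2) a(2)] assms(4) by auto
  moreover have "K = ?T" if K: "gr_right_ideal \<Gamma> R K" "K \<noteq> carrier R" "?T \<subseteq> K" for K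
  proof -
    \<comment> \<open>The right ideal N + a K is proper: if it were R, then a r = m + a k would give
      a (r - k) in N, so r - k lies in the transporter and hence in K, making K = R. Maximality of N
      then forces a K into N.\<close>
    let ?L = "N <+>\<^bsub>regular_module R\<^esub> (\<lambda>t. a \<otimes> t) ` K"
    have I: "gr_submodule \<Gamma> R (regular_module R) ((\<lambda>t. a \<otimes> t) ` K)"
      using reg.gr_submodule_image_ract[OF assms(2) a(2) K(1)] by simp
    have L: "gr_right_ideal \<Gamma> R ?L"
      unfolding gr_right_ideal_def by (rule reg.gr_submodule_set_add[OF N' I])
    have NL: "N \<subseteq> ?L" "(\<lambda>t. a \<otimes> t) ` K \<subseteq> ?L" by (rule reg.set_add_upper[OF N' I])+
    have "?L \<noteq> carrier R"
    proof
      assume L: "?L = carrier R"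
      have "r \<in> K" if r: "r \<in> carrier R" for r
      proof -
        have "a \<otimes> r \<in> ?L" using L a r m_closed by blast
        then obtain m k where mk: "m \<in> N" "k \<in> K" "a \<otimes> r = m \<oplus> a \<otimes> k"
          unfolding reg.mem_set_add_iff by auto
        have c: "m \<in> carrier R" "k \<in> carrier R"
          using mk gr_right_ideal_carrier N K by auto
        have "a \<otimes> (r \<oplus> \<ominus> k) = a \<otimes> r \<oplus> \<ominus> (a \<otimes> k)"
          using r_distr[of r "\<ominus> k" a] reg.ract_minus[of a k] a r c by simp
        also have "\<dots> = m" using mk(3) c a m_closed by (simp add: a_assoc r_neg)
        finally have "r \<oplus> \<ominus> k \<in> K" using K(3) mk r c by auto
        then have "(r \<oplus> \<ominus> k) \<oplus> k \<in> K" using gr_right_ideal_add[OF K(1)] mk by blast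
        then show "r \<in> K" using r c by (simp add: a_assoc l_neg)
      qed
      then show False using K(1,2) gr_right_ideal_carrier by blast
    qed
    then have "?L = N" using max[OF L] NL by blast
    then have "(\<lambda>t. a \<otimes> t) ` K \<subseteq> N" using NL by simp
    then have "K \<subseteq> ?T" using gr_right_ideal_carrier[OF K(1)] by auto
    then show "K = ?T" using K(3) by (rule antisym)
  qed
  ultimately show ?thesis unfolding gr_maximal_right_ideal_def using T by blast
qed

text \<open>For a homogeneous factor b and a maximal N, either b lies in N and so does b u, or the
  transporter of N along b is again maximal and therefore contains u. General factors follow by
  additivity.\<close>

lemma gr_radical_left_closed:
  assumes "a \<in> carrier R" "u \<in> gr_radical \<Gamma> R"
  shows "a \<otimes> u \<in> gr_radical \<Gamma> R"
proof -
  have u: "u \<in> carrier R" using assms unfolding gr_radical_def by blast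
  have "a \<in> {a \<in> carrier R. a \<otimes> u \<in> gr_radical \<Gamma> R}"
  proof (rule RC.mem_if_components[OF assms(1)])
    fix \<gamma> assume g: "\<gamma> \<in> arrows \<Gamma>"
    let ?b = "RC.component a \<gamma>"
    have b: "?b \<in> grade R \<gamma>" "?b \<in> carrier R"
      using RC.component_mem RC.component_carrier assms g by auto
    have "?b \<otimes> u \<in> N" if N: "gr_maximal_right_ideal \<Gamma> R N" for N
    proof (cases "?b \<in> N")
      case True
      then show ?thesis
        using N u gr_right_ideal_mult unfolding gr_maximal_right_ideal_def by blast
    next
      case False
      then show ?thesis
        using gr_maximal_right_ideal_transporter[OF N g b(1)] assms(2)
        unfolding gr_radical_def by blast
    qed
    then show "?b \<in> {a \<in> carrier R. a \<otimes> u \<in> gr_radical \<Gamma> R}"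
      using b u m_closed unfolding gr_radical_def by blast
  next
    show "\<zero> \<in> {a \<in> carrier R. a \<otimes> u \<in> gr_radical \<Gamma> R}"
      using reg.zero_ract[of u] u gr_right_ideal_zero[OF gr_right_ideal_radical] by simp
  next
    fix x y assume "x \<in> {a \<in> carrier R. a \<otimes> u \<in> gr_radical \<Gamma> R}"
      "y \<in> {a \<in> carrier R. a \<otimes> u \<in> gr_radical \<Gamma> R}"
    then show "x \<oplus> y \<in> {a \<in> carrier R. a \<otimes> u \<in> gr_radical \<Gamma> R}"
      using u gr_right_ideal_add[OF gr_right_ideal_radical] by (simp add: l_distr)
  qed
  then show ?thesis by blast
qed

section \<open>Graded quotient rings\<close>

context
  fixes U
  assumes U: "gr_right_ideal \<Gamma> R U"
    and U_left: "\<And>a u. a \<in> carrier R \<Longrightarrow> u \<in> U \<Longrightarrow> a \<otimes> u \<in> U"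
begin

interpretation U: abelian_subgroup U R
proof (rule abelian_subgroupI3)
  show "additive_subgroup U R"
    by (rule additive_subgroupI)
      (use U in \<open>simp add: subgroup_add_monoid_iff gr_right_ideal_iff\<close>)
qed (rule abelian_group_axioms)

lemma quotient_simps:
  "zero (gr_quotient_ring R U) = U" "add (gr_quotient_ring R U) = set_add R"
  "mult (gr_quotient_ring R U) = rcoset_mult R U"
  "grade (gr_quotient_ring R U) \<gamma> = (\<lambda>a. U +> a) ` grade R \<gamma>"
  "carrier (gr_quotient_ring R U) = (\<lambda>a. U +> a) ` carrier R"
  by (auto simp: gr_quotient_ring_def ring.extend_def gr_ring.fields_def FactRing_def
      A_RCOSETS_def')

lemma coset_add:
  "a \<in> carrier R \<Longrightarrow> b \<in> carrier R \<Longrightarrow>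
    (U +> a) \<oplus>\<^bsub>gr_quotient_ring R U\<^esub> (U +> b) = U +> (a \<oplus> b)"
  by (simp add: quotient_simps U.a_rcos_sum)

lemma coset_eq_iff:
  assumes "a \<in> carrier R" "b \<in> carrier R"
  shows "U +> a = U +> b \<longleftrightarrow> a \<oplus> \<ominus> b \<in> U"
  using U.a_rcos_module[OF assms(2,1)] U.a_repr_independence' U.a_rcos_self assms by metis

lemma coset_zero_iff: "a \<in> carrier R \<Longrightarrow> U +> a = U \<longleftrightarrow> a \<in> U"
  using U.a_rcos_self U.a_rcos_const by metis

text \<open>\<open>rcoset_mult\<close> is the union of the cosets of all products of
  representatives. Since \<open>U\<close> is closed under multiplication from both sides, all these
  cosets coincide, and the union is not empty.\<close>

lemma coset_mult:
  assumes a: "a \<in> carrier R" and b: "b \<in> carrier R"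
  shows "(U +> a) \<otimes>\<^bsub>gr_quotient_ring R U\<^esub> (U +> b) = U +> (a \<otimes> b)"
proof -
  have "U +> (a' \<otimes> b') = U +> (a \<otimes> b)" if a': "a' \<in> U +> a" and b': "b' \<in> U +> b" for a' b'
  proof -
    obtain h k where h: "h \<in> U" "a' = h \<oplus> a" and k: "k \<in> U" "b' = k \<oplus> b"
      using a' b' unfolding a_r_coset_def' by blast
    have c: "h \<in> carrier R" "k \<in> carrier R" using h k gr_right_ideal_carrier[OF U] by auto
    have "a' \<otimes> b' = (h \<otimes> (k \<oplus> b) \<oplus> a \<otimes> k) \<oplus> a \<otimes> b"
      using h k c a b by (simp add: l_distr r_distr m_closed a_ac)
    moreover have "h \<otimes> (k \<oplus> b) \<oplus> a \<otimes> k \<in> U"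
      using h k c a b gr_right_ideal_mult[OF U] U_left by auto
    ultimately have "a' \<otimes> b' \<in> U +> (a \<otimes> b)" unfolding a_r_coset_def' by blast
    then show ?thesis using U.a_repr_independence'[of "a' \<otimes> b'" "a \<otimes> b"] a b m_closed by simp
  qed
  moreover have "U +> a \<noteq> {}" "U +> b \<noteq> {}" using U.a_rcos_self a b by blast+
  ultimately show ?thesis unfolding quotient_simps rcoset_mult_def by auto
qed

lemma quotient_abelian_group: "abelian_group (gr_quotient_ring R U)"
proof (rule abelian_groupI)
  show "\<exists>Y\<in>carrier (gr_quotient_ring R U).
      Y \<oplus>\<^bsub>gr_quotient_ring R U\<^esub> X = \<zero>\<^bsub>gr_quotient_ring R U\<^esub>"
    if X: "X \<in> carrier (gr_quotient_ring R U)" for X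
  proof -
    obtain a where a: "a \<in> carrier R" "X = U +> a" using X by (auto simp: quotient_simps)
    then have "(U +> \<ominus> a) \<oplus>\<^bsub>gr_quotient_ring R U\<^esub> X = \<zero>\<^bsub>gr_quotient_ring R U\<^esub>"
      by (simp add: coset_add l_neg) (simp add: quotient_simps coset_zero_iff)
    then show ?thesis using a by (auto simp: quotient_simps(5))
  qed
  show "\<zero>\<^bsub>gr_quotient_ring R U\<^esub> \<in> carrier (gr_quotient_ring R U)"
    using coset_zero_iff[of \<zero>] by (force simp: quotient_simps)
  show "\<zero>\<^bsub>gr_quotient_ring R U\<^esub> \<oplus>\<^bsub>gr_quotient_ring R U\<^esub> X = X"
    if X: "X \<in> carrier (gr_quotient_ring R U)" for X
  proof -
    obtain a where a: "a \<in> carrier R" "X = U +> a" using X by (auto simp: quotient_simps)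
    then show ?thesis using coset_add[of \<zero> a] coset_zero_iff[of \<zero>] by (simp add: quotient_simps)
  qed
qed (auto simp: quotient_simps(5) coset_add a_ac)

interpretation Q: abelian_group "gr_quotient_ring R U"
  by (rule quotient_abelian_group)

lemma coset_finsum:
  assumes "finite F" "f \<in> F \<rightarrow> carrier R"
  shows "finsum (gr_quotient_ring R U) (\<lambda>i. U +> f i) F = U +> finsum R f F"
  using assms
proof (induction F)
  case empty
  then show ?case using Q.finsum_empty coset_zero_iff[of \<zero>] by (simp add: quotient_simps)
next
  case (insert i F)
  have "finsum (gr_quotient_ring R U) (\<lambda>i. U +> f i) (insert i F) =
      (U +> f i) \<oplus>\<^bsub>gr_quotient_ring R U\<^esub> finsum (gr_quotient_ring R U) (\<lambda>i. U +> f i) F"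
    using insert by (intro Q.finsum_insert) (auto simp: quotient_simps(5))
  also have "\<dots> = U +> (f i \<oplus> finsum R f F)" using insert by (simp add: coset_add)
  finally show ?case using insert by simp
qed

text \<open>Independence is where gradedness of \<open>U\<close> enters: a relation among
  homogeneous cosets lifts to a sum in \<open>U\<close>, and \<open>U\<close> contains every
  component of that sum.\<close>

lemma quotient_direct_sum_on:
  "direct_sum_on (gr_quotient_ring R U) (arrows \<Gamma>) (grade (gr_quotient_ring R U))
    (carrier (gr_quotient_ring R U))"
  unfolding direct_sum_on_def
proof (intro conjI ballI allI impI)
  fix \<gamma> assume g: "\<gamma> \<in> arrows \<Gamma>"
  note c = RC.summand_carrier[OF g]
  show "subgroup (grade (gr_quotient_ring R U) \<gamma>) (add_monoid (gr_quotient_ring R U))"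
    unfolding Q.subgroup_add_monoid_iff
  proof (intro conjI ballI)
    show "grade (gr_quotient_ring R U) \<gamma> \<subseteq> carrier (gr_quotient_ring R U)"
      using c by (auto simp: quotient_simps(4,5))
    show "\<zero>\<^bsub>gr_quotient_ring R U\<^esub> \<in> grade (gr_quotient_ring R U) \<gamma>"
      using RC.summand_zero[OF g] coset_zero_iff[of \<zero>] by (force simp: quotient_simps)
    fix X assume "X \<in> grade (gr_quotient_ring R U) \<gamma>"
    then obtain a where a: "a \<in> grade R \<gamma>" "X = U +> a" by (auto simp: quotient_simps(4))
    have "(U +> \<ominus> a) \<oplus>\<^bsub>gr_quotient_ring R U\<^esub> X = \<zero>\<^bsub>gr_quotient_ring R U\<^esub>"
      using a c by (simp add: coset_add l_neg) (simp add: quotient_simps coset_zero_iff)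
    then have "\<ominus>\<^bsub>gr_quotient_ring R U\<^esub> X = U +> \<ominus> a"
      using a c by (intro Q.minus_equality) (auto simp: quotient_simps(5))
    then show "\<ominus>\<^bsub>gr_quotient_ring R U\<^esub> X \<in> grade (gr_quotient_ring R U) \<gamma>"
      using a RC.summand_minus[OF g] by (auto simp: quotient_simps(4))
    fix Y assume "Y \<in> grade (gr_quotient_ring R U) \<gamma>"
    then obtain b where b: "b \<in> grade R \<gamma>" "Y = U +> b" by (auto simp: quotient_simps(4))
    then show "X \<oplus>\<^bsub>gr_quotient_ring R U\<^esub> Y \<in> grade (gr_quotient_ring R U) \<gamma>"
      using a c RC.summand_add[OF g] by (auto simp: coset_add quotient_simps(4))
  qed
next
  show "carrier (gr_quotient_ring R U) =
      sum_of (gr_quotient_ring R U) (arrows \<Gamma>) (grade (gr_quotient_ring R U))"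
  proof (intro equalityI subsetI)
    fix X assume "X \<in> carrier (gr_quotient_ring R U)"
    then obtain a where a: "a \<in> carrier R" "X = U +> a" by (auto simp: quotient_simps(5))
    then obtain F where F: "RC.decomp a (RC.component a) F" using RC.decomp_component by blast
    have "X = finsum (gr_quotient_ring R U) (\<lambda>i. U +> RC.component a i) F"
      using coset_finsum[of F "RC.component a"] F a RC.component_carrier
      by (auto simp: RC.decomp_def)
    moreover have "finite F" "F \<subseteq> arrows \<Gamma>"
      "\<forall>i\<in>F. U +> RC.component a i \<in> grade (gr_quotient_ring R U) i"
      using F by (auto simp: RC.decomp_def quotient_simps(4))
    ultimately show "X \<in> sum_of (gr_quotient_ring R U) (arrows \<Gamma>) (grade (gr_quotient_ring R U))"
      unfolding sum_of_def by blast
  next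
    fix X assume "X \<in> sum_of (gr_quotient_ring R U) (arrows \<Gamma>) (grade (gr_quotient_ring R U))"
    then obtain f F where f: "X = finsum (gr_quotient_ring R U) f F" "F \<subseteq> arrows \<Gamma>"
      "\<forall>i\<in>F. f i \<in> grade (gr_quotient_ring R U) i"
      unfolding sum_of_def by blast
    have "f i \<in> carrier (gr_quotient_ring R U)" if "i \<in> F" for i
      using f(2,3) that RC.summand_carrier by (fastforce simp: quotient_simps(4,5))
    then show "X \<in> carrier (gr_quotient_ring R U)" unfolding f(1) by (intro Q.finsum_closed) auto
  qed
next
  fix f F i
  assume f: "finite F \<and> F \<subseteq> arrows \<Gamma> \<and> (\<forall>i\<in>F. f i \<in> grade (gr_quotient_ring R U) i) \<and>
    finsum (gr_quotient_ring R U) f F = \<zero>\<^bsub>gr_quotient_ring R U\<^esub>" and i: "i \<in> F"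
  then have "\<forall>i\<in>F. \<exists>a. a \<in> grade R i \<and> f i = U +> a" by (auto simp: quotient_simps(4))
  then obtain g where g: "\<And>i. i \<in> F \<Longrightarrow> g i \<in> grade R i" "\<And>i. i \<in> F \<Longrightarrow> f i = U +> g i"
    by metis
  \<comment> \<open>Extended by zero outside \<open>F\<close>, the chosen representatives form the
    component function of their own sum.\<close>
  let ?g = "\<lambda>i. if i \<in> F then g i else \<zero>"
  have gc: "?g \<in> F \<rightarrow> carrier R" using g f RC.summand_carrier by auto
  then have s: "finsum R ?g F \<in> carrier R" by (rule finsum_closed)
  have "finsum (gr_quotient_ring R U) f F = finsum (gr_quotient_ring R U) (\<lambda>i. U +> ?g i) F"
    using g gc by (intro Q.finsum_cong') (auto simp: quotient_simps(5))
  also have "\<dots> = U +> finsum R ?g F" using coset_finsum f gc by blast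
  finally have "finsum R ?g F \<in> U"
    using f coset_zero_iff[OF s] by (simp add: quotient_simps)
  moreover have "RC.component (finsum R ?g F) = ?g"
    by (rule RC.component_eq[of _ _ F]) (use f g in \<open>auto simp: RC.decomp_def\<close>)
  ultimately have "?g i \<in> U" using gr_right_ideal_component[OF U] f i by (metis subsetD)
  then show "f i = \<zero>\<^bsub>gr_quotient_ring R U\<^esub>"
    using g(2)[OF i] i U.a_rcos_const by (simp add: quotient_simps)
qed

lemma quotient_graded_ring: "graded_ring \<Gamma> (gr_quotient_ring R U)"
proof -
  have one: "is_obj_one (gr_quotient_ring R U) e (U +> obj_one R e)"
    if e: "e \<in> units \<Gamma>" for e
  proof -
    obtain u where u: "is_obj_one R e u" using obj_one_exists[OF e] by blast
    note c = RC.summand_carrier[OF units_arrow[OF e]]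
    show ?thesis using u c unfolding obj_one_eq[OF u]
      by (auto simp: is_obj_one_def quotient_simps(4) coset_mult)
  qed
  have uc: "obj_one R e \<in> carrier R" if e: "e \<in> units \<Gamma>" for e
    using obj_one_exists[OF e] obj_one_eq RC.summand_carrier[OF units_arrow[OF e]]
    unfolding is_obj_one_def by metis
  show ?thesis
  proof (intro graded_ring.intro graded_ring_axioms.intro nonunital_ring.intro
      nonunital_ring_axioms.intro quotient_abelian_group quotient_direct_sum_on)
    show "groupoid \<Gamma>" by (rule groupoid_axioms)
    show "\<exists>u. is_obj_one (gr_quotient_ring R U) e u" if "e \<in> units \<Gamma>" for e
      using one[OF that] by blast
    show "obj_one (gr_quotient_ring R U) (gran \<Gamma> \<gamma>) \<otimes>\<^bsub>gr_quotient_ring R U\<^esub> X = X"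
      if g: "\<gamma> \<in> arrows \<Gamma>" and X: "X \<in> grade (gr_quotient_ring R U) \<gamma>" for \<gamma> X
      using X obj_one_eq[OF one[OF ran_unit[OF g]]] uc[OF ran_unit[OF g]] obj_one_left[OF g]
        RC.summand_carrier[OF g] by (auto simp: quotient_simps(4) coset_mult)
    show "X \<otimes>\<^bsub>gr_quotient_ring R U\<^esub> obj_one (gr_quotient_ring R U) (gdom \<Gamma> \<gamma>) = X"
      if g: "\<gamma> \<in> arrows \<Gamma>" and X: "X \<in> grade (gr_quotient_ring R U) \<gamma>" for \<gamma> X
      using X obj_one_eq[OF one[OF dom_unit[OF g]]] uc[OF dom_unit[OF g]] obj_one_right[OF g]
        RC.summand_carrier[OF g] by (auto simp: quotient_simps(4) coset_mult)
    show "X \<otimes>\<^bsub>gr_quotient_ring R U\<^esub> Y \<in> grade (gr_quotient_ring R U) (gcomp \<Gamma> \<gamma> \<delta>)"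
      if g: "\<gamma> \<in> arrows \<Gamma>" "\<delta> \<in> arrows \<Gamma>" "gdom \<Gamma> \<gamma> = gran \<Gamma> \<delta>"
        "X \<in> grade (gr_quotient_ring R U) \<gamma>" "Y \<in> grade (gr_quotient_ring R U) \<delta>" for \<gamma> \<delta> X Y
    proof -
      obtain a b where "a \<in> grade R \<gamma>" "b \<in> grade R \<delta>" "X = U +> a" "Y = U +> b"
        using g(4,5) by (auto simp: quotient_simps(4))
      then show ?thesis using grade_mult[OF g(1-3)] RC.summand_carrier g(1,2)
        by (auto simp: coset_mult quotient_simps(4))
    qed
    show "X \<otimes>\<^bsub>gr_quotient_ring R U\<^esub> Y = \<zero>\<^bsub>gr_quotient_ring R U\<^esub>"
      if g: "\<gamma> \<in> arrows \<Gamma>" "\<delta> \<in> arrows \<Gamma>" "gdom \<Gamma> \<gamma> \<noteq> gran \<Gamma> \<delta>"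
        "X \<in> grade (gr_quotient_ring R U) \<gamma>" "Y \<in> grade (gr_quotient_ring R U) \<delta>" for \<gamma> \<delta> X Y
    proof -
      obtain a b where ab: "a \<in> grade R \<gamma>" "b \<in> grade R \<delta>" "X = U +> a" "Y = U +> b"
        using g(4,5) by (auto simp: quotient_simps(4))
      then have "X \<otimes>\<^bsub>gr_quotient_ring R U\<^esub> Y = U +> \<zero>"
        using grade_mult_zero[OF g(1-3) ab(1,2)] RC.summand_carrier g(1,2)
        by (auto simp: coset_mult)
      then show ?thesis using coset_zero_iff[of \<zero>] by (simp add: quotient_simps)
    qed
  qed (auto simp: quotient_simps(5) coset_add coset_mult m_closed m_assoc l_distr r_distr)
qed

lemma coset_component:
  assumes a: "a \<in> carrier R"
  shows "internal_direct_sum.component (gr_quotient_ring R U) (arrows \<Gamma>)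
      (grade (gr_quotient_ring R U)) (U +> a) = (\<lambda>\<gamma>. U +> RC.component a \<gamma>)"
proof -
  interpret QR: graded_ring \<Gamma> "gr_quotient_ring R U" by (rule quotient_graded_ring)
  obtain F where F: "RC.decomp a (RC.component a) F" using RC.decomp_component[OF a] by blast
  have "QR.RC.decomp (U +> a) (\<lambda>\<gamma>. U +> RC.component a \<gamma>) F"
    using F coset_finsum[of F "RC.component a"] coset_zero_iff[of \<zero>] RC.component_carrier[OF a]
    by (auto simp: QR.RC.decomp_def RC.decomp_def quotient_simps(1,4))
  then show ?thesis by (rule QR.RC.component_eq)
qed

text \<open>With \<open>gr_right_ideal_coset_vimage\<close>, one half each of the correspondence
  between graded right ideals of R/U and those of R above U.\<close>

lemma gr_right_ideal_coset_image:
  assumes "gr_right_ideal \<Gamma> R K"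
  shows "gr_right_ideal \<Gamma> (gr_quotient_ring R U) ((\<lambda>a. U +> a) ` K)"
proof -
  interpret QR: graded_ring \<Gamma> "gr_quotient_ring R U" by (rule quotient_graded_ring)
  note K = gr_right_ideal_carrier[OF assms] gr_right_ideal_zero[OF assms]
    gr_right_ideal_add[OF assms] gr_right_ideal_minus[OF assms] gr_right_ideal_mult[OF assms]
    gr_right_ideal_component[OF assms]
  have zero: "U +> \<zero> = U" using coset_zero_iff[of \<zero>] by simp
  have minus: "\<ominus>\<^bsub>gr_quotient_ring R U\<^esub> (U +> a) = U +> \<ominus> a" if "a \<in> carrier R" for a
    using that zero by (intro Q.minus_equality)
      (auto simp: quotient_simps(1,5) coset_add l_neg)
  show ?thesis unfolding QR.gr_right_ideal_iff
    using K zero by (auto simp: quotient_simps(1,5) coset_add coset_mult coset_component minus)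
qed

lemma gr_right_ideal_coset_vimage:
  assumes S: "gr_right_ideal \<Gamma> (gr_quotient_ring R U) S"
  shows "gr_right_ideal \<Gamma> R {a \<in> carrier R. U +> a \<in> S}"
proof -
  interpret QR: graded_ring \<Gamma> "gr_quotient_ring R U" by (rule quotient_graded_ring)
  note S' = QR.gr_right_ideal_zero[OF S] QR.gr_right_ideal_add[OF S]
    QR.gr_right_ideal_minus[OF S] QR.gr_right_ideal_mult[OF S] QR.gr_right_ideal_component[OF S]
  have zero: "U +> \<zero> = U" using coset_zero_iff[of \<zero>] by simp
  have minus: "\<ominus>\<^bsub>gr_quotient_ring R U\<^esub> (U +> a) = U +> \<ominus> a" if "a \<in> carrier R" for a
    using that zero by (intro Q.minus_equality)
      (auto simp: quotient_simps(1,5) coset_add l_neg)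
  show ?thesis unfolding gr_right_ideal_iff
  proof (intro conjI ballI)
    show "\<zero> \<in> {a \<in> carrier R. U +> a \<in> S}" using S'(1) zero by (simp add: quotient_simps(1))
    fix x assume x: "x \<in> {a \<in> carrier R. U +> a \<in> S}"
    show "\<ominus> x \<in> {a \<in> carrier R. U +> a \<in> S}" using x S'(3)[of "U +> x"] minus[of x] by simp
    show "x \<otimes> a \<in> {a \<in> carrier R. U +> a \<in> S}" if "a \<in> carrier R" for a
      using x that S'(4)[of "U +> x" "U +> a"]
      by (simp add: coset_mult m_closed quotient_simps(5))
    show "RC.component x \<gamma> \<in> {a \<in> carrier R. U +> a \<in> S}" if "\<gamma> \<in> arrows \<Gamma>" for \<gamma>
      using x that S'(5)[of "U +> x" \<gamma>] coset_component[of x] RC.component_carrier by simp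
    show "x \<oplus> y \<in> {a \<in> carrier R. U +> a \<in> S}" if "y \<in> {a \<in> carrier R. U +> a \<in> S}" for y
      using x that S'(2)[of "U +> x" "U +> y"] by (simp add: coset_add)
  qed auto
qed

text \<open>Moves semisimplicity of R/U into R, so that no module over R/U has to be considered. The
  family consists of the preimages of the simple summands; that these summands span is phrased as a
  test, since an additively closed set containing U and all the preimages must be R.\<close>

lemma gr_semisimple_quotient_cover:
  assumes "gr_semisimple_ring \<Gamma> (gr_quotient_ring R U)"
  obtains \<T> where
    "\<And>T. T \<in> \<T> \<Longrightarrow> gr_right_ideal \<Gamma> R T" "\<And>T. T \<in> \<T> \<Longrightarrow> U \<subseteq> T"
    "\<And>T K. T \<in> \<T> \<Longrightarrow> gr_right_ideal \<Gamma> R K \<Longrightarrow> U \<subseteq> K \<Longrightarrow> K \<subseteq> T \<Longrightarrow> K = U \<or> K = T"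
    "\<And>N. N \<subseteq> carrier R \<Longrightarrow> (\<And>x y. x \<in> N \<Longrightarrow> y \<in> N \<Longrightarrow> x \<oplus> y \<in> N) \<Longrightarrow> U \<subseteq> N \<Longrightarrow>
      (\<And>T. T \<in> \<T> \<Longrightarrow> T \<subseteq> N) \<Longrightarrow> N = carrier R"
proof -
  let ?Q = "gr_quotient_ring R U"
  interpret QR: graded_ring \<Gamma> ?Q by (rule quotient_graded_ring)
  obtain \<S> where S: "\<And>S. S \<in> \<S> \<Longrightarrow> gr_submodule \<Gamma> ?Q (regular_module ?Q) S"
    "\<And>S. S \<in> \<S> \<Longrightarrow> gr_simple \<Gamma> ?Q (sub_module (regular_module ?Q) S)"
    "sum_of (regular_module ?Q) \<S> (\<lambda>S. S) = carrier ?Q"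
    using assms unfolding gr_semisimple_ring_def gr_semisimple_def by auto
  define pre where "pre S = {a \<in> carrier R. U +> a \<in> S}" for S
  have pre: "gr_right_ideal \<Gamma> R (pre S)" if "S \<in> \<S>" for S
    unfolding pre_def
    using gr_right_ideal_coset_vimage S(1)[OF that] unfolding gr_right_ideal_def by blast
  show thesis
  proof (rule that[of "pre ` \<S>"])
    show "gr_right_ideal \<Gamma> R T" if "T \<in> pre ` \<S>" for T using that pre by blast
    show "U \<subseteq> T" if T: "T \<in> pre ` \<S>" for T
    proof
      fix u assume u: "u \<in> U"
      obtain S where "S \<in> \<S>" "T = pre S" using T by blast
      moreover from this have "U \<in> S"
        using QR.reg.gr_submodule_zero[OF S(1)] by (simp add: quotient_simps(1))
      ultimately show "u \<in> T"
        using u U.a_rcos_const gr_right_ideal_carrier[OF U] unfolding pre_def by simp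
    qed
    show "K = U \<or> K = T"
      if T: "T \<in> pre ` \<S>" and K: "gr_right_ideal \<Gamma> R K" "U \<subseteq> K" "K \<subseteq> T" for T K
    proof -
      obtain S where S': "S \<in> \<S>" "T = pre S" using T by blast
      note Kc = gr_right_ideal_carrier[OF K(1)]
      let ?I = "(\<lambda>a. U +> a) ` K"
      have "?I \<subseteq> S" using K(3) S'(2) unfolding pre_def by auto
      moreover have "gr_submodule \<Gamma> ?Q (regular_module ?Q) ?I"
        using gr_right_ideal_coset_image[OF K(1)] unfolding gr_right_ideal_def .
      ultimately have "gr_submodule \<Gamma> ?Q (sub_module (regular_module ?Q) S) ?I"
        using QR.reg.sub_module_gr_submodule[OF S(1)[OF S'(1)]] by blast
      then have "?I = {U} \<or> ?I = S"
        using S(2)[OF S'(1)] unfolding gr_simple_def by (auto simp: quotient_simps(1))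
      then show ?thesis
      proof
        assume I: "?I = {U}"
        have "a \<in> U" if "a \<in> K" for a
        proof -
          have "U +> a = U" using I that by auto
          then show ?thesis using coset_zero_iff[OF Kc[OF that]] by simp
        qed
        then have "K \<subseteq> U" by auto
        then show ?thesis using K(2) by blast
      next
        assume I: "?I = S"
        \<comment> \<open>\<open>K\<close> contains \<open>U\<close>, hence is the full preimage of
          its image.\<close>
        have "a \<in> K" if a: "a \<in> T" for a
        proof -
          have ac: "a \<in> carrier R" and "U +> a \<in> ?I" using a I S'(2) unfolding pre_def by auto
          then obtain k where k: "k \<in> K" "U +> a = U +> k" by auto
          then have "a \<oplus> \<ominus> k \<in> K" using coset_eq_iff[OF ac Kc] K(2) by blast
          then have "(a \<oplus> \<ominus> k) \<oplus> k \<in> K" using gr_right_ideal_add[OF K(1)] k by blast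
          then show ?thesis using ac Kc[OF k(1)] by (simp add: a_assoc l_neg)
        qed
        then show ?thesis using K(3) by blast
      qed
    qed
    show "N = carrier R"
      if N: "N \<subseteq> carrier R" "\<And>x y. x \<in> N \<Longrightarrow> y \<in> N \<Longrightarrow> x \<oplus> y \<in> N" "U \<subseteq> N"
        and T: "\<And>T. T \<in> pre ` \<S> \<Longrightarrow> T \<subseteq> N" for N
    proof (intro equalityI subsetI)
      fix a assume a: "a \<in> carrier R"
      then have "U +> a \<in> sum_of (regular_module ?Q) \<S> (\<lambda>S. S)"
        using S(3) by (auto simp: quotient_simps(5))
      then obtain f F where f: "U +> a = finsum ?Q f F" "finite F" "F \<subseteq> \<S>" "\<forall>S\<in>F. f S \<in> S"
        unfolding sum_of_def by auto
      have "\<forall>S\<in>F. \<exists>b. b \<in> pre S \<and> f S = U +> b"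
        using f(3,4) QR.reg.gr_submodule_carrier[OF S(1)]
        unfolding pre_def by (fastforce simp: quotient_simps(5))
      then obtain g where g: "\<And>S. S \<in> F \<Longrightarrow> g S \<in> pre S" "\<And>S. S \<in> F \<Longrightarrow> f S = U +> g S"
        by metis
      have gc: "g \<in> F \<rightarrow> carrier R" using g(1) unfolding pre_def by auto
      have "finsum ?Q f F = finsum ?Q (\<lambda>S. U +> g S) F"
        using g(2) gc by (intro Q.finsum_cong') (auto simp: quotient_simps(5))
      then have "U +> a = U +> finsum R g F" using f coset_finsum gc by simp
      \<comment> \<open>The lifted sum agrees with \<open>a\<close> only up to \<open>U\<close>;
        this is where the test set must contain \<open>U\<close>.\<close>
      then have "a \<oplus> \<ominus> finsum R g F \<in> N" using coset_eq_iff[OF a] gc N(3) by auto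
      moreover have "g S \<in> N" if "S \<in> F" for S using T[OF imageI] g(1)[OF that] f(3) that by blast
      then have "finsum R g F \<in> N"
        using RC.finsum_mem[of N F g] N f(2) gr_right_ideal_zero[OF U] by blast
      ultimately have "(a \<oplus> \<ominus> finsum R g F) \<oplus> finsum R g F \<in> N" using N(2) by blast
      then show "a \<in> N" using a gc by (simp add: a_assoc l_neg)
    qed (use N(1) in auto)
  qed
qed

end

end

section \<open>Chain conditions on intervals\<close>

text \<open>Stated as well-foundedness, like \<open>acc\<close>, so that lexicographic products and
  minimal elements of subfamilies are available; the forms without infinite chains are derived as
  equivalences.\<close>

definition dcc :: "'a set set \<Rightarrow> bool"
  where "dcc \<N> \<longleftrightarrow> wf {(X, Y). X \<in> \<N> \<and> Y \<in> \<N> \<and> X \<subset> Y}"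

definition acc :: "'a set set \<Rightarrow> bool"
  where "acc \<N> \<longleftrightarrow> wf {(X, Y). X \<in> \<N> \<and> Y \<in> \<N> \<and> Y \<subset> X}"

lemma dcc_iff_no_chain: "dcc \<N> \<longleftrightarrow> \<not> (\<exists>N. (\<forall>i. N i \<in> \<N>) \<and> (\<forall>i. N (Suc i) \<subset> N i))"
proof -
  have "(\<forall>i. (N (Suc i), N i) \<in> {(X, Y). X \<in> \<N> \<and> Y \<in> \<N> \<and> X \<subset> Y}) \<longleftrightarrow>
      (\<forall>i. N i \<in> \<N>) \<and> (\<forall>i. N (Suc i) \<subset> N i)" for N
    by auto
  then show ?thesis unfolding dcc_def wf_iff_no_infinite_down_chain by simp
qed

lemma acc_iff_no_chain: "acc \<N> \<longleftrightarrow> \<not> (\<exists>N. (\<forall>i. N i \<in> \<N>) \<and> (\<forall>i. N i \<subset> N (Suc i)))"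
proof -
  have "(\<forall>i. (N (Suc i), N i) \<in> {(X, Y). X \<in> \<N> \<and> Y \<in> \<N> \<and> Y \<subset> X}) \<longleftrightarrow>
      (\<forall>i. N i \<in> \<N>) \<and> (\<forall>i. N i \<subset> N (Suc i))" for N
    by auto
  then show ?thesis unfolding acc_def wf_iff_no_infinite_down_chain by simp
qed

lemma dcc_mono: "\<N> \<subseteq> \<N>' \<Longrightarrow> dcc \<N>' \<Longrightarrow> dcc \<N>"
  unfolding dcc_def by (erule wf_subset) auto

lemma acc_mono: "\<N> \<subseteq> \<N>' \<Longrightarrow> acc \<N>' \<Longrightarrow> acc \<N>"
  unfolding acc_def by (erule wf_subset) auto

lemma dcc_minimal:
  assumes "dcc \<N>" "\<K> \<subseteq> \<N>" "K \<in> \<K>"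
  obtains L where "L \<in> \<K>" "\<And>L'. L' \<in> \<K> \<Longrightarrow> L' \<subseteq> L \<Longrightarrow> L' = L"
proof -
  obtain L where L: "L \<in> \<K>" "\<And>L'. (L', L) \<in> {(X, Y). X \<in> \<N> \<and> Y \<in> \<N> \<and> X \<subset> Y} \<Longrightarrow> L' \<notin> \<K>"
    by (rule wfE_min[OF assms(1)[unfolded dcc_def] assms(3)]) (rule that)
  then have "L' = L" if "L' \<in> \<K>" "L' \<subseteq> L" for L' using that assms(2) by blast
  then show thesis using that L(1) by blast
qed

lemma acc_maximal:
  assumes "acc \<N>" "\<K> \<subseteq> \<N>" "K \<in> \<K>"
  obtains L where "L \<in> \<K>" "\<And>L'. L' \<in> \<K> \<Longrightarrow> L \<subseteq> L' \<Longrightarrow> L' = L"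
proof -
  obtain L where L: "L \<in> \<K>" "\<And>L'. (L', L) \<in> {(X, Y). X \<in> \<N> \<and> Y \<in> \<N> \<and> Y \<subset> X} \<Longrightarrow> L' \<notin> \<K>"
    by (rule wfE_min[OF assms(1)[unfolded acc_def] assms(3)]) (rule that)
  then have "L' = L" if "L' \<in> \<K>" "L \<subseteq> L'" for L' using that assms(2) by blast
  then show thesis using that L(1) by blast
qed

context graded_module
begin

text \<open>Plays the role of the lattice of graded submodules of A/B.\<close>

definition interval :: "'m set \<Rightarrow> 'm set \<Rightarrow> 'm set set"
  where "interval B A = {N. gr_submodule \<Gamma> R M N \<and> B \<subseteq> N \<and> N \<subseteq> A}"

lemma interval_full: "interval {\<zero>\<^bsub>M\<^esub>} (carrier M) = Collect (gr_submodule \<Gamma> R M)"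
  unfolding interval_def using gr_submodule_subset gr_submodule_zero by blast

lemma gr_artinian_iff: "gr_artinian \<Gamma> R M \<longleftrightarrow> dcc (interval {\<zero>\<^bsub>M\<^esub>} (carrier M))"
  unfolding gr_artinian_def interval_full dcc_iff_no_chain by simp

lemma gr_noetherian_iff: "gr_noetherian \<Gamma> R M \<longleftrightarrow> acc (interval {\<zero>\<^bsub>M\<^esub>} (carrier M))"
  unfolding gr_noetherian_def interval_full acc_iff_no_chain by simp

text \<open>Chain conditions pass to extensions because N -> (N \<inter> B, N + B) is strictly
  monotone into the lexicographic product of [C, B] and [B, A]: by modularity a proper inclusion
  cannot leave both entries unchanged.\<close>

lemma
  assumes B: "gr_submodule \<Gamma> R M B" and "C \<subseteq> B" "B \<subseteq> A" and A: "gr_submodule \<Gamma> R M A"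
  shows dcc_interval_split: "dcc (interval C B) \<Longrightarrow> dcc (interval B A) \<Longrightarrow> dcc (interval C A)"
    and acc_interval_split: "acc (interval C B) \<Longrightarrow> acc (interval B A) \<Longrightarrow> acc (interval C A)"
proof -
  let ?f = "\<lambda>N. (N \<inter> B, N <+>\<^bsub>M\<^esub> B)"
  have mem: "N \<inter> B \<in> interval C B" "N <+>\<^bsub>M\<^esub> B \<in> interval B A" if "N \<in> interval C A" for N
    using that assms(2,3) gr_submodule_Int[OF _ B] gr_submodule_set_add[OF _ B]
      set_add_upper(2)[OF _ B] set_add_least[OF A, of N B] unfolding interval_def by auto
  have strict: "N \<inter> B \<subset> K \<inter> B \<or> N \<inter> B = K \<inter> B \<and> N <+>\<^bsub>M\<^esub> B \<subset> K <+>\<^bsub>M\<^esub> B"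
    if "N \<in> interval C A" "K \<in> interval C A" "N \<subset> K" for N K
  proof -
    have "N <+>\<^bsub>M\<^esub> B \<subseteq> K <+>\<^bsub>M\<^esub> B" using that(3) by (intro set_add_mono) auto
    moreover have "\<not> (N \<inter> B = K \<inter> B \<and> N <+>\<^bsub>M\<^esub> B = K <+>\<^bsub>M\<^esub> B)"
      using eq_if_Int_set_add_eq[OF _ B, of N K] that unfolding interval_def by blast
    ultimately show ?thesis using that(3) by blast
  qed
  show "dcc (interval C A)" if "dcc (interval C B)" "dcc (interval B A)"
    unfolding dcc_def
    by (rule wf_subset[OF wf_inv_image[OF wf_lex_prod[OF that[unfolded dcc_def]], of ?f]])
      (use mem strict in \<open>fastforce simp: in_inv_image\<close>)
  show "acc (interval C A)" if "acc (interval C B)" "acc (interval B A)"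
    unfolding acc_def
    by (rule wf_subset[OF wf_inv_image[OF wf_lex_prod[OF that[unfolded acc_def]], of ?f]])
      (use mem strict in \<open>fastforce simp: in_inv_image\<close>)
qed

section \<open>Semisimple layers\<close>

text \<open>The classical argument for semisimple modules, with Y/Z in the role of a module over
  R/J. Zorn's lemma yields a maximal C with X \<inter> C = Z. If X + C missed a homogeneous x of Y,
  then x T would not lie in X + C for some T minimal above J, and C + x T would be a larger
  candidate.\<close>

lemma semisimple_layer_complement:
  assumes sl: "gr_semilocal \<Gamma> R"
    and Z: "gr_submodule \<Gamma> R M Z" and X: "gr_submodule \<Gamma> R M X" and Y: "gr_submodule \<Gamma> R M Y"
    and "Z \<subseteq> X" "X \<subseteq> Y" and YJ: "\<And>y u. y \<in> Y \<Longrightarrow> u \<in> gr_radical \<Gamma> R \<Longrightarrow> y \<triangleleft>\<^bsub>M\<^esub> u \<in> Z"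
  obtains C where "gr_submodule \<Gamma> R M C" "Z \<subseteq> C" "C \<subseteq> Y" "X <+>\<^bsub>M\<^esub> C = Y" "X \<inter> C = Z"
proof -
  let ?J = "gr_radical \<Gamma> R"
  note J = gr_right_ideal_radical
  obtain \<T> where T: "\<And>T. T \<in> \<T> \<Longrightarrow> gr_right_ideal \<Gamma> R T" "\<And>T. T \<in> \<T> \<Longrightarrow> ?J \<subseteq> T"
    and simple: "\<And>T K. T \<in> \<T> \<Longrightarrow> gr_right_ideal \<Gamma> R K \<Longrightarrow> ?J \<subseteq> K \<Longrightarrow> K \<subseteq> T \<Longrightarrow> K = ?J \<or> K = T"
    and cover: "\<And>N. N \<subseteq> carrier R \<Longrightarrow> (\<And>x y. x \<in> N \<Longrightarrow> y \<in> N \<Longrightarrow> x \<oplus> y \<in> N) \<Longrightarrow> ?J \<subseteq> N \<Longrightarrow>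
      (\<And>T. T \<in> \<T> \<Longrightarrow> T \<subseteq> N) \<Longrightarrow> N = carrier R"
    by (rule gr_semisimple_quotient_cover[OF J gr_radical_left_closed
          sl[unfolded gr_semilocal_def]]) blast+
  let ?\<C> = "{C. gr_submodule \<Gamma> R M C \<and> Z \<subseteq> C \<and> C \<subseteq> Y \<and> X \<inter> C = Z}"
  have "\<exists>C\<in>?\<C>. \<forall>C'\<in>?\<C>. C \<subseteq> C' \<longrightarrow> C' = C"
  proof (rule subset_Zorn_nonempty)
    show "?\<C> \<noteq> {}" using Z assms(5,6) by blast
    fix \<K> assume k: "\<K> \<noteq> {}" "subset.chain ?\<C> \<K>"
    then have k': "\<And>K. K \<in> \<K> \<Longrightarrow> K \<in> ?\<C>" unfolding subset.chain_def by blast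
    have "gr_submodule \<Gamma> R M (\<Union>\<K>)"
      using k(2) by (intro gr_submodule_Union_chain[OF k(1)]) (use k' in \<open>auto simp: subset_chain_def\<close>)
    moreover have "Z \<subseteq> \<Union>\<K>" "\<Union>\<K> \<subseteq> Y" "X \<inter> \<Union>\<K> = Z" using k(1) k' by blast+
    ultimately show "\<Union>\<K> \<in> ?\<C>" by blast
  qed
  \<comment> \<open>Maximality is recorded with the inclusion
    \<open>X \<inter> C' \<subseteq> Z\<close> only; the reverse one is automatic since Z lies in
    both X and C.\<close>
  then obtain C where C: "gr_submodule \<Gamma> R M C" "Z \<subseteq> C" "C \<subseteq> Y" "X \<inter> C = Z"
    and max: "\<And>C'. gr_submodule \<Gamma> R M C' \<Longrightarrow> C \<subseteq> C' \<Longrightarrow> C' \<subseteq> Y \<Longrightarrow> X \<inter> C' \<subseteq> Z \<Longrightarrow> C' = C"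
  proof -
    obtain C where C: "C \<in> ?\<C>" "\<forall>C'\<in>?\<C>. C \<subseteq> C' \<longrightarrow> C' = C"
      using \<open>\<exists>C\<in>?\<C>. \<forall>C'\<in>?\<C>. C \<subseteq> C' \<longrightarrow> C' = C\<close> by blast
    have mx: "C' = C" if "gr_submodule \<Gamma> R M C'" "C \<subseteq> C'" "C' \<subseteq> Y" "X \<inter> C' \<subseteq> Z" for C'
    proof -
      have "Z \<subseteq> C'" "X \<inter> C' = Z" using C(1) that assms(5) by auto
      then have "C' \<in> ?\<C>" using that by simp
      then show ?thesis using C(2) that(2) by blast
    qed
    show thesis by (rule that[OF _ _ _ _ mx]) (use C(1) in auto)
  qed
  let ?D = "X <+>\<^bsub>M\<^esub> C"
  have D: "gr_submodule \<Gamma> R M ?D" by (rule gr_submodule_set_add[OF X C(1)])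
  have upper: "X \<subseteq> ?D" "C \<subseteq> ?D" by (rule set_add_upper[OF X C(1)])+
  have "Y \<subseteq> ?D"
  proof (rule gr_submodule_le_if_homogeneous[OF Y D], rule subsetI)
    fix \<sigma> x assume s: "\<sigma> \<in> arrows \<Gamma>" and x: "x \<in> Y \<inter> grade M \<sigma>"
    then have xg: "x \<in> grade M \<sigma>" by blast
    note xc = gr_submodule_carrier[OF Y, of x]
    let ?N = "{a \<in> carrier R. x \<triangleleft>\<^bsub>M\<^esub> a \<in> ?D}"
    have N: "gr_right_ideal \<Gamma> R ?N" by (rule gr_right_ideal_transporter[OF s xg D])
    have JN: "?J \<subseteq> ?N" using YJ x gr_right_ideal_carrier[OF J] C(2) upper by blast
    have "T \<subseteq> ?N" if t: "T \<in> \<T>" for T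
    proof (rule ccontr)
      assume nT: "\<not> T \<subseteq> ?N"
      have "gr_right_ideal \<Gamma> R (T \<inter> ?N)"
        using T(1)[OF t] N reg.gr_submodule_Int unfolding gr_right_ideal_def by blast
      \<comment> \<open>\<open>T \<inter> ?N\<close> lies between J and T, so minimality of T leaves
        J or T, and T was excluded.\<close>
      then have TN: "T \<inter> ?N = ?J" using simple[OF t] T(2)[OF t] JN nT by blast
      let ?S = "(\<lambda>t. x \<triangleleft>\<^bsub>M\<^esub> t) ` T"
      have S: "gr_submodule \<Gamma> R M ?S" by (rule gr_submodule_image_ract[OF s xg T(1)[OF t]])
      \<comment> \<open>The enlarged candidate still meets X in Z: if c + x r lies in X with r in T,
        then x r lies in X + C, so r lies in J. Hence x r is in Z, thus in C, and c + x r lies in X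
        \<inter> C.\<close>
      have "C <+>\<^bsub>M\<^esub> ?S = C"
      proof (rule max)
        show "gr_submodule \<Gamma> R M (C <+>\<^bsub>M\<^esub> ?S)" by (rule gr_submodule_set_add[OF C(1) S])
        show "C \<subseteq> C <+>\<^bsub>M\<^esub> ?S" by (rule set_add_upper[OF C(1) S])
        show "C <+>\<^bsub>M\<^esub> ?S \<subseteq> Y"
          using C(3) gr_submodule_ract[OF Y] x gr_right_ideal_carrier[OF T(1)[OF t]]
          by (intro set_add_least[OF Y]) auto
        show "X \<inter> (C <+>\<^bsub>M\<^esub> ?S) \<subseteq> Z"
        proof
          fix z assume z: "z \<in> X \<inter> (C <+>\<^bsub>M\<^esub> ?S)"
          then obtain c r where c: "c \<in> C" "r \<in> T" "z = c \<oplus>\<^bsub>M\<^esub> x \<triangleleft>\<^bsub>M\<^esub> r"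
            by (auto simp: mem_set_add_iff)
          have rc: "r \<in> carrier R" using gr_right_ideal_carrier[OF T(1)[OF t] c(2)] .
          have "x \<triangleleft>\<^bsub>M\<^esub> r \<in> ?D"
            by (rule gr_submodule_add_cancel[OF D, of c])
              (use c z upper rc xc x ract_closed in auto)
          then have "x \<triangleleft>\<^bsub>M\<^esub> r \<in> C" using TN c(2) rc YJ x C(2) by blast
          then have "z \<in> C" using c gr_submodule_add[OF C(1)] by blast
          then show "z \<in> Z" using z C(4) by blast
        qed
      qed
      then have "?S \<subseteq> ?D" using set_add_upper(2)[OF C(1) S] upper by auto
      then show False using nT gr_right_ideal_carrier[OF T(1)[OF t]] by blast
    qed
    \<comment> \<open>The transporter of X + C along x contains every T, so it is R; applying this
      to the local identity puts x into X + C.\<close>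
    then have "?N = carrier R"
      using gr_right_ideal_add[OF N] JN by (intro cover) blast+
    then show "x \<in> ?D" using homogeneous_mem_orbit[OF s xg] by force
  qed
  then have "?D = Y" using set_add_least[OF Y assms(6) C(3)] by blast
  then show thesis using that C by blast
qed

text \<open>Complements reverse inclusions only when they are chosen compatibly. A recursive choice
  makes them nested, and strictness then follows because properly nested submodules cannot share a
  complement.\<close>

lemma semisimple_layer_dcc_iff_acc:
  assumes sl: "gr_semilocal \<Gamma> R"
    and B: "gr_submodule \<Gamma> R M B" and A: "gr_submodule \<Gamma> R M A" and "B \<subseteq> A"
    and AJ: "\<And>y u. y \<in> A \<Longrightarrow> u \<in> gr_radical \<Gamma> R \<Longrightarrow> y \<triangleleft>\<^bsub>M\<^esub> u \<in> B"
  shows "dcc (interval B A) \<longleftrightarrow> acc (interval B A)"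
proof -
  define compl where "compl X D \<longleftrightarrow> D \<in> interval B A \<and> X <+>\<^bsub>M\<^esub> D = A \<and> X \<inter> D = B" for X D
  have ex: "\<exists>D. compl X D" if X: "X \<in> interval B A" for X
  proof -
    have X': "gr_submodule \<Gamma> R M X" "B \<subseteq> X" "X \<subseteq> A" using X unfolding interval_def by auto
    obtain C where "gr_submodule \<Gamma> R M C" "B \<subseteq> C" "C \<subseteq> A" "X <+>\<^bsub>M\<^esub> C = A" "X \<inter> C = B"
      by (rule semisimple_layer_complement[OF sl B X'(1) A X'(2,3) AJ])
    then have "compl X C" unfolding compl_def interval_def by simp
    then show ?thesis ..
  qed
  have neq: "D \<noteq> D'" if "X \<in> interval B A" "X' \<in> interval B A" "compl X D" "compl X' D'" "X \<subset> X'"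
    for X X' D D'
  proof
    assume "D = D'"
    then have "X = X'" using that unfolding compl_def interval_def
      by (intro eq_if_Int_set_add_eq[of X D X']) auto
    then show False using that(5) by blast
  qed
  show ?thesis
  proof
    assume dcc: "dcc (interval B A)"
    show "acc (interval B A)" unfolding acc_iff_no_chain
    proof
      assume "\<exists>N. (\<forall>i. N i \<in> interval B A) \<and> (\<forall>i. N i \<subset> N (Suc i))"
      then obtain N where N: "\<And>i. N i \<in> interval B A" "\<And>i. N i \<subset> N (Suc i)" by blast
      have "\<exists>D. \<forall>i. compl (N i) (D i) \<and> D (Suc i) \<subseteq> D i"
      proof (rule dependent_nat_choice)
        fix D i assume D: "compl (N i) D"
        note Ns = N(1)[of "Suc i", unfolded interval_def, simplified]
        note D' = D[unfolded compl_def interval_def, simplified]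
        have X: "gr_submodule \<Gamma> R M (N (Suc i) \<inter> D)" using Ns D' gr_submodule_Int by blast
        \<comment> \<open>Complement of N_{i+1} \<inter> D within [B, D], which keeps the new
          complement below D. Then N_{i+1} + C contains D as well as N_i, so it contains N_i + D =
          A; and N_{i+1} \<inter> C = B because C lies in D.\<close>
        obtain C where C: "gr_submodule \<Gamma> R M C" "B \<subseteq> C" "C \<subseteq> D"
          "(N (Suc i) \<inter> D) <+>\<^bsub>M\<^esub> C = D" "(N (Suc i) \<inter> D) \<inter> C = B"
          by (rule semisimple_layer_complement[OF sl B X, of D]) (use Ns D' AJ in blast)+
        have NC: "gr_submodule \<Gamma> R M (N (Suc i) <+>\<^bsub>M\<^esub> C)"
          using Ns C(1) gr_submodule_set_add by blast
        have up: "N (Suc i) \<subseteq> N (Suc i) <+>\<^bsub>M\<^esub> C" "C \<subseteq> N (Suc i) <+>\<^bsub>M\<^esub> C"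
          using set_add_upper Ns C(1) by blast+
        have "D \<subseteq> N (Suc i) <+>\<^bsub>M\<^esub> C"
          using set_add_least[OF NC, of "N (Suc i) \<inter> D" C] up C(4) by blast
        then have "A \<subseteq> N (Suc i) <+>\<^bsub>M\<^esub> C"
          using set_add_least[OF NC, of "N i" D] up N(2)[of i] D' by blast
        moreover have "N (Suc i) <+>\<^bsub>M\<^esub> C \<subseteq> A"
          using set_add_least[OF A] Ns C(3) D' by blast
        ultimately have "compl (N (Suc i)) C"
          unfolding compl_def interval_def using C D' by blast
        then show "\<exists>C. compl (N (Suc i)) C \<and> C \<subseteq> D" using C(3) by blast
      qed (use ex N in blast)
      then obtain D where D: "\<And>i. compl (N i) (D i)" "\<And>i. D (Suc i) \<subseteq> D i" by blast
      then have "D (Suc i) \<subset> D i" for i using neq[OF N(1,1) D(1,1) N(2)] by blast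
      moreover have "D i \<in> interval B A" for i using D(1) unfolding compl_def by blast
      ultimately show False using dcc unfolding dcc_iff_no_chain by blast
    qed
  next
    assume acc: "acc (interval B A)"
    show "dcc (interval B A)" unfolding dcc_iff_no_chain
    proof
      assume "\<exists>N. (\<forall>i. N i \<in> interval B A) \<and> (\<forall>i. N (Suc i) \<subset> N i)"
      then obtain N where N: "\<And>i. N i \<in> interval B A" "\<And>i. N (Suc i) \<subset> N i" by blast
      have "\<exists>D. \<forall>i. compl (N i) (D i) \<and> D i \<subseteq> D (Suc i)"
      proof (rule dependent_nat_choice)
        fix D i assume D: "compl (N i) D"
        note Ns = N(1)[of "Suc i", unfolded interval_def, simplified]
        note D' = D[unfolded compl_def interval_def, simplified]
        have X: "gr_submodule \<Gamma> R M (N (Suc i) <+>\<^bsub>M\<^esub> D)" using Ns D' gr_submodule_set_add by blast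
        have up: "N (Suc i) \<subseteq> N (Suc i) <+>\<^bsub>M\<^esub> D" "D \<subseteq> N (Suc i) <+>\<^bsub>M\<^esub> D"
          using set_add_upper Ns D' by blast+
        have XA: "N (Suc i) <+>\<^bsub>M\<^esub> D \<subseteq> A" using set_add_least[OF A] Ns D' by blast
        \<comment> \<open>Dually, a complement of N_{i+1} + D within [D, A], which keeps the new
          complement above D. The layer condition carries over from B to the larger lower bound
          D.\<close>
        obtain C where C: "gr_submodule \<Gamma> R M C" "D \<subseteq> C" "C \<subseteq> A"
          "(N (Suc i) <+>\<^bsub>M\<^esub> D) <+>\<^bsub>M\<^esub> C = A" "(N (Suc i) <+>\<^bsub>M\<^esub> D) \<inter> C = D"
          by (rule semisimple_layer_complement[OF sl _ X A, of D]) (use D' up XA AJ in blast)+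
        have NC: "gr_submodule \<Gamma> R M (N (Suc i) <+>\<^bsub>M\<^esub> C)"
          using Ns C(1) gr_submodule_set_add by blast
        have up': "N (Suc i) \<subseteq> N (Suc i) <+>\<^bsub>M\<^esub> C" "C \<subseteq> N (Suc i) <+>\<^bsub>M\<^esub> C"
          using set_add_upper Ns C(1) by blast+
        have "N (Suc i) <+>\<^bsub>M\<^esub> D \<subseteq> N (Suc i) <+>\<^bsub>M\<^esub> C"
          using set_add_least[OF NC] up' C(2) by blast
        then have "A \<subseteq> N (Suc i) <+>\<^bsub>M\<^esub> C"
          using set_add_least[OF NC, of "N (Suc i) <+>\<^bsub>M\<^esub> D" C] up' C(4) by blast
        moreover have "N (Suc i) <+>\<^bsub>M\<^esub> C \<subseteq> A"
          using set_add_least[OF A] Ns C(3) by blast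
        \<comment> \<open>The intersection lies in (N_{i+1} + D) \<inter> C = D and in N_i, hence in
          N_i \<inter> D = B.\<close>
        moreover have "N (Suc i) \<inter> C \<subseteq> N i \<inter> D" using C(5) up N(2)[of i] by blast
        ultimately have "compl (N (Suc i)) C"
          unfolding compl_def interval_def using C(1-3) D' Ns by blast
        then show "\<exists>C. compl (N (Suc i)) C \<and> D \<subseteq> C" using C(2) by blast
      qed (use ex N in blast)
      then obtain D where D: "\<And>i. compl (N i) (D i)" "\<And>i. D i \<subseteq> D (Suc i)" by blast
      then have "D i \<subset> D (Suc i)" for i using neq[OF N(1,1) D(1,1) N(2)] by blast
      moreover have "D i \<in> interval B A" for i using D(1) unfolding compl_def by blast
      ultimately show False using acc unfolding acc_iff_no_chain by blast
    qed
  qed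
qed

end

section \<open>The radical filtration\<close>

text \<open>The submodule N U spanned by products. No rule for negatives is included: for a
  submodule N they are obtained by negating the factor in N.\<close>

inductive_set act_prod :: "('g, 'r, 'm) gr_module \<Rightarrow> 'm set \<Rightarrow> 'r set \<Rightarrow> 'm set"
  for M N U where
    zero: "\<zero>\<^bsub>M\<^esub> \<in> act_prod M N U"
  | prod: "x \<in> N \<Longrightarrow> u \<in> U \<Longrightarrow> x \<triangleleft>\<^bsub>M\<^esub> u \<in> act_prod M N U"
  | sum: "x \<in> act_prod M N U \<Longrightarrow> y \<in> act_prod M N U \<Longrightarrow> x \<oplus>\<^bsub>M\<^esub> y \<in> act_prod M N U"

context graded_module
begin

lemma act_prod_subset:
  assumes "\<zero>\<^bsub>M\<^esub> \<in> K" "\<And>x y. x \<in> K \<Longrightarrow> y \<in> K \<Longrightarrow> x \<oplus>\<^bsub>M\<^esub> y \<in> K"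
    and "\<And>x u. x \<in> N \<Longrightarrow> u \<in> U \<Longrightarrow> x \<triangleleft>\<^bsub>M\<^esub> u \<in> K"
  shows "act_prod M N U \<subseteq> K"
proof
  fix z assume "z \<in> act_prod M N U"
  then show "z \<in> K" by induction (use assms in auto)
qed

lemma gr_submodule_act_prod:
  assumes N: "gr_submodule \<Gamma> R M N" and U: "gr_right_ideal \<Gamma> R U"
  shows "gr_submodule \<Gamma> R M (act_prod M N U)" "act_prod M N U \<subseteq> N"
proof -
  let ?P = "act_prod M N U"
  note Uc = gr_right_ideal_carrier[OF U] and Nc = gr_submodule_carrier[OF N]
  show PN: "?P \<subseteq> N"
    by (rule act_prod_subset)
      (use gr_submodule_zero[OF N] gr_submodule_add[OF N] gr_submodule_ract[OF N] Uc in auto)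
  have Pc: "?P \<subseteq> carrier M" using PN Nc by blast
  show "gr_submodule \<Gamma> R M ?P"
  proof (rule gr_submoduleI[OF Pc act_prod.zero act_prod.sum])
    show "\<ominus>\<^bsub>M\<^esub> z \<in> ?P" if "z \<in> ?P" for z
    proof -
      have "?P \<subseteq> {z \<in> carrier M. \<ominus>\<^bsub>M\<^esub> z \<in> ?P}"
      proof (rule act_prod_subset)
        fix x u assume "x \<in> N" "u \<in> U"
        then show "x \<triangleleft>\<^bsub>M\<^esub> u \<in> {z \<in> carrier M. \<ominus>\<^bsub>M\<^esub> z \<in> ?P}"
          using act_prod.prod[of "\<ominus>\<^bsub>M\<^esub> x" N u U M] gr_submodule_minus[OF N] Nc Uc
          by (simp add: minus_ract ract_closed)
      qed (auto simp: act_prod.zero act_prod.sum M.minus_add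
          M.minus_equality[OF M.r_zero[OF M.zero_closed]])
      then show ?thesis using that by blast
    qed
    show "z \<triangleleft>\<^bsub>M\<^esub> a \<in> ?P" if "z \<in> ?P" and a: "a \<in> carrier R" for z a
    proof -
      have "?P \<subseteq> {z \<in> carrier M. z \<triangleleft>\<^bsub>M\<^esub> a \<in> ?P}"
      proof (rule act_prod_subset)
        fix x u assume "x \<in> N" "u \<in> U"
        then show "x \<triangleleft>\<^bsub>M\<^esub> u \<in> {z \<in> carrier M. z \<triangleleft>\<^bsub>M\<^esub> a \<in> ?P}"
          using act_prod.prod[of x N "u \<otimes> a" U M] gr_right_ideal_mult[OF U _ a] Nc Uc a
          by (simp add: ract_assoc ract_closed)
      qed (auto simp: act_prod.zero act_prod.sum ract_l_distr a)
      then show ?thesis using that by blast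
    qed
    show "MC.component z \<gamma> \<in> ?P" if "z \<in> ?P" and g: "\<gamma> \<in> arrows \<Gamma>" for z \<gamma>
    proof -
      have "?P \<subseteq> {z \<in> carrier M. MC.component z \<gamma> \<in> ?P}"
      proof (rule act_prod_subset)
        fix x u assume x: "x \<in> N" and u: "u \<in> U"
        note uc = Uc[OF u]
        \<comment> \<open>\<open>x\<close> need not be homogeneous, and component formulas for x u
          require that. Passing to the component of degree \<sigma> gives the single product of that
          component with one component of u, or zero.\<close>
        have "x \<in> {x \<in> carrier M. MC.component (x \<triangleleft>\<^bsub>M\<^esub> u) \<gamma> \<in> ?P}"
        proof (rule MC.mem_if_components[OF Nc[OF x]])
          fix \<sigma> assume s: "\<sigma> \<in> arrows \<Gamma>"
          have y: "MC.component x \<sigma> \<in> grade M \<sigma>" "MC.component x \<sigma> \<in> N"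
            using MC.component_mem Nc x s gr_submodule_component[OF N] by auto
          have "MC.component (MC.component x \<sigma> \<triangleleft>\<^bsub>M\<^esub> u) \<gamma> \<in> ?P"
          proof (cases "gran \<Gamma> \<gamma> = gran \<Gamma> \<sigma>")
            case True
            then obtain \<delta> where d: "\<delta> \<in> arrows \<Gamma>" "gdom \<Gamma> \<sigma> = gran \<Gamma> \<delta>" "gcomp \<Gamma> \<sigma> \<delta> = \<gamma>"
              using comp_left_solve[OF s g] by blast
            then show ?thesis
              using component_ract[OF s y(1) uc d(1,2)] gr_right_ideal_component[OF U u d(1)] y(2)
              by (simp add: act_prod.prod)
          next
            case False
            then show ?thesis using component_ract_zero[OF s y(1) uc g] by (simp add: act_prod.zero)
          qed
          then show "MC.component x \<sigma> \<in> {x \<in> carrier M. MC.component (x \<triangleleft>\<^bsub>M\<^esub> u) \<gamma> \<in> ?P}"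
            using y(2) Nc by blast
        qed (auto simp: uc act_prod.zero act_prod.sum MC.component_zero ract_l_distr ract_closed
            MC.component_add)
        then show "x \<triangleleft>\<^bsub>M\<^esub> u \<in> {z \<in> carrier M. MC.component z \<gamma> \<in> ?P}"
          using uc ract_closed by blast
      qed (auto simp: act_prod.zero act_prod.sum MC.component_zero MC.component_add)
      then show ?thesis using that by blast
    qed
  qed
qed

text \<open>The term N J^n of the radical filtration, obtained by iterated multiplication. It makes
  sense for n = 0, whereas \<open>ideal_pow\<close> begins with exponent 1.\<close>

definition rad_layer :: "'m set \<Rightarrow> nat \<Rightarrow> 'm set"
  where "rad_layer N n = ((\<lambda>K. act_prod M K (gr_radical \<Gamma> R)) ^^ n) N"

lemma rad_layer_0 [simp]: "rad_layer N 0 = N"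
  and rad_layer_Suc: "rad_layer N (Suc n) = act_prod M (rad_layer N n) (gr_radical \<Gamma> R)"
  unfolding rad_layer_def by simp_all

lemma rad_layer_Suc': "rad_layer N (Suc n) = rad_layer (act_prod M N (gr_radical \<Gamma> R)) n"
  unfolding rad_layer_def funpow_Suc_right by simp

lemma gr_submodule_rad_layer:
  "gr_submodule \<Gamma> R M N \<Longrightarrow> gr_submodule \<Gamma> R M (rad_layer N n)"
  by (induction n) (simp_all add: rad_layer_Suc gr_submodule_act_prod gr_right_ideal_radical)

lemma rad_layer_antimono:
  assumes "gr_submodule \<Gamma> R M N" "m \<le> n"
  shows "rad_layer N n \<subseteq> rad_layer N m"
  using assms(2)
proof (rule lift_Suc_antimono_le[rotated])
  show "rad_layer N (Suc k) \<subseteq> rad_layer N k" for k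
    unfolding rad_layer_Suc
    by (rule gr_submodule_act_prod(2)[OF gr_submodule_rad_layer[OF assms(1)] gr_right_ideal_radical])
qed

text \<open>Induction on the length with N varying: N J has one layer less, and [N J, N] is a
  semisimple layer. Both chain conditions are assembled from these two intervals and restrict to
  them.\<close>

lemma dcc_iff_acc_if_rad_layer_zero:
  assumes sl: "gr_semilocal \<Gamma> R"
  shows "gr_submodule \<Gamma> R M N \<Longrightarrow> rad_layer N n = {\<zero>\<^bsub>M\<^esub>} \<Longrightarrow>
    dcc (interval {\<zero>\<^bsub>M\<^esub>} N) \<longleftrightarrow> acc (interval {\<zero>\<^bsub>M\<^esub>} N)"
proof (induction n arbitrary: N)
  case 0
  then have "N = {\<zero>\<^bsub>M\<^esub>}" by simp
  then have "interval {\<zero>\<^bsub>M\<^esub>} N \<subseteq> {{\<zero>\<^bsub>M\<^esub>}}" unfolding interval_def by auto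
  moreover have "dcc {{\<zero>\<^bsub>M\<^esub>}}" "acc {{\<zero>\<^bsub>M\<^esub>}}"
    unfolding dcc_iff_no_chain acc_iff_no_chain by auto
  ultimately show ?case using dcc_mono acc_mono by blast
next
  case (Suc n)
  let ?B = "act_prod M N (gr_radical \<Gamma> R)"
  note B = gr_submodule_act_prod[OF Suc.prems(1) gr_right_ideal_radical]
  have IH: "dcc (interval {\<zero>\<^bsub>M\<^esub>} ?B) \<longleftrightarrow> acc (interval {\<zero>\<^bsub>M\<^esub>} ?B)"
    using Suc.IH[OF B(1)] Suc.prems(2) by (simp add: rad_layer_Suc')
  have layer: "dcc (interval ?B N) \<longleftrightarrow> acc (interval ?B N)"
    by (rule semisimple_layer_dcc_iff_acc[OF sl B(1) Suc.prems(1) B(2)]) (rule act_prod.prod)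
  have z: "{\<zero>\<^bsub>M\<^esub>} \<subseteq> ?B" using gr_submodule_zero[OF B(1)] by blast
  have sub: "interval {\<zero>\<^bsub>M\<^esub>} ?B \<subseteq> interval {\<zero>\<^bsub>M\<^esub>} N" "interval ?B N \<subseteq> interval {\<zero>\<^bsub>M\<^esub>} N"
    using z B(2) unfolding interval_def by blast+
  show ?case
    using dcc_interval_split[OF B(1) z B(2) Suc.prems(1)] dcc_mono[OF sub(1)] dcc_mono[OF sub(2)]
      acc_interval_split[OF B(1) z B(2) Suc.prems(1)] acc_mono[OF sub(1)] acc_mono[OF sub(2)]
      IH layer by blast
qed

lemma gr_artinian_iff_noetherian:
  assumes "gr_semilocal \<Gamma> R" "rad_layer (carrier M) n = {\<zero>\<^bsub>M\<^esub>}"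
  shows "gr_artinian \<Gamma> R M \<longleftrightarrow> gr_noetherian \<Gamma> R M"
  unfolding gr_artinian_iff gr_noetherian_iff
  by (rule dcc_iff_acc_if_rad_layer_zero[OF assms(1) gr_submodule_top assms(2)])

section \<open>Powers of the radical and their action on the module\<close>

lemma ideal_pow_Suc:
  "n \<ge> 1 \<Longrightarrow> ideal_pow R U (Suc n) = ideal_prod R (ideal_pow R U n) U"
  unfolding ideal_pow_def by (cases n) simp_all

text \<open>Closure from the right yields that the powers decrease; closure from the left makes the
  elements annihilated by a power a right submodule.\<close>

lemma ideal_pow_radical:
  assumes "n \<ge> 1"
  shows "ideal_pow R (gr_radical \<Gamma> R) n \<subseteq> carrier R \<and>
    (\<forall>p\<in>ideal_pow R (gr_radical \<Gamma> R) n. \<forall>a\<in>carrier R.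
      a \<otimes> p \<in> ideal_pow R (gr_radical \<Gamma> R) n \<and> p \<otimes> a \<in> ideal_pow R (gr_radical \<Gamma> R) n)"
  using assms
proof (induction n rule: dec_induct)
  case base
  show ?case
    using gr_right_ideal_radical gr_radical_left_closed gr_right_ideal_carrier gr_right_ideal_mult
    by (auto simp: ideal_pow_def)
next
  case (step n)
  let ?P = "ideal_pow R (gr_radical \<Gamma> R) n" and ?J = "gr_radical \<Gamma> R"
  note J = gr_right_ideal_carrier[OF gr_right_ideal_radical]
    gr_right_ideal_mult[OF gr_right_ideal_radical]
  have "q \<in> carrier R \<and> (\<forall>a\<in>carrier R. a \<otimes> q \<in> ideal_prod R ?P ?J \<and> q \<otimes> a \<in> ideal_prod R ?P ?J)"
    if "q \<in> ideal_prod R ?P ?J" for q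
    using that
  proof induction
    case (prod p u)
    have c: "p \<in> carrier R" "u \<in> carrier R" using prod step.IH J by auto
    have "a \<otimes> (p \<otimes> u) \<in> ideal_prod R ?P ?J" "(p \<otimes> u) \<otimes> a \<in> ideal_prod R ?P ?J"
      if a: "a \<in> carrier R" for a
      using ideal_prod.prod[of "a \<otimes> p" ?P u ?J R] ideal_prod.prod[of p ?P "u \<otimes> a" ?J R]
        prod step.IH J a c by (simp_all add: m_assoc)
    then show ?case using c m_closed by blast
  next
    case (sum p q)
    then show ?case by (simp add: l_distr r_distr ideal_prod.sum)
  qed
  then show ?case using step.hyps by (auto simp: ideal_pow_Suc)
qed

lemma ideal_pow_radical_antimono:
  assumes "1 \<le> m" "m \<le> n"
  shows "ideal_pow R (gr_radical \<Gamma> R) n \<subseteq> ideal_pow R (gr_radical \<Gamma> R) m"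
  using assms(2)
proof (induction n rule: dec_induct)
  case (step n)
  have n: "n \<ge> 1" using assms(1) step.hyps by simp
  let ?P = "ideal_pow R (gr_radical \<Gamma> R)"
  \<comment> \<open>Exponent 1 is J itself rather than a product, so additivity of the powers needs
    a separate case there.\<close>
  have add: "q \<oplus> r \<in> ?P k" if "k \<ge> 1" "q \<in> ?P k" "r \<in> ?P k" for q r k
  proof (cases "k = 1")
    case True
    then show ?thesis using that gr_right_ideal_add[OF gr_right_ideal_radical]
      by (simp add: ideal_pow_def)
  next
    case False
    then have "?P k = ideal_prod R (?P (k - 1)) (gr_radical \<Gamma> R)"
      using ideal_pow_Suc[of "k - 1"] that(1) by simp
    then show ?thesis using that by (simp add: ideal_prod.sum)
  qed
  have "q \<in> ?P n" if "q \<in> ideal_prod R (?P n) (gr_radical \<Gamma> R)" for q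
    using that
  proof induction
    case (prod p u)
    then show ?case
      using ideal_pow_radical[OF n] gr_right_ideal_carrier[OF gr_right_ideal_radical] by blast
  qed (use add n in blast)
  then show ?case using step.IH ideal_pow_Suc[OF n] by auto
qed simp

text \<open>Connects the iterated products ((M J) J) ... with the powers J^n, about which the
  nilpotency hypotheses speak: M J^n lies in every additively closed set containing zero and all x p
  with p in J^n.\<close>

lemma rad_layer_subset:
  assumes "n \<ge> 1"
  shows "K \<subseteq> carrier M \<Longrightarrow> \<zero>\<^bsub>M\<^esub> \<in> K \<Longrightarrow> (\<And>x y. x \<in> K \<Longrightarrow> y \<in> K \<Longrightarrow> x \<oplus>\<^bsub>M\<^esub> y \<in> K) \<Longrightarrow>
    (\<And>x p. x \<in> carrier M \<Longrightarrow> p \<in> ideal_pow R (gr_radical \<Gamma> R) n \<Longrightarrow> x \<triangleleft>\<^bsub>M\<^esub> p \<in> K) \<Longrightarrow>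
    rad_layer (carrier M) n \<subseteq> K"
  using assms
proof (induction n arbitrary: K rule: dec_induct)
  case base
  have "act_prod M (carrier M) (gr_radical \<Gamma> R) \<subseteq> K"
    by (rule act_prod_subset) (use base in \<open>auto simp: ideal_pow_def\<close>)
  then show ?case using rad_layer_Suc[of "carrier M" 0] by simp
next
  case (step n)
  let ?J = "gr_radical \<Gamma> R"
  note Jc = gr_right_ideal_carrier[OF gr_right_ideal_radical]
  \<comment> \<open>The last factor of J^{n+1} is moved into the target: the elements that J sends
    into K take the place of K at exponent n.\<close>
  let ?K = "{x \<in> carrier M. \<forall>u\<in>?J. x \<triangleleft>\<^bsub>M\<^esub> u \<in> K}"
  have "rad_layer (carrier M) n \<subseteq> ?K"
  proof (rule step.IH)
    fix x p assume x: "x \<in> carrier M" and p: "p \<in> ideal_pow R ?J n"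
    then have pc: "p \<in> carrier R" using ideal_pow_radical step.hyps by blast
    have "x \<triangleleft>\<^bsub>M\<^esub> p \<triangleleft>\<^bsub>M\<^esub> u \<in> K" if u: "u \<in> ?J" for u
      using step.prems(4)[OF x, of "p \<otimes> u"] ideal_prod.prod[OF p u, of R] step.hyps
      by (simp add: ideal_pow_Suc ract_assoc x pc Jc u)
    then show "x \<triangleleft>\<^bsub>M\<^esub> p \<in> ?K" using x pc ract_closed by blast
  next
    show "\<zero>\<^bsub>M\<^esub> \<in> ?K" using step.prems(2) Jc by auto
    show "x \<oplus>\<^bsub>M\<^esub> y \<in> ?K" if "x \<in> ?K" "y \<in> ?K" for x y
      using that step.prems(3) Jc by (auto simp: ract_l_distr)
  qed auto
  then show ?case unfolding rad_layer_Suc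
    by (intro act_prod_subset) (use step.prems in auto)
qed

lemma rad_layer_annihilated:
  assumes "n \<ge> 1" "\<And>p. p \<in> ideal_pow R (gr_radical \<Gamma> R) n \<Longrightarrow> p \<otimes> a = \<zero>" "a \<in> carrier R"
    and "x \<in> rad_layer (carrier M) n"
  shows "x \<triangleleft>\<^bsub>M\<^esub> a = \<zero>\<^bsub>M\<^esub>"
proof -
  have "rad_layer (carrier M) n \<subseteq> {x \<in> carrier M. x \<triangleleft>\<^bsub>M\<^esub> a = \<zero>\<^bsub>M\<^esub>}"
  proof (rule rad_layer_subset[OF assms(1)])
    fix x p assume "x \<in> carrier M" and p: "p \<in> ideal_pow R (gr_radical \<Gamma> R) n"
    moreover have "p \<in> carrier R" using ideal_pow_radical[OF assms(1)] p by blast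
    ultimately show "x \<triangleleft>\<^bsub>M\<^esub> p \<in> {x \<in> carrier M. x \<triangleleft>\<^bsub>M\<^esub> a = \<zero>\<^bsub>M\<^esub>}"
      using ract_assoc[of x p a] assms(2)[OF p] assms(3) ract_closed by simp
  qed (auto simp: ract_l_distr assms(3))
  then show ?thesis using assms(4) by blast
qed

text \<open>A homogeneous element is fixed by the local identity at its domain, so it vanishes if
  all local identities kill it.\<close>

lemma gr_submodule_zero_if_annihilated:
  assumes N: "gr_submodule \<Gamma> R M N"
    and ann: "\<And>x e. x \<in> N \<Longrightarrow> e \<in> units \<Gamma> \<Longrightarrow> x \<triangleleft>\<^bsub>M\<^esub> obj_one R e = \<zero>\<^bsub>M\<^esub>"
  shows "N = {\<zero>\<^bsub>M\<^esub>}"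
proof -
  have "N \<subseteq> {\<zero>\<^bsub>M\<^esub>}"
  proof (rule gr_submodule_le_if_homogeneous[OF N gr_submodule_null], rule subsetI)
    fix \<sigma> x assume s: "\<sigma> \<in> arrows \<Gamma>" and x: "x \<in> N \<inter> grade M \<sigma>"
    then have "x \<triangleleft>\<^bsub>M\<^esub> obj_one R (gdom \<Gamma> \<sigma>) = x" using ract_obj_one by blast
    then show "x \<in> {\<zero>\<^bsub>M\<^esub>}" using ann[of x "gdom \<Gamma> \<sigma>"] dom_unit[OF s] x by simp
  qed
  then show ?thesis using gr_submodule_zero[OF N] by blast
qed

section \<open>Noetherian modules over a right objectwise nilpotent radical\<close>

lemma obj_one_carrier: "e \<in> units \<Gamma> \<Longrightarrow> obj_one R e \<in> carrier R"
  using obj_one_exists[of e] obj_one_eq RC.summand_carrier[OF units_arrow]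
  unfolding is_obj_one_def by metis

text \<open>A maximal finitely generated graded submodule N is all of M: for a homogeneous x, N + x
  R is graded and needs only the extra generator x.\<close>

lemma fin_generated_if_gr_noetherian:
  assumes "gr_noetherian \<Gamma> R M"
  shows "fin_generated R M"
proof -
  \<comment> \<open>Generation is tested against all right submodules K, graded or not, to match
    \<open>gen_submodule\<close>, while the members N are graded so that the noetherian condition
    applies.\<close>
  let ?\<K> = "{N. gr_submodule \<Gamma> R M N \<and>
    (\<exists>X. finite X \<and> X \<subseteq> N \<and> (\<forall>K. right_submodule R M K \<and> X \<subseteq> K \<longrightarrow> N \<subseteq> K))}"
  have null: "{\<zero>\<^bsub>M\<^esub>} \<in> ?\<K>"
    using gr_submodule_null unfolding right_submodule_def M.subgroup_add_monoid_iff
    by (intro CollectI conjI exI[of _ "{}"]) auto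
  have sub: "?\<K> \<subseteq> interval {\<zero>\<^bsub>M\<^esub>} (carrier M)" unfolding interval_full by blast
  obtain N where N: "N \<in> ?\<K>" and max: "\<And>N'. N' \<in> ?\<K> \<Longrightarrow> N \<subseteq> N' \<Longrightarrow> N' = N"
    by (rule acc_maximal[OF assms[unfolded gr_noetherian_iff] sub null]) (rule that)
  obtain X where X: "finite X" "X \<subseteq> N"
    "\<And>K. right_submodule R M K \<Longrightarrow> X \<subseteq> K \<Longrightarrow> N \<subseteq> K" using N by auto
  have gN: "gr_submodule \<Gamma> R M N" using N by blast
  have "carrier M \<subseteq> N"
  proof (rule gr_submodule_le_if_homogeneous[OF gr_submodule_top gN], rule subsetI)
    fix \<sigma> x assume s: "\<sigma> \<in> arrows \<Gamma>" and x: "x \<in> carrier M \<inter> grade M \<sigma>"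
    then have xg: "x \<in> grade M \<sigma>" by blast
    let ?S = "(\<lambda>t. x \<triangleleft>\<^bsub>M\<^esub> t) ` carrier R"
    have "gr_right_ideal \<Gamma> R (carrier R)"
      using reg.gr_submodule_top unfolding gr_right_ideal_def by simp
    then have S: "gr_submodule \<Gamma> R M ?S" by (rule gr_submodule_image_ract[OF s xg])
    note up = set_add_upper[OF gN S]
    have xS: "x \<in> ?S" using homogeneous_mem_orbit[OF s xg] by force
    have "N <+>\<^bsub>M\<^esub> ?S \<subseteq> K" if K: "right_submodule R M K" "insert x X \<subseteq> K" for K
    proof -
      have "N \<subseteq> K" "?S \<subseteq> K" using X(3) K unfolding right_submodule_def by auto
      moreover have "\<And>y z. y \<in> K \<Longrightarrow> z \<in> K \<Longrightarrow> y \<oplus>\<^bsub>M\<^esub> z \<in> K"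
        using K(1) unfolding right_submodule_def M.subgroup_add_monoid_iff by blast
      ultimately show ?thesis unfolding subset_iff mem_set_add_iff by blast
    qed
    moreover have "finite (insert x X)" "insert x X \<subseteq> N <+>\<^bsub>M\<^esub> ?S" using X xS up by auto
    ultimately have "N <+>\<^bsub>M\<^esub> ?S \<in> ?\<K>" using gr_submodule_set_add[OF gN S] by blast
    from max[OF this up(1)] show "x \<in> N" using up(2) xS by blast
  qed
  then have "N = carrier M" using gr_submodule_subset[OF gN] by blast
  then have "gen_submodule R M X = carrier M"
    using X gN unfolding gen_submodule_def gr_submodule_def by blast
  then show ?thesis unfolding fin_generated_def using X(1,2) gr_submodule_subset[OF gN] by blast
qed

lemma rad_layer_zero_if_fin_generated:
  assumes nil: "right_obj_nilpotent \<Gamma> R (gr_radical \<Gamma> R)" and fg: "fin_generated R M"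
  obtains n where "rad_layer (carrier M) n = {\<zero>\<^bsub>M\<^esub>}"
proof -
  let ?P = "ideal_pow R (gr_radical \<Gamma> R)"
  \<comment> \<open>The annihilator of J^n in M. It grows with n because the powers of J decrease.
    Generators of M need not be homogeneous, so it is used as a plain right submodule.\<close>
  define L where "L n = {x \<in> carrier M. \<forall>p\<in>?P n. x \<triangleleft>\<^bsub>M\<^esub> p = \<zero>\<^bsub>M\<^esub>}" for n
  have Pc: "p \<in> carrier R" if "p \<in> ?P n" "n \<ge> 1" for p n using ideal_pow_radical that by blast
  have L_mono: "L m \<subseteq> L n" if "1 \<le> m" "m \<le> n" for m n
    using ideal_pow_radical_antimono[OF that] unfolding L_def by blast
  have L_add: "x \<oplus>\<^bsub>M\<^esub> y \<in> L n" if "x \<in> L n" "y \<in> L n" "n \<ge> 1" for x y n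
    using that Pc unfolding L_def by (simp add: ract_l_distr)
  have L_sub: "right_submodule R M (L n)" if n: "n \<ge> 1" for n
    unfolding right_submodule_def M.subgroup_add_monoid_iff
  proof (intro conjI ballI)
    show "L n \<subseteq> carrier M" unfolding L_def by blast
    show "\<zero>\<^bsub>M\<^esub> \<in> L n" using Pc n unfolding L_def by simp
    show "x \<oplus>\<^bsub>M\<^esub> y \<in> L n" if "x \<in> L n" "y \<in> L n" for x y using L_add that n by blast
    show "\<ominus>\<^bsub>M\<^esub> x \<in> L n" if "x \<in> L n" for x
      using that Pc n unfolding L_def by (simp add: minus_ract)
    show "x \<triangleleft>\<^bsub>M\<^esub> a \<in> L n" if "x \<in> L n" "a \<in> carrier R" for x a
    proof -
      have "x \<triangleleft>\<^bsub>M\<^esub> a \<triangleleft>\<^bsub>M\<^esub> p = \<zero>\<^bsub>M\<^esub>" if p: "p \<in> ?P n" for p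
        using ract_assoc[of x a p] \<open>x \<in> L n\<close> \<open>a \<in> carrier R\<close> Pc[OF p n] p ideal_pow_radical[OF n]
        unfolding L_def by force
      then show ?thesis using that ract_closed unfolding L_def by blast
    qed
  qed
  have all: "\<exists>n\<ge>1. x \<in> L n" if x: "x \<in> carrier M" for x
  proof -
    have "x \<in> {x. \<exists>n\<ge>1. x \<in> L n}"
    proof (rule MC.mem_if_components[OF x])
      show "\<zero>\<^bsub>M\<^esub> \<in> {x. \<exists>n\<ge>1. x \<in> L n}" using Pc[of _ 1] unfolding L_def by auto
      show "y \<oplus>\<^bsub>M\<^esub> z \<in> {x. \<exists>n\<ge>1. x \<in> L n}"
        if y: "y \<in> {x. \<exists>n\<ge>1. x \<in> L n}" and z: "z \<in> {x. \<exists>n\<ge>1. x \<in> L n}" for y z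
      proof -
        obtain m n where mn: "m \<ge> 1" "y \<in> L m" "n \<ge> 1" "z \<in> L n" using y z by blast
        then have "y \<in> L (max m n)" "z \<in> L (max m n)"
          using L_mono[of m "max m n"] L_mono[of n "max m n"] by auto
        then show ?thesis using L_add[of y "max m n" z] mn by (auto intro!: exI[of _ "max m n"])
      qed
      fix \<sigma> assume s: "\<sigma> \<in> arrows \<Gamma>"
      let ?y = "MC.component x \<sigma>" and ?e = "gdom \<Gamma> \<sigma>"
      have y: "?y \<in> grade M \<sigma>" "?y \<in> carrier M"
        using MC.component_mem MC.component_carrier x s by auto
      note o = homogeneous_mem_orbit[OF s y(1)]
      obtain n where n: "n \<ge> 1" "\<forall>p\<in>?P n. obj_one R ?e \<otimes> p = \<zero>"
        using nil dom_unit[OF s] unfolding right_obj_nilpotent_def by blast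
      \<comment> \<open>For y of domain e, y p = (y 1_e) p = y (1_e p) = 0.\<close>
      have "?y \<triangleleft>\<^bsub>M\<^esub> p = \<zero>\<^bsub>M\<^esub>" if p: "p \<in> ?P n" for p
        using ract_assoc[OF y(2) o(1) Pc[OF p n(1)]] n(2) p o(2) y(2) by simp
      then show "?y \<in> {x. \<exists>n\<ge>1. x \<in> L n}" using n(1) y(2) unfolding L_def by blast
    qed
    then show ?thesis by blast
  qed
  obtain X where X: "finite X" "X \<subseteq> carrier M" "gen_submodule R M X = carrier M"
    using fg unfolding fin_generated_def by blast
  have "\<exists>n\<ge>1. X \<subseteq> L n" using X(1,2)
  proof (induction X)
    case (insert x X)
    then obtain m n where mn: "m \<ge> 1" "x \<in> L m" "n \<ge> 1" "X \<subseteq> L n" using all by blast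
    then have "insert x X \<subseteq> L (max m n)"
      using L_mono[of m "max m n"] L_mono[of n "max m n"] by auto
    then show ?case using mn(1) by (intro exI[of _ "max m n"]) auto
  qed auto
  then obtain n where n: "n \<ge> 1" "X \<subseteq> L n" by blast
  then have "gen_submodule R M X \<subseteq> L n" using L_sub unfolding gen_submodule_def by blast
  then have "carrier M \<subseteq> L n" using X(3) by simp
  then have "rad_layer (carrier M) n \<subseteq> {\<zero>\<^bsub>M\<^esub>}"
    by (intro rad_layer_subset[OF n(1)]) (auto simp: L_def)
  then show thesis
    using that gr_submodule_zero[OF gr_submodule_rad_layer[OF gr_submodule_top]] by blast
qed

text \<open>Either side of the equivalence provides finite generation, and then the radical
  filtration terminates and the two chain conditions agree. The cogenerated analogue has the same
  shape.\<close>

lemma gr_noetherian_iff_artinian_fin_generated: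
  assumes "gr_semilocal \<Gamma> R" "right_obj_nilpotent \<Gamma> R (gr_radical \<Gamma> R)"
  shows "gr_noetherian \<Gamma> R M \<longleftrightarrow> gr_artinian \<Gamma> R M \<and> fin_generated R M"
proof -
  have "gr_artinian \<Gamma> R M \<longleftrightarrow> gr_noetherian \<Gamma> R M" if fg: "fin_generated R M"
  proof -
    obtain n where "rad_layer (carrier M) n = {\<zero>\<^bsub>M\<^esub>}"
      by (rule rad_layer_zero_if_fin_generated[OF assms(2) fg])
    then show ?thesis by (rule gr_artinian_iff_noetherian[OF assms(1)])
  qed
  then show ?thesis using fin_generated_if_gr_noetherian by blast
qed

section \<open>Artinian modules over a left objectwise nilpotent radical\<close>

text \<open>A minimal finite intersection W is contained in every member N of the family, since
  intersecting with N gives another finite intersection below W.\<close>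

lemma fin_gr_cogenerated_if_gr_artinian:
  assumes "gr_artinian \<Gamma> R M"
  shows "fin_gr_cogenerated \<Gamma> R M"
  unfolding fin_gr_cogenerated_def
proof (intro allI impI)
  fix \<F> assume F: "\<F> \<subseteq> Collect (gr_submodule \<Gamma> R M) \<and> carrier M \<inter> \<Inter>\<F> = {\<zero>\<^bsub>M\<^esub>}"
  let ?\<K> = "{carrier M \<inter> \<Inter>\<G> | \<G>. \<G> \<subseteq> \<F> \<and> finite \<G>}"
  have "gr_submodule \<Gamma> R M (carrier M \<inter> \<Inter>\<G>)" if "\<G> \<subseteq> \<F>" for \<G>
    by (rule gr_submodule_Inter) (use that F in blast)
  then have sub: "?\<K> \<subseteq> interval {\<zero>\<^bsub>M\<^esub>} (carrier M)" unfolding interval_full by auto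
  have top: "carrier M \<inter> \<Inter>{} \<in> ?\<K>" by blast
  obtain W where W: "W \<in> ?\<K>" and min: "\<And>W'. W' \<in> ?\<K> \<Longrightarrow> W' \<subseteq> W \<Longrightarrow> W' = W"
    by (rule dcc_minimal[OF assms[unfolded gr_artinian_iff] sub top]) (rule that)
  obtain \<G> where G: "\<G> \<subseteq> \<F>" "finite \<G>" "W = carrier M \<inter> \<Inter>\<G>" using W by blast
  have "W \<subseteq> N" if "N \<in> \<F>" for N
  proof -
    have "carrier M \<inter> \<Inter>(insert N \<G>) \<in> ?\<K>" using G that by blast
    then have "carrier M \<inter> \<Inter>(insert N \<G>) = W" by (rule min) (use G in blast)
    then show ?thesis by blast
  qed
  then have "W \<subseteq> {\<zero>\<^bsub>M\<^esub>}" using F G(3) by blast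
  moreover have "\<zero>\<^bsub>M\<^esub> \<in> W" using W sub unfolding interval_def by blast
  ultimately have "W = {\<zero>\<^bsub>M\<^esub>}" by blast
  then show "\<exists>\<G>\<subseteq>\<F>. finite \<G> \<and> carrier M \<inter> \<Inter>\<G> = {\<zero>\<^bsub>M\<^esub>}" using G by blast
qed

text \<open>The exponent may depend on the object e, but lying in all layers allows any exponent: x
  1_e is killed by using the layer that belongs to e.\<close>

lemma gr_submodule_zero_if_below_rad_layers:
  assumes nil: "left_obj_nilpotent \<Gamma> R (gr_radical \<Gamma> R)" and N: "gr_submodule \<Gamma> R M N"
    and "\<And>n. N \<subseteq> rad_layer (carrier M) n"
  shows "N = {\<zero>\<^bsub>M\<^esub>}"
proof (rule gr_submodule_zero_if_annihilated[OF N])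
  fix x e assume x: "x \<in> N" and e: "e \<in> units \<Gamma>"
  obtain n where n: "n \<ge> 1" "\<forall>p\<in>ideal_pow R (gr_radical \<Gamma> R) n. p \<otimes> obj_one R e = \<zero>"
    using nil e unfolding left_obj_nilpotent_def by blast
  show "x \<triangleleft>\<^bsub>M\<^esub> obj_one R e = \<zero>\<^bsub>M\<^esub>"
    by (rule rad_layer_annihilated[OF n(1) _ obj_one_carrier[OF e]]) (use n(2) assms(3) x in auto)
qed

lemma rad_layer_zero_if_fin_gr_cogenerated:
  assumes nil: "left_obj_nilpotent \<Gamma> R (gr_radical \<Gamma> R)" and cog: "fin_gr_cogenerated \<Gamma> R M"
  obtains n where "rad_layer (carrier M) n = {\<zero>\<^bsub>M\<^esub>}"
proof -
  let ?L = "rad_layer (carrier M)"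
  note L = gr_submodule_rad_layer[OF gr_submodule_top]
  have "carrier M \<inter> \<Inter>(range ?L) = {\<zero>\<^bsub>M\<^esub>}"
    by (rule gr_submodule_zero_if_below_rad_layers[OF nil gr_submodule_Inter]) (use L in auto)
  moreover have "range ?L \<subseteq> Collect (gr_submodule \<Gamma> R M)" using L by blast
  ultimately obtain \<G> where G: "\<G> \<subseteq> range ?L" "finite \<G>" "carrier M \<inter> \<Inter>\<G> = {\<zero>\<^bsub>M\<^esub>}"
    using cog unfolding fin_gr_cogenerated_def by meson
  obtain F where F: "finite F" "\<G> = ?L ` F" using finite_subset_image[OF G(2,1)] by blast
  \<comment> \<open>The layers decrease, so the finite intersection contains the one of largest
    index. Inserting 0 covers the empty subfamily, whose intersection is M, the layer of index
    0.\<close>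
  have "?L (Max (insert 0 F)) \<subseteq> ?L k" if "k \<in> F" for k
    using F(1) that by (intro rad_layer_antimono[OF gr_submodule_top]) simp
  then have "?L (Max (insert 0 F)) \<subseteq> {\<zero>\<^bsub>M\<^esub>}"
    using G(3) F(2) gr_submodule_subset[OF L] by blast
  then show thesis using that gr_submodule_zero[OF L] by blast
qed

lemma gr_artinian_iff_noetherian_fin_gr_cogenerated:
  assumes "gr_semilocal \<Gamma> R" "left_obj_nilpotent \<Gamma> R (gr_radical \<Gamma> R)"
  shows "gr_artinian \<Gamma> R M \<longleftrightarrow> gr_noetherian \<Gamma> R M \<and> fin_gr_cogenerated \<Gamma> R M"
proof -
  have "gr_artinian \<Gamma> R M \<longleftrightarrow> gr_noetherian \<Gamma> R M" if cog: "fin_gr_cogenerated \<Gamma> R M"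
  proof -
    obtain n where "rad_layer (carrier M) n = {\<zero>\<^bsub>M\<^esub>}"
      by (rule rad_layer_zero_if_fin_gr_cogenerated[OF assms(2) cog])
    then show ?thesis by (rule gr_artinian_iff_noetherian[OF assms(1)])
  qed
  then show ?thesis using fin_gr_cogenerated_if_gr_artinian by blast
qed

end

section \<open>Objectwise chain conditions\<close>

context graded_module
begin

lemma part_module_graded_module: "e \<in> units \<Gamma> \<Longrightarrow> graded_module \<Gamma> R (part_module \<Gamma> M e)"
  unfolding part_module_def by (rule sub_module_graded_module[OF gr_submodule_part])

lemma part_module_gr_submodule:
  "e \<in> units \<Gamma> \<Longrightarrow>
    gr_submodule \<Gamma> R (part_module \<Gamma> M e) N \<longleftrightarrow> gr_submodule \<Gamma> R M N \<and> N \<subseteq> part \<Gamma> M e"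
  unfolding part_module_def by (rule sub_module_gr_submodule[OF gr_submodule_part])

lemma part_disjoint:
  assumes "x \<in> part \<Gamma> M e" "x \<in> part \<Gamma> M f" "e \<noteq> f"
  shows "x = \<zero>\<^bsub>M\<^esub>"
proof -
  have "x \<in> {\<zero>\<^bsub>M\<^esub>}"
    by (rule MC.mem_if_components) (use assms in \<open>auto simp: part_iff\<close>)
  then show ?thesis by simp
qed

text \<open>Over e no two consecutive members agree, and over any other object all parts are zero,
  so stability holds for trivial reasons. Hence a strict chain inside one M(e) already refutes the
  strong condition.\<close>

lemma obj_stable_chain_in_part:
  assumes "e \<in> units \<Gamma>" "\<And>i. gr_submodule \<Gamma> R M (N i)" "\<And>i. N i \<subseteq> part \<Gamma> M e"
    and "\<And>i. N i \<noteq> N (Suc i)"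
  shows "obj_stable_chain \<Gamma> M N"
  unfolding obj_stable_chain_def part_sub_module[OF assms(2)]
proof (intro ballI allI impI)
  fix f i l assume f: "f \<in> units \<Gamma>" "N i \<inter> part \<Gamma> M f = N (Suc i) \<inter> part \<Gamma> M f" "(1::nat) \<le> l"
  show "N i \<inter> part \<Gamma> M f = N (i + l) \<inter> part \<Gamma> M f"
  proof (cases "f = e")
    case True
    then have "N i = N (Suc i)" using f(2) assms(3) by (simp add: inf_absorb1)
    then show ?thesis using assms(4) by blast
  next
    case False
    have "N j \<inter> part \<Gamma> M f = {\<zero>\<^bsub>M\<^esub>}" for j
    proof -
      have "N j \<inter> part \<Gamma> M f \<subseteq> {\<zero>\<^bsub>M\<^esub>}" using assms(3)[of j] part_disjoint[OF _ _ False] by blast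
      moreover have "\<zero>\<^bsub>M\<^esub> \<in> N j \<inter> part \<Gamma> M f"
        using gr_submodule_zero[OF assms(2)] gr_submodule_zero[OF gr_submodule_part[OF f(1)]]
        by blast
      ultimately show ?thesis by blast
    qed
    then show ?thesis by simp
  qed
qed

lemma obj_artinian_if_strongly:
  assumes "strongly_obj_artinian \<Gamma> R M"
  shows "obj_artinian \<Gamma> R M"
  unfolding obj_artinian_def gr_artinian_def
proof (intro ballI notI)
  fix e assume e: "e \<in> units \<Gamma>"
  assume "\<exists>N. (\<forall>i. gr_submodule \<Gamma> R (part_module \<Gamma> M e) (N i)) \<and> (\<forall>i. N (Suc i) \<subset> N i)"
  then obtain N where N: "\<And>i. gr_submodule \<Gamma> R M (N i)" "\<And>i. N i \<subseteq> part \<Gamma> M e"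
    "\<And>i. N (Suc i) \<subset> N i" using part_module_gr_submodule[OF e] by auto
  then have "N i \<noteq> N (Suc i)" for i by blast
  then have "obj_stable_chain \<Gamma> M N" by (rule obj_stable_chain_in_part[OF e N(1,2)])
  then show False using assms N(1,3) unfolding strongly_obj_artinian_def by blast
qed

lemma obj_noetherian_if_strongly:
  assumes "strongly_obj_noetherian \<Gamma> R M"
  shows "obj_noetherian \<Gamma> R M"
  unfolding obj_noetherian_def gr_noetherian_def
proof (intro ballI notI)
  fix e assume e: "e \<in> units \<Gamma>"
  assume "\<exists>N. (\<forall>i. gr_submodule \<Gamma> R (part_module \<Gamma> M e) (N i)) \<and> (\<forall>i. N i \<subset> N (Suc i))"
  then obtain N where N: "\<And>i. gr_submodule \<Gamma> R M (N i)" "\<And>i. N i \<subseteq> part \<Gamma> M e"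
    "\<And>i. N i \<subset> N (Suc i)" using part_module_gr_submodule[OF e] by auto
  then have "N i \<noteq> N (Suc i)" for i by blast
  then have "obj_stable_chain \<Gamma> M N" by (rule obj_stable_chain_in_part[OF e N(1,2)])
  then show False using assms N(1,3) unfolding strongly_obj_noetherian_def by blast
qed

text \<open>Makes a glued submodule computable object by object; with
  \<open>gr_submodule_subset_iff_parts\<close>, glued chains can be compared over each object
  separately.\<close>

lemma glue_Int_part:
  assumes N: "\<And>e. e \<in> units \<Gamma> \<Longrightarrow> gr_submodule \<Gamma> R M (N e)" and e: "e \<in> units \<Gamma>"
  shows "glue N \<inter> part \<Gamma> M e = N e \<inter> part \<Gamma> M e"
proof (intro equalityI subsetI)
  fix x assume x: "x \<in> glue N \<inter> part \<Gamma> M e"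
  then have xc: "x \<in> carrier M" unfolding glue_def by blast
  have "x \<in> N e"
  proof (rule MC.mem_if_components[OF xc gr_submodule_zero[OF N[OF e]] gr_submodule_add[OF N[OF e]]])
    fix \<gamma> assume g: "\<gamma> \<in> arrows \<Gamma>"
    show "MC.component x \<gamma> \<in> N e"
      using x g gr_submodule_zero[OF N[OF e]] 
      by (cases "gran \<Gamma> \<gamma> = e") (auto simp: glue_def part_iff)
  qed
  then show "x \<in> N e \<inter> part \<Gamma> M e" using x by blast
next
  fix x assume x: "x \<in> N e \<inter> part \<Gamma> M e"
  have "MC.component x \<gamma> \<in> N (gran \<Gamma> \<gamma>)" if g: "\<gamma> \<in> arrows \<Gamma>" for \<gamma>
    using x g gr_submodule_component[OF N[OF e] _ g] gr_submodule_zero[OF N[OF ran_unit[OF g]]]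
    by (cases "gran \<Gamma> \<gamma> = e") (auto simp: part_iff)
  then show "x \<in> glue N \<inter> part \<Gamma> M e"
    using x gr_submodule_carrier[OF N[OF e]] unfolding glue_def by blast
qed

lemma gr_submodule_subset_iff_parts:
  assumes "gr_submodule \<Gamma> R M N" "gr_submodule \<Gamma> R M K"
  shows "N \<subseteq> K \<longleftrightarrow> (\<forall>e\<in>units \<Gamma>. N \<inter> part \<Gamma> M e \<subseteq> K \<inter> part \<Gamma> M e)"
proof
  assume r: "\<forall>e\<in>units \<Gamma>. N \<inter> part \<Gamma> M e \<subseteq> K \<inter> part \<Gamma> M e"
  show "N \<subseteq> K"
  proof (rule gr_submodule_le_if_homogeneous[OF assms], rule subsetI)
    fix \<gamma> x assume g: "\<gamma> \<in> arrows \<Gamma>" and x: "x \<in> N \<inter> grade M \<gamma>"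
    then have "x \<in> part \<Gamma> M (gran \<Gamma> \<gamma>)"
      using MC.summand_carrier MC.component_homogeneous by (auto simp: part_iff)
    then show "x \<in> K" using r ran_unit[OF g] x by blast
  qed
qed blast

text \<open>If the parts \<open>N i (e)\<close> of a chain become constant at stage \<open>k e\<close>, then running each part
  backwards from its last stage, \<open>i \<mapsto> N (k e - i) (e)\<close> with truncated subtraction, reverses the
  chain while keeping it objectwise stable.\<close>

lemma reversed_chain:
  assumes N: "\<And>i. gr_submodule \<Gamma> R M (N i)" and stable: "obj_stable_chain \<Gamma> M N"
    and neq: "\<And>i. N i \<noteq> N (Suc i)"
    and stops: "\<And>e. e \<in> units \<Gamma> \<Longrightarrow> \<exists>i. N i \<inter> part \<Gamma> M e = N (Suc i) \<inter> part \<Gamma> M e"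
  obtains P where "\<And>i. gr_submodule \<Gamma> R M (P i)" "obj_stable_chain \<Gamma> M P"
    "\<And>i. P i \<noteq> P (Suc i)"
    "(\<forall>i. N i \<subseteq> N (Suc i)) \<longrightarrow> (\<forall>i. P (Suc i) \<subseteq> P i)"
    "(\<forall>i. N (Suc i) \<subseteq> N i) \<longrightarrow> (\<forall>i. P i \<subseteq> P (Suc i))"
proof -
  let ?at = "\<lambda>i e. N i \<inter> part \<Gamma> M e"
  \<comment> \<open>The first repetition over e; by stability the part over e is constant from there
    on, and by minimality it changes at every earlier step.\<close>
  define k where "k e = (LEAST i. ?at i e = ?at (Suc i) e)" for e
  define P where "P i = glue (\<lambda>e. N (k e - i))" for i
  have P: "gr_submodule \<Gamma> R M (P i)" for i
    unfolding P_def by (rule gr_submodule_glue) (rule N)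
  have P_at: "P i \<inter> part \<Gamma> M e = ?at (k e - i) e" if "e \<in> units \<Gamma>" for i e
    unfolding P_def using glue_Int_part[of "\<lambda>e. N (k e - i)"] N that by blast
  have k_eq: "?at (k e) e = ?at (Suc (k e)) e" if "e \<in> units \<Gamma>" for e
    unfolding k_def by (rule LeastI_ex) (rule stops[OF that])
  have k_neq: "?at i e \<noteq> ?at (Suc i) e" if "i < k e" for i e
    using not_less_Least[of i] that unfolding k_def by blast
  have const: "?at i e = ?at (Suc i) e" if e: "e \<in> units \<Gamma>" and i: "k e \<le> i" for i e
  proof -
    have st: "?at (k e) e = ?at (k e + l) e" if "1 \<le> l" for l
      using stable k_eq[OF e] e that unfolding obj_stable_chain_def part_sub_module[OF N] by blast
    have "?at (k e) e = ?at j e" if "k e \<le> j" for j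
      using st[of "j - k e"] that by (cases "j = k e") auto
    then show ?thesis using i by (metis le_SucI)
  qed
  have P_neq: "P i \<inter> part \<Gamma> M e \<noteq> P (Suc i) \<inter> part \<Gamma> M e" if "e \<in> units \<Gamma>" "i < k e" for i e
    using k_neq[of "k e - Suc i" e] that by (auto simp: P_at Suc_diff_Suc)
  have stableP: "obj_stable_chain \<Gamma> M P"
    unfolding obj_stable_chain_def part_sub_module[OF P]
  proof (intro ballI allI impI)
    fix e i l assume e: "e \<in> units \<Gamma>" "P i \<inter> part \<Gamma> M e = P (Suc i) \<inter> part \<Gamma> M e"
    \<comment> \<open>A repetition of P over e can occur only once i has reached k e; from then on
      truncated subtraction gives index 0, so the part of P stays that of N_0.\<close>
    then have "k e \<le> i" using P_neq not_less by blast
    then show "P i \<inter> part \<Gamma> M e = P (i + l) \<inter> part \<Gamma> M e" by (simp add: P_at e(1))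
  qed
  have neqP: "P i \<noteq> P (Suc i)" for i
  proof -
    \<comment> \<open>If N_i and N_{i+1} differ over e, then i < k e, so P also changes at step i
      over this same e. Thus each step of P is a proper one.\<close>
    have "\<exists>e\<in>units \<Gamma>. ?at i e \<noteq> ?at (Suc i) e"
      using neq[of i] gr_submodule_subset_iff_parts[OF N N] by blast
    then obtain e where e: "e \<in> units \<Gamma>" "i < k e" using const not_less by blast
    then show ?thesis using P_neq by metis
  qed
  have down: "P (Suc i) \<subseteq> P i" if "\<forall>i. N i \<subseteq> N (Suc i)" for i
    unfolding gr_submodule_subset_iff_parts[OF P P]
  proof
    fix e assume e: "e \<in> units \<Gamma>"
    have "N (k e - Suc i) \<subseteq> N (k e - i)"
      by (rule lift_Suc_mono_le[of N, OF that[rule_format]]) simp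
    then show "P (Suc i) \<inter> part \<Gamma> M e \<subseteq> P i \<inter> part \<Gamma> M e"
      using e by (auto simp: P_at)
  qed
  have up: "P i \<subseteq> P (Suc i)" if "\<forall>i. N (Suc i) \<subseteq> N i" for i
    unfolding gr_submodule_subset_iff_parts[OF P P]
  proof
    fix e assume e: "e \<in> units \<Gamma>"
    have "N (k e - i) \<subseteq> N (k e - Suc i)"
      by (rule lift_Suc_antimono_le[of N, OF that[rule_format]]) simp
    then show "P i \<inter> part \<Gamma> M e \<subseteq> P (Suc i) \<inter> part \<Gamma> M e"
      using e by (auto simp: P_at)
  qed
  show thesis
    by (rule that[OF P stableP neqP]) (use down up in auto)
qed

text \<open>For an ascending chain the repetitions needed to reverse it come from
  \<open>noeth\<close>, for a descending one from \<open>art\<close>; the reversed chain then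
  violates the strong condition of the opposite direction.\<close>

lemma strongly_obj_artinian_iff_noetherian:
  assumes art: "obj_artinian \<Gamma> R M" and noeth: "obj_noetherian \<Gamma> R M"
  shows "strongly_obj_artinian \<Gamma> R M \<longleftrightarrow> strongly_obj_noetherian \<Gamma> R M"
proof
  assume sart: "strongly_obj_artinian \<Gamma> R M"
  show "strongly_obj_noetherian \<Gamma> R M" unfolding strongly_obj_noetherian_def
  proof
    assume "\<exists>N. (\<forall>i. gr_submodule \<Gamma> R M (N i)) \<and> (\<forall>i. N i \<subset> N (Suc i)) \<and> obj_stable_chain \<Gamma> M N"
    then obtain N where N: "\<And>i. gr_submodule \<Gamma> R M (N i)" "\<And>i. N i \<subset> N (Suc i)"
      "obj_stable_chain \<Gamma> M N" by blast
    have stops: "\<exists>i. N i \<inter> part \<Gamma> M e = N (Suc i) \<inter> part \<Gamma> M e" if e: "e \<in> units \<Gamma>" for e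
    proof (rule ccontr)
      assume "\<not> ?thesis"
      then have "N i \<inter> part \<Gamma> M e \<subset> N (Suc i) \<inter> part \<Gamma> M e" for i using N(2)[of i] by blast
      moreover have "gr_submodule \<Gamma> R (part_module \<Gamma> M e) (N i \<inter> part \<Gamma> M e)" for i
        unfolding part_module_gr_submodule[OF e]
        using gr_submodule_Int[OF N(1) gr_submodule_part[OF e]] by blast
      ultimately have "\<not> gr_noetherian \<Gamma> R (part_module \<Gamma> M e)"
        unfolding gr_noetherian_def not_not by (intro exI[of _ "\<lambda>i. N i \<inter> part \<Gamma> M e"]) auto
      then show False using noeth e unfolding obj_noetherian_def by blast
    qed
    have neq: "N i \<noteq> N (Suc i)" for i using N(2) by blast
    obtain P where "\<And>i. gr_submodule \<Gamma> R M (P i)" "obj_stable_chain \<Gamma> M P" "\<And>i. P i \<noteq> P (Suc i)"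
      "(\<forall>i. N i \<subseteq> N (Suc i)) \<longrightarrow> (\<forall>i. P (Suc i) \<subseteq> P i)"
      "(\<forall>i. N (Suc i) \<subseteq> N i) \<longrightarrow> (\<forall>i. P i \<subseteq> P (Suc i))"
      by (rule reversed_chain[OF N(1,3) neq stops]) (assumption, rule that)
    moreover from this have "P (Suc i) \<subset> P i" for i using N(2) by blast
    ultimately show False using sart unfolding strongly_obj_artinian_def by blast
  qed
next
  assume snoeth: "strongly_obj_noetherian \<Gamma> R M"
  show "strongly_obj_artinian \<Gamma> R M" unfolding strongly_obj_artinian_def
  proof
    assume "\<exists>N. (\<forall>i. gr_submodule \<Gamma> R M (N i)) \<and> (\<forall>i. N (Suc i) \<subset> N i) \<and> obj_stable_chain \<Gamma> M N"
    then obtain N where N: "\<And>i. gr_submodule \<Gamma> R M (N i)" "\<And>i. N (Suc i) \<subset> N i"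
      "obj_stable_chain \<Gamma> M N" by blast
    have stops: "\<exists>i. N i \<inter> part \<Gamma> M e = N (Suc i) \<inter> part \<Gamma> M e" if e: "e \<in> units \<Gamma>" for e
    proof (rule ccontr)
      assume "\<not> ?thesis"
      then have "N (Suc i) \<inter> part \<Gamma> M e \<subset> N i \<inter> part \<Gamma> M e" for i using N(2)[of i] by blast
      moreover have "gr_submodule \<Gamma> R (part_module \<Gamma> M e) (N i \<inter> part \<Gamma> M e)" for i
        unfolding part_module_gr_submodule[OF e]
        using gr_submodule_Int[OF N(1) gr_submodule_part[OF e]] by blast
      ultimately have "\<not> gr_artinian \<Gamma> R (part_module \<Gamma> M e)"
        unfolding gr_artinian_def not_not by (intro exI[of _ "\<lambda>i. N i \<inter> part \<Gamma> M e"]) auto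
      then show False using art e unfolding obj_artinian_def by blast
    qed
    have neq: "N i \<noteq> N (Suc i)" for i using N(2) by blast
    obtain P where "\<And>i. gr_submodule \<Gamma> R M (P i)" "obj_stable_chain \<Gamma> M P" "\<And>i. P i \<noteq> P (Suc i)"
      "(\<forall>i. N i \<subseteq> N (Suc i)) \<longrightarrow> (\<forall>i. P (Suc i) \<subseteq> P i)"
      "(\<forall>i. N (Suc i) \<subseteq> N i) \<longrightarrow> (\<forall>i. P i \<subseteq> P (Suc i))"
      by (rule reversed_chain[OF N(1,3) neq stops]) (assumption, rule that)
    moreover from this have "P i \<subset> P (Suc i)" for i using N(2) by blast
    ultimately show False using snoeth unfolding strongly_obj_noetherian_def by blast
  qed
qed

lemma obj_noetherian_iff_artinian_fin_generated:
  assumes "gr_semilocal \<Gamma> R" "right_obj_nilpotent \<Gamma> R (gr_radical \<Gamma> R)"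
  shows "obj_noetherian \<Gamma> R M \<longleftrightarrow> obj_artinian \<Gamma> R M \<and> obj_fin_generated \<Gamma> R M"
  unfolding obj_noetherian_def obj_artinian_def obj_fin_generated_def
  using graded_module.gr_noetherian_iff_artinian_fin_generated[OF part_module_graded_module assms]
  by blast

lemma obj_artinian_iff_noetherian_fin_gr_cogenerated:
  assumes "gr_semilocal \<Gamma> R" "left_obj_nilpotent \<Gamma> R (gr_radical \<Gamma> R)"
  shows "obj_artinian \<Gamma> R M \<longleftrightarrow> obj_noetherian \<Gamma> R M \<and> obj_fin_gr_cogenerated \<Gamma> R M"
  unfolding obj_noetherian_def obj_artinian_def obj_fin_gr_cogenerated_def
  using graded_module.gr_artinian_iff_noetherian_fin_gr_cogenerated[OF
      part_module_graded_module assms]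
  by blast

end

theorem theorem5p6:
  fixes \<Gamma> :: "'g groupoid" and R :: "('g, 'r) gr_ring" and M :: "('g, 'r, 'm) gr_module"
  assumes "groupoid \<Gamma>" and "graded_ring \<Gamma> R" and "graded_module \<Gamma> R M"
  shows "(gr_semilocal \<Gamma> R \<and> right_obj_nilpotent \<Gamma> R (gr_radical \<Gamma> R) \<longrightarrow>
      (gr_noetherian \<Gamma> R M \<longleftrightarrow> gr_artinian \<Gamma> R M \<and> fin_generated R M) \<and>
      (obj_noetherian \<Gamma> R M \<longleftrightarrow> obj_artinian \<Gamma> R M \<and> obj_fin_generated \<Gamma> R M) \<and>
      (strongly_obj_noetherian \<Gamma> R M \<longleftrightarrow>
        strongly_obj_artinian \<Gamma> R M \<and> obj_fin_generated \<Gamma> R M)) \<and>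
    (gr_semilocal \<Gamma> R \<and> left_obj_nilpotent \<Gamma> R (gr_radical \<Gamma> R) \<longrightarrow>
      (gr_artinian \<Gamma> R M \<longleftrightarrow> gr_noetherian \<Gamma> R M \<and> fin_gr_cogenerated \<Gamma> R M) \<and>
      (obj_artinian \<Gamma> R M \<longleftrightarrow> obj_noetherian \<Gamma> R M \<and> obj_fin_gr_cogenerated \<Gamma> R M) \<and>
      (strongly_obj_artinian \<Gamma> R M \<longleftrightarrow>
        strongly_obj_noetherian \<Gamma> R M \<and> obj_fin_gr_cogenerated \<Gamma> R M))"
proof -
  interpret graded_module \<Gamma> R M by (rule assms(3))
  \<comment> \<open>In the strong equivalences each side implies both objectwise chain conditions:
    one because strong implies objectwise, the other by the objectwise equivalence. The comparison
    of the two strong conditions then applies.\<close>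
  show ?thesis
    using gr_noetherian_iff_artinian_fin_generated obj_noetherian_iff_artinian_fin_generated
      gr_artinian_iff_noetherian_fin_gr_cogenerated
      obj_artinian_iff_noetherian_fin_gr_cogenerated
      strongly_obj_artinian_iff_noetherian obj_artinian_if_strongly obj_noetherian_if_strongly
    by argo
qed

end
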